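(* The theory $\mathbf{SPOT}+\mathbf B+\mathbf{BI}'$ is a conservative extension of $\mathbf{ZF}$; that is, for every sentence $\theta$ in the $\in$-language, if $\mathbf{SPOT}+\mathbf B+\mathbf{BI}'\vdash\theta$ then $\mathbf{ZF}\vdash\theta$.
   Context: The $\mathrm{st}$-$\in$-language extends the $\in$-language of set theory by a unary predicate $\mathrm{st}$ ($\mathrm{st}(x)$ reads "$x$ is standard"). An $\in$-formula is a formula not involving $\mathrm{st}$; an $\mathrm{st}$-$\in$-formula may involve it. $\forall$ and $\exists$ are quantifiers over sets; $\forall^{\mathrm{st}}$ and $\exists^{\mathrm{st}}$ are quantifiers over standard sets; $\forall^{\mathrm{st\,fin}}$ is the universal quantifier over standard finite sets. $\mathbf{ZF}$ is Zermelo–Fraenkel set theory without Choice (when part of a theory in the $\mathrm{st}$-$\in$-language, its Separation and Replacement schemas are for $\in$-formulas only). $\mathbb N$ is the set of natural numbers. $\mathbf{SPOT}$ is the theory in the $\mathrm{st}$-$\in$-language with the axioms: - $\mathbf{ZF}$; - Transfer ($\mathbf T$): for each $\in$-formula $\phi$ with standard parameters, $\forall^{\mathrm{st}}x\,\phi(x)\rightarrow\forall x\,\phi(x)$; - Nontriviality ($\mathbf O$): $\exists\nu\in\mathbb N\ \forall^{\mathrm{st}}n\in\mathbb N\ (n\neq\nu)$; - Standard Part ($\mathbf{SP}'$): $\forall A\subseteq\mathbb N\ \exists^{\mathrm{st}}B\subseteq\mathbb N\ \forall^{\mathrm{st}}n\in\mathbb N\ (n\in B\leftrightarrow n\in A)$.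 $\mathbf B$ (Boundedness) is the axiom $\forall x\ \exists^{\mathrm{st}}y\ (x\in y)$. $\mathbf{BI}'$ is Bounded Idealization for $\in$-formulas with standard parameters, i.e. the schema: let $\phi$ be an $\in$-formula with standard parameters; for every set $A$, $$\forall^{\mathrm{st\,fin}}a\subseteq A\ \exists y\ \forall x\in a\ \phi(x,y)\ \leftrightarrow\ \exists y\ \forall^{\mathrm{st}}x\in A\ \phi(x,y).$$ *)

theory Defs
  imports Main
begin

text \<open>
  Formulas of the st-\<open>\<in>\<close>-language in de Bruijn notation.  Variables are the only terms, so a
  term is just an index and substitution is a renaming of indices.  A free index \<open>n\<close> that
  occurs below \<open>k\<close> quantifiers is written \<open>n + k\<close>.
\<close>

datatype fm =
    Mem nat nat  (infix "\<^bold>\<in>" 50)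
  | Eq nat nat  (infix "\<^bold>=" 50)
  | St nat
  | Falsum
  | Imp fm fm  (infixr "\<^bold>\<longrightarrow>" 25)
  | Forall fm

abbreviation Neg :: "fm \<Rightarrow> fm" ("\<^bold>\<not> _" [40] 40) where
  "\<^bold>\<not> p \<equiv> p \<^bold>\<longrightarrow> Falsum"

abbreviation Conj :: "fm \<Rightarrow> fm \<Rightarrow> fm" (infixr "\<^bold>\<and>" 35) where
  "p \<^bold>\<and> q \<equiv> \<^bold>\<not> (p \<^bold>\<longrightarrow> \<^bold>\<not> q)"

abbreviation Disj :: "fm \<Rightarrow> fm \<Rightarrow> fm" (infixr "\<^bold>\<or>" 30) where
  "p \<^bold>\<or> q \<equiv> \<^bold>\<not> p \<^bold>\<longrightarrow> q"

abbreviation Iff :: "fm \<Rightarrow> fm \<Rightarrow> fm" (infix "\<^bold>\<longleftrightarrow>" 25) where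
  "p \<^bold>\<longleftrightarrow> q \<equiv> (p \<^bold>\<longrightarrow> q) \<^bold>\<and> (q \<^bold>\<longrightarrow> p)"

abbreviation Exists :: "fm \<Rightarrow> fm" where
  "Exists p \<equiv> \<^bold>\<not> Forall (\<^bold>\<not> p)"

abbreviation AllIn :: "nat \<Rightarrow> fm \<Rightarrow> fm" where
  "AllIn a p \<equiv> Forall (0 \<^bold>\<in> Suc a \<^bold>\<longrightarrow> p)"

abbreviation ExIn :: "nat \<Rightarrow> fm \<Rightarrow> fm" where
  "ExIn a p \<equiv> Exists (0 \<^bold>\<in> Suc a \<^bold>\<and> p)"

abbreviation AllSt :: "fm \<Rightarrow> fm" where
  "AllSt p \<equiv> Forall (St 0 \<^bold>\<longrightarrow> p)"

abbreviation ExSt :: "fm \<Rightarrow> fm" where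
  "ExSt p \<equiv> Exists (St 0 \<^bold>\<and> p)"

primrec eps_formula :: "fm \<Rightarrow> bool" where
  "eps_formula (i \<^bold>\<in> j) = True"
| "eps_formula (i \<^bold>= j) = True"
| "eps_formula (St i) = False"
| "eps_formula Falsum = True"
| "eps_formula (p \<^bold>\<longrightarrow> q) = (eps_formula p \<and> eps_formula q)"
| "eps_formula (Forall p) = eps_formula p"

text \<open>The least \<open>n\<close> such that all free indices are below \<open>n\<close>.\<close>

primrec fv_bound :: "fm \<Rightarrow> nat" where
  "fv_bound (i \<^bold>\<in> j) = Suc (max i j)"
| "fv_bound (i \<^bold>= j) = Suc (max i j)"
| "fv_bound (St i) = Suc i"
| "fv_bound Falsum = 0"
| "fv_bound (p \<^bold>\<longrightarrow> q) = max (fv_bound p) (fv_bound q)"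
| "fv_bound (Forall p) = fv_bound p - 1"

definition sentence :: "fm \<Rightarrow> bool" where
  "sentence p \<longleftrightarrow> fv_bound p = 0"

definition closure :: "fm \<Rightarrow> fm" where
  "closure p = (Forall ^^ fv_bound p) p"

text \<open>Closure under quantifiers over standard sets: the free indices are standard parameters.\<close>

definition st_closure :: "fm \<Rightarrow> fm" where
  "st_closure p = (AllSt ^^ fv_bound p) p"

primrec ren :: "(nat \<Rightarrow> nat) \<Rightarrow> fm \<Rightarrow> fm" where
  "ren f (i \<^bold>\<in> j) = (f i \<^bold>\<in> f j)"
| "ren f (i \<^bold>= j) = (f i \<^bold>= f j)"
| "ren f (St i) = St (f i)"
| "ren f Falsum = Falsum"
| "ren f (p \<^bold>\<longrightarrow> q) = (ren f p \<^bold>\<longrightarrow> ren f q)"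
| "ren f (Forall p) = Forall (ren (case_nat 0 (\<lambda>n. Suc (f n))) p)"

definition inst :: "fm \<Rightarrow> nat \<Rightarrow> fm" where
  "inst p t = ren (case_nat t (\<lambda>n. n)) p"

text \<open>
  \<open>lift_from k d p\<close> makes room for \<open>d\<close> new quantifiers directly outside the \<open>k\<close> innermost ones.
\<close>

definition lift_from :: "nat \<Rightarrow> nat \<Rightarrow> fm \<Rightarrow> fm" where
  "lift_from k d p = ren (\<lambda>n. if n < k then n else n + d) p"

text \<open>
  A Hilbert calculus for classical first-order logic with equality.  All formulas in a derivation
  belong to the language \<open>L\<close>.  Unrestricted generalization is sound because it is only used with
  theories \<open>T\<close> that consist of sentences.
\<close>

inductive derivable :: "fm set \<Rightarrow> fm set \<Rightarrow> fm \<Rightarrow> bool" for L :: "fm set" and T :: "fm set" where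
  Axiom: "p \<in> T \<Longrightarrow> p \<in> L \<Longrightarrow> derivable L T p"
| K: "(p \<^bold>\<longrightarrow> q \<^bold>\<longrightarrow> p) \<in> L \<Longrightarrow> derivable L T (p \<^bold>\<longrightarrow> q \<^bold>\<longrightarrow> p)"
| S: "((p \<^bold>\<longrightarrow> q \<^bold>\<longrightarrow> r) \<^bold>\<longrightarrow> (p \<^bold>\<longrightarrow> q) \<^bold>\<longrightarrow> p \<^bold>\<longrightarrow> r) \<in> L \<Longrightarrow>
    derivable L T ((p \<^bold>\<longrightarrow> q \<^bold>\<longrightarrow> r) \<^bold>\<longrightarrow> (p \<^bold>\<longrightarrow> q) \<^bold>\<longrightarrow> p \<^bold>\<longrightarrow> r)"
| Double_neg: "(\<^bold>\<not> \<^bold>\<not> p \<^bold>\<longrightarrow> p) \<in> L \<Longrightarrow> derivable L T (\<^bold>\<not> \<^bold>\<not> p \<^bold>\<longrightarrow> p)"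
| Inst: "(Forall p \<^bold>\<longrightarrow> inst p t) \<in> L \<Longrightarrow> derivable L T (Forall p \<^bold>\<longrightarrow> inst p t)"
| Dist: "(Forall (p \<^bold>\<longrightarrow> q) \<^bold>\<longrightarrow> Forall p \<^bold>\<longrightarrow> Forall q) \<in> L \<Longrightarrow>
    derivable L T (Forall (p \<^bold>\<longrightarrow> q) \<^bold>\<longrightarrow> Forall p \<^bold>\<longrightarrow> Forall q)"
| Vacuous: "(p \<^bold>\<longrightarrow> Forall (lift_from 0 1 p)) \<in> L \<Longrightarrow>
    derivable L T (p \<^bold>\<longrightarrow> Forall (lift_from 0 1 p))"
| Refl: "(i \<^bold>= i) \<in> L \<Longrightarrow> derivable L T (i \<^bold>= i)"
| Leibniz: "(i \<^bold>= j \<^bold>\<longrightarrow> inst p i \<^bold>\<longrightarrow> inst p j) \<in> L \<Longrightarrow>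
    derivable L T (i \<^bold>= j \<^bold>\<longrightarrow> inst p i \<^bold>\<longrightarrow> inst p j)"
| MP: "derivable L T (p \<^bold>\<longrightarrow> q) \<Longrightarrow> derivable L T p \<Longrightarrow> derivable L T q"
| Gen: "derivable L T p \<Longrightarrow> Forall p \<in> L \<Longrightarrow> derivable L T (Forall p)"

definition proves_eps :: "fm set \<Rightarrow> fm \<Rightarrow> bool" (infix "\<turnstile>\<^sub>\<in>" 50) where
  "T \<turnstile>\<^sub>\<in> p \<longleftrightarrow> derivable {q. eps_formula q} T p"

definition proves_st :: "fm set \<Rightarrow> fm \<Rightarrow> bool" (infix "\<turnstile>\<^sub>s\<^sub>t" 50) where
  "T \<turnstile>\<^sub>s\<^sub>t p \<longleftrightarrow> derivable UNIV T p"


definition subset_fm :: "nat \<Rightarrow> nat \<Rightarrow> fm" where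
  "subset_fm a b = AllIn a (0 \<^bold>\<in> Suc b)"

definition empty_fm :: "nat \<Rightarrow> fm" where
  "empty_fm a = Forall (\<^bold>\<not> 0 \<^bold>\<in> Suc a)"

text \<open>\<open>y = x \<union> {x}\<close>\<close>

definition succ_fm :: "nat \<Rightarrow> nat \<Rightarrow> fm" where
  "succ_fm y x = Forall (0 \<^bold>\<in> Suc y \<^bold>\<longleftrightarrow> (0 \<^bold>\<in> Suc x \<^bold>\<or> 0 \<^bold>= Suc x))"

definition inductive_fm :: "nat \<Rightarrow> fm" where
  "inductive_fm w = (ExIn w (empty_fm 0) \<^bold>\<and> AllIn w (ExIn (Suc w) (succ_fm 0 1)))"

text \<open>\<open>w\<close> is the set of natural numbers, i.e. the least inductive set.\<close>

definition Nat_fm :: "nat \<Rightarrow> fm" where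
  "Nat_fm w = (inductive_fm w \<^bold>\<and> Forall (inductive_fm 0 \<^bold>\<longrightarrow> subset_fm (Suc w) 0))"

text \<open>\<open>p = {a, b}\<close>\<close>

definition upair_fm :: "nat \<Rightarrow> nat \<Rightarrow> nat \<Rightarrow> fm" where
  "upair_fm p a b = Forall (0 \<^bold>\<in> Suc p \<^bold>\<longleftrightarrow> (0 \<^bold>= Suc a \<^bold>\<or> 0 \<^bold>= Suc b))"

text \<open>\<open>p = {{a}, {a, b}}\<close>\<close>

definition opair_fm :: "nat \<Rightarrow> nat \<Rightarrow> nat \<Rightarrow> fm" where
  "opair_fm p a b =
    Exists (Exists (upair_fm 1 (a + 2) (a + 2) \<^bold>\<and> upair_fm 0 (a + 2) (b + 2) \<^bold>\<and> upair_fm (p + 2) 1 0))"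

definition related_fm :: "nat \<Rightarrow> nat \<Rightarrow> nat \<Rightarrow> fm" where
  "related_fm f a b = ExIn f (opair_fm 0 (a + 1) (b + 1))"

text \<open>There is exactly one \<open>x \<in> a\<close> with \<open>p\<close>: for some \<open>x\<close>, all \<open>z\<close> satisfy \<open>z \<in> a \<and> p z \<longleftrightarrow> z = x\<close>.\<close>

definition Ex1In :: "nat \<Rightarrow> fm \<Rightarrow> fm" where
  "Ex1In a p = Exists (Forall ((0 \<^bold>\<in> a + 2 \<^bold>\<and> lift_from 1 1 p) \<^bold>\<longleftrightarrow> 0 \<^bold>= 1))"

text \<open>\<open>f\<close> is a bijection from \<open>n\<close> onto \<open>a\<close>.\<close>

definition bij_fm :: "nat \<Rightarrow> nat \<Rightarrow> nat \<Rightarrow> fm" where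
  "bij_fm f n a =
    (AllIn f (ExIn (n + 1) (ExIn (a + 2) (opair_fm 2 1 0))) \<^bold>\<and>
     AllIn n (Ex1In (a + 1) (related_fm (f + 2) 1 0)) \<^bold>\<and>
     AllIn a (Ex1In (n + 1) (related_fm (f + 2) 0 1)))"

definition finite_fm :: "nat \<Rightarrow> fm" where
  "finite_fm a = Exists (Nat_fm 0 \<^bold>\<and> ExIn 0 (Exists (bij_fm 0 1 (a + 3))))"


definition Extensionality :: fm where
  "Extensionality = Forall (Forall (Forall (0 \<^bold>\<in> 2 \<^bold>\<longleftrightarrow> 0 \<^bold>\<in> 1) \<^bold>\<longrightarrow> 1 \<^bold>= 0))"

definition Foundation :: fm where
  "Foundation = Forall (Exists (0 \<^bold>\<in> 1) \<^bold>\<longrightarrow> ExIn 0 (\<^bold>\<not> ExIn 0 (0 \<^bold>\<in> 2)))"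

definition Pairing :: fm where
  "Pairing = Forall (Forall (Exists (upair_fm 0 2 1)))"

definition Union :: fm where
  "Union = Forall (Exists (Forall (0 \<^bold>\<in> 1 \<^bold>\<longleftrightarrow> ExIn 2 (1 \<^bold>\<in> 0))))"

definition Power_Set :: fm where
  "Power_Set = Forall (Exists (Forall (0 \<^bold>\<in> 1 \<^bold>\<longleftrightarrow> subset_fm 0 2)))"

definition Infinity :: fm where
  "Infinity = Exists (inductive_fm 0)"

text \<open>
  In Separation and Transfer, index 0 of \<open>\<phi>\<close> is \<open>x\<close>; in Replacement and Bounded Idealization,
  indices 0 and 1 are \<open>x\<close> and \<open>y\<close>.  The remaining free indices of \<open>\<phi>\<close> are the parameters.
\<close>

definition Separation :: "fm \<Rightarrow> fm" where
  "Separation \<phi> =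
    closure (Forall (Exists (Forall (0 \<^bold>\<in> 1 \<^bold>\<longleftrightarrow> (0 \<^bold>\<in> 2 \<^bold>\<and> lift_from 1 2 \<phi>)))))"

text \<open>
  Replacement: if \<open>\<phi>(x,y) \<and> \<phi>(x,z) \<longrightarrow> y = z\<close> for all \<open>x, y, z\<close>, then for every \<open>A\<close> there is
  \<open>B\<close> such that \<open>y \<in> B \<longleftrightarrow> (\<exists>x\<in>A. \<phi>(x,y))\<close> for all \<open>y\<close>.  In the premise the quantifier prefix
  is \<open>z, y, x\<close> from the outside.
\<close>

definition Replacement :: "fm \<Rightarrow> fm" where
  "Replacement \<phi> =
    closure
      (Forall (Forall (Forall
         (lift_from 2 1 \<phi> \<^bold>\<and> ren (\<lambda>n. if n = 0 then 0 else n + 1) \<phi> \<^bold>\<longrightarrow> 1 \<^bold>= 2)))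
       \<^bold>\<longrightarrow> Forall (Exists (Forall (0 \<^bold>\<in> 1 \<^bold>\<longleftrightarrow> ExIn 2 (lift_from 2 2 \<phi>)))))"

definition ZF :: "fm set" where
  "ZF = {Extensionality, Foundation, Pairing, Union, Power_Set, Infinity}
    \<union> {Separation \<phi> |\<phi>. eps_formula \<phi>} \<union> {Replacement \<phi> |\<phi>. eps_formula \<phi>}"

definition Transfer :: "fm \<Rightarrow> fm" where
  "Transfer \<phi> = st_closure (AllSt \<phi> \<^bold>\<longrightarrow> Forall \<phi>)"

definition Nontriviality :: fm where
  "Nontriviality =
    Exists (Nat_fm 0 \<^bold>\<and> ExIn 0 (AllSt (0 \<^bold>\<in> 2 \<^bold>\<longrightarrow> \<^bold>\<not> 0 \<^bold>= 1)))"

definition Standard_Part :: fm where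
  "Standard_Part =
    Exists (Nat_fm 0 \<^bold>\<and>
      Forall (subset_fm 0 1 \<^bold>\<longrightarrow>
        ExSt (subset_fm 0 2 \<^bold>\<and> AllSt (0 \<^bold>\<in> 3 \<^bold>\<longrightarrow> (0 \<^bold>\<in> 1 \<^bold>\<longleftrightarrow> 0 \<^bold>\<in> 2)))))"

definition SPOT :: "fm set" where
  "SPOT = ZF \<union> {Transfer \<phi> |\<phi>. eps_formula \<phi>} \<union> {Nontriviality, Standard_Part}"

definition Boundedness :: fm where
  "Boundedness = Forall (ExSt (1 \<^bold>\<in> 0))"

text \<open>
  The parameters of \<open>\<phi>\<close> are standard, but the set \<open>A\<close> (the outermost quantifier inside the
  closure) is arbitrary.
\<close>

definition Bounded_Idealization :: "fm \<Rightarrow> fm" where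
  "Bounded_Idealization \<phi> =
    st_closure (Forall
      (AllSt (finite_fm 0 \<^bold>\<and> subset_fm 0 1 \<^bold>\<longrightarrow> Exists (AllIn 1 (lift_from 2 2 \<phi>)))
       \<^bold>\<longleftrightarrow> Exists (AllSt (0 \<^bold>\<in> 2 \<^bold>\<longrightarrow> lift_from 2 1 \<phi>))))"

definition BI' :: "fm set" where
  "BI' = {Bounded_Idealization \<phi> |\<phi>. eps_formula \<phi>}"

end

theory Submission
  imports Defs "HOL-Library.Countable_Set"
begin

text \<open>
  If ZF does not prove \<open>\<theta>\<close>, take a countable model \<open>M\<close> of ZF in which \<open>\<theta>\<close> fails.  A generic
  elementary extension \<open>N\<close> of \<open>M\<close>, with \<open>M\<close> as the class of standard sets, is a model of SPOT, B and
  BI'.  It is built from countably many names; a condition is a proper filter, coded in \<open>M\<close>, on the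
  space of valuations of the names by elements of \<open>M\<close>, and \<open>N\<close> is the structure of names modulo a
  generic sequence of conditions.  Choice is not needed:
  \<^item> a witness for an existential formula is a fresh name, so Los's theorem holds;
  \<^item> names get standard bounds because Collection holds in \<open>M\<close> (via the cumulative hierarchy);
  \<^item> the trace of a name on \<open>\<omega>\<close> is decided by a canonical branch defined by recursion in \<open>M\<close>, all finite
    stages of which are compatible with the given filter, so their union generates a proper filter;
  \<^item> for idealization over \<open>A\<close>, either the filter can be extended by the sets \<open>x \<in> A \<longrightarrow> \<phi>(x, y)\<close> for all \<open>x\<close>
    in \<open>M\<close> and a fresh name \<open>y\<close>, or some finite set \<open>a\<close> of \<open>M\<close> is an obstruction; then \<open>A \<inter> a\<close> can be
    decided to be a finite set of \<open>M\<close>, which refutes the hypothesis.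
\<close>

text \<open>\<open>M\<close> need not be well-founded: \<open>om\<close> may have nonstandard
  elements, and a set that \<open>M\<close> calls finite may be infinite from outside. So induction
  and recursion on \<open>om\<close> and on finite sets are available only for predicates definable
  in \<open>M\<close>, and many arguments carry a \<open>Dfn\<close> obligation for this reason. The
  decisive demand on a condition is that it turns definable families of predicates into definable
  predicates: then \<open>M\<close> itself can ask, inside a recursion, whether a decision is
  compatible with the filter. Positive predicates are more convenient than the filter because a case
  distinction leaves one of the cases positive; an ultrafilter, which would need choice in
  \<open>M\<close>, never has to exist there. Only the chain of conditions is external.
  Nontriviality needs no construction of its own: it is idealization over \<open>om\<close> for
  \<open>y \<epsilon> om \<and> z \<noteq> y\<close>.\<close>

instance fm :: countable
  by countable_datatype

text \<open>Rasiowa-Sikorski for an arbitrary order, used twice: for finite consistent sets of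
  formulas under reverse inclusion, and for forcing conditions.\<close>

lemma generic_chain:
  fixes le :: "'a \<Rightarrow> 'a \<Rightarrow> bool"
  assumes refl: "\<And>a. le a a" and trans: "\<And>a b c. le a b \<Longrightarrow> le b c \<Longrightarrow> le a c"
    and "C a0" and "countable DD"
    and dense: "\<And>X a. X \<in> DD \<Longrightarrow> C a \<Longrightarrow> \<exists>b. C b \<and> le b a \<and> b \<in> X"
  shows "\<exists>c. c 0 = a0 \<and> (\<forall>n. C (c n)) \<and> (\<forall>m n. m \<le> n \<longrightarrow> le (c n) (c m)) \<and>
    (\<forall>X\<in>DD. \<exists>n :: nat. c n \<in> X)"
proof -
  \<comment> \<open>\<open>UNIV\<close> asks for nothing; it makes the enumerated family nonempty
    even when \<open>DD\<close> is empty.\<close>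
  define d where "d = from_nat_into (insert UNIV DD)"
  have d: "\<exists>b. C b \<and> le b a \<and> b \<in> d n" if "C a" for a n
  proof -
    have "d n \<in> insert UNIV DD"
      unfolding d_def by (rule from_nat_into) simp
    then show ?thesis using dense[of "d n" a] refl that by auto
  qed
  obtain c where c: "c 0 = a0" "\<And>n. C (c n)" "\<And>n. le (c (Suc n)) (c n)" "\<And>n. c (Suc n) \<in> d n"
  proof -
    have "\<exists>f. \<forall>n. (C (f n) \<and> (n = 0 \<longrightarrow> f n = a0)) \<and> (le (f (Suc n)) (f n) \<and> f (Suc n) \<in> d n)"
      by (rule dependent_nat_choice) (use \<open>C a0\<close> d in auto)
    then show ?thesis using that by auto
  qed
  show ?thesis
  proof (intro exI[of _ c] conjI allI impI ballI)
    show "c 0 = a0" "C (c n)" for n using c by auto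
    show "le (c n) (c m)" if "m \<le> n" for n m
      using that
    proof (induction rule: dec_induct)
      case (step n)
      show ?case by (rule trans[OF c(3) step.IH])
    qed (rule refl)
    show "\<exists>n. c n \<in> X" if "X \<in> DD" for X
      using that c(4) from_nat_into_surj[of "insert UNIV DD" X] \<open>countable DD\<close>
      unfolding d_def by (metis countable_insert insertCI)
  qed
qed

section \<open>Semantics\<close>

text \<open>Equality is read as a relation \<open>Q\<close> because the Henkin model and the
  structure of names both live on carriers whose elements are not yet identified.\<close>

primrec sat :: "('a \<Rightarrow> 'a \<Rightarrow> bool) \<Rightarrow> ('a \<Rightarrow> 'a \<Rightarrow> bool) \<Rightarrow> ('a \<Rightarrow> bool) \<Rightarrow> (nat \<Rightarrow> 'a) \<Rightarrow> fm \<Rightarrow> bool"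
  where
  "sat E Q S e (i \<^bold>\<in> j) = E (e i) (e j)"
| "sat E Q S e (i \<^bold>= j) = Q (e i) (e j)"
| "sat E Q S e (St i) = S (e i)"
| "sat E Q S e Falsum = False"
| "sat E Q S e (p \<^bold>\<longrightarrow> q) = (sat E Q S e p \<longrightarrow> sat E Q S e q)"
| "sat E Q S e (Forall p) = (\<forall>x. sat E Q S (case_nat x e) p)"

lemma sat_ren: "sat E Q S e (ren f p) = sat E Q S (\<lambda>n. e (f n)) p"
proof (induction p arbitrary: e f)
  case (Forall p)
  have "(\<lambda>n. case_nat x e (case_nat 0 (\<lambda>n. Suc (f n)) n)) = case_nat x (\<lambda>n. e (f n))" for x
    by (auto split: nat.split)
  then show ?case by (simp only: ren.simps sat.simps Forall)
qed auto

lemma sat_fv_cong: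
  "(\<And>n. n < fv_bound p \<Longrightarrow> e n = e' n) \<Longrightarrow> sat E Q S e p = sat E Q S e' p"
proof (induction p arbitrary: e e')
  case (Forall p)
  have "sat E Q S (case_nat x e) p = sat E Q S (case_nat x e') p" for x
    by (rule Forall.IH) (use Forall.prems in \<open>auto split: nat.split\<close>)
  then show ?case by simp
next
  case (Imp p q)
  then show ?case by (metis fv_bound.simps(5) max_less_iff_conj not_le sat.simps(5) less_max_iff_disj)
qed (auto split: nat.splits)

lemma sat_iff: "sat E Q S e (p \<^bold>\<longleftrightarrow> q) \<longleftrightarrow> (sat E Q S e p \<longleftrightarrow> sat E Q S e q)"
  by auto

definition congruence :: "('a \<Rightarrow> 'a \<Rightarrow> bool) \<Rightarrow> ('a \<Rightarrow> 'a \<Rightarrow> bool) \<Rightarrow> ('a \<Rightarrow> bool) \<Rightarrow> bool" where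
  "congruence E Q S \<longleftrightarrow> equivp Q \<and> (\<forall>x x' y y'. Q x x' \<longrightarrow> Q y y' \<longrightarrow> E x y \<longrightarrow> E x' y') \<and>
    (\<forall>x x'. Q x x' \<longrightarrow> S x \<longrightarrow> S x')"

lemma congruenceD:
  assumes "congruence E Q S"
  shows "Q x x" "Q x y \<Longrightarrow> Q y x" "Q x y \<Longrightarrow> Q y z \<Longrightarrow> Q x z"
    "Q x x' \<Longrightarrow> Q y y' \<Longrightarrow> E x y \<longleftrightarrow> E x' y'" "Q x x' \<Longrightarrow> S x \<longleftrightarrow> S x'"
  using assms unfolding congruence_def
  by (blast dest: equivp_reflp equivp_symp equivp_transp)+

lemma sat_congruence:
  assumes "congruence E Q S"
  shows "(\<And>n. Q (e n) (e' n)) \<Longrightarrow> sat E Q S e p = sat E Q S e' p"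
proof (induction p arbitrary: e e')
  case (Forall p)
  have "sat E Q S (case_nat x e) p = sat E Q S (case_nat x e') p" for x
    by (rule Forall.IH) (use Forall.prems congruenceD(1)[OF assms] in \<open>auto split: nat.split\<close>)
  then show ?case by simp
next
  case (Imp p q)
  then show ?case using sat.simps(5) by metis
next
  case (Eq i j)
  then show ?case using congruenceD(2,3)[OF assms] by (metis sat.simps(2))
next
  case (Mem i j)
  show ?case unfolding sat.simps by (rule congruenceD(4)[OF assms Mem Mem])
next
  case (St i)
  show ?case unfolding sat.simps by (rule congruenceD(5)[OF assms St])
qed simp

lemma comp_case_nat: "(\<lambda>n. e (case_nat t f n)) = case_nat (e t) (\<lambda>n. e (f n))"
  by (auto split: nat.split)

lemma sat_inst: "sat E Q S e (inst p t) = sat E Q S (case_nat (e t) e) p"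
  by (simp only: inst_def sat_ren comp_case_nat)

lemma lift_from_0_1: "lift_from 0 1 p = ren Suc p" "lift_from 0 (Suc 0) p = ren Suc p"
  by (simp_all add: lift_from_def)

lemma sat_lift: "sat E Q S (case_nat x e) (lift_from 0 1 p) = sat E Q S e p"
  by (simp only: lift_from_0_1 sat_ren nat.case)

text \<open>The induction is uniform in the environment and the axioms in \<open>T\<close> hold
  under every environment, which makes \<open>Gen\<close> sound; \<open>Refl\<close> and
  \<open>Leibniz\<close> are where \<open>Q\<close> has to be a congruence.\<close>

theorem soundness:
  assumes "derivable L T p" and "congruence E Q S" and "\<And>q e. q \<in> T \<Longrightarrow> sat E Q S e q"
  shows "sat E Q S e p"
  using assms(1)
proof (induction arbitrary: e)
  case (Leibniz i j p)
  have "sat E Q S (case_nat (e i) e) p = sat E Q S (case_nat (e j) e) p" if "Q (e i) (e j)"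
    by (rule sat_congruence[OF assms(2)])
      (use that congruenceD(1)[OF assms(2)] in \<open>auto split: nat.split\<close>)
  then show ?case by (simp add: sat_inst)
next
  case (Vacuous p)
  then show ?case by (simp only: sat.simps sat_lift) simp
next
  case (Axiom p)
  then show ?case using assms(3) by blast
next
  case (Refl i)
  then show ?case using congruenceD(1)[OF assms(2)] by simp
next
  case (Inst p t)
  then show ?case by (simp add: sat_inst)
qed simp_all

text \<open>Moves one quantifier of a block into the environment: the value \<open>x\<close> of the
  outermost quantifier sits behind the \<open>n\<close> inner ones, at place
  \<open>n\<close>.\<close>

lemma shifted_case_nat:
  "(\<forall>k. e' (k + n) = case_nat x e k) \<longleftrightarrow> x = e' n \<and> (\<forall>k. e' (k + Suc n) = e k)"
proof -
  have "(\<forall>k. P k) \<longleftrightarrow> P 0 \<and> (\<forall>k. P (Suc k))" for P :: "nat \<Rightarrow> bool"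
    by (metis nat.exhaust)
  from this[of "\<lambda>k. e' (k + n) = case_nat x e k"] show ?thesis by auto
qed

lemma sat_funpow_Forall:
  "sat E Q S e ((Forall ^^ n) p) \<longleftrightarrow> (\<forall>e'. (\<forall>k. e' (k + n) = e k) \<longrightarrow> sat E Q S e' p)"
proof (induction n arbitrary: e)
  case 0
  have "(\<forall>k. e' k = e k) \<longleftrightarrow> e' = e" for e' by auto
  then show ?case by simp
next
  case (Suc n)
  note * = shifted_case_nat[of _ n _ e]
  show ?case by (simp only: funpow.simps comp_def sat.simps Suc *) blast
qed

lemma sat_closure: "sat E Q S e (closure p) \<longleftrightarrow> (\<forall>e'. sat E Q S e' p)"
proof -
  have "sat E Q S e' p"
    if "\<forall>e'. (\<forall>k. e' (k + fv_bound p) = e k) \<longrightarrow> sat E Q S e' p" for e'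
  proof -
    \<comment> \<open>The block forces the tail of the environment to be \<open>e\<close>; grafting
      that tail onto \<open>e'\<close> changes nothing below \<open>fv_bound p\<close>.\<close>
    define e'' where "e'' n = (if n < fv_bound p then e' n else e (n - fv_bound p))" for n
    have "sat E Q S e'' p" using that by (simp add: e''_def)
    then show ?thesis using sat_fv_cong[of p e' e''] by (simp add: e''_def)
  qed
  then show ?thesis unfolding closure_def sat_funpow_Forall by blast
qed

lemma sat_funpow_AllSt:
  "sat E Q S e ((AllSt ^^ n) p) \<longleftrightarrow>
    (\<forall>e'. (\<forall>k. e' (k + n) = e k) \<longrightarrow> (\<forall>k<n. S (e' k)) \<longrightarrow> sat E Q S e' p)"
proof (induction n arbitrary: e)
  case 0
  have "(\<forall>k. e' k = e k) \<longleftrightarrow> e' = e" for e' by auto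
  then show ?case by simp
next
  case (Suc n)
  note * = shifted_case_nat[of _ n _ e]
  have **: "(\<forall>k<Suc n. S (e' k)) \<longleftrightarrow> S (e' n) \<and> (\<forall>k<n. S (e' k))" for e' 
    using less_Suc_eq by auto
  show ?case by (simp only: funpow.simps comp_def sat.simps Suc * ** nat.case) blast
qed

section \<open>Completeness\<close>

lemma ren_cong: "(\<And>n. n < fv_bound p \<Longrightarrow> f n = g n) \<Longrightarrow> ren f p = ren g p"
proof (induction p arbitrary: f g)
  case (Forall p)
  show ?case
    by (simp, rule Forall.IH) (use Forall.prems in \<open>auto split: nat.split\<close>)
next
  case (Imp p q)
  then show ?case by (metis fv_bound.simps(5) ren.simps(5) less_max_iff_disj)
qed auto

lemma ren_id: "ren (\<lambda>n. n) p = p"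
proof (induction p)
  case (Forall p)
  have "case_nat 0 Suc = (\<lambda>n. n)" by (auto split: nat.split)
  then show ?case using Forall by simp
qed auto

lemma ren_ren: "ren f (ren g p) = ren (f \<circ> g) p"
proof (induction p arbitrary: f g)
  case (Forall p)
  have "case_nat 0 (\<lambda>n. Suc (f n)) \<circ> case_nat 0 (\<lambda>n. Suc (g n)) = case_nat 0 (\<lambda>n. Suc ((f \<circ> g) n))"
    by (auto split: nat.split)
  then show ?case by (simp add: Forall)
qed auto

lemma ren_sentence: "fv_bound p = 0 \<Longrightarrow> ren f p = p"
  using ren_cong[of p f "\<lambda>n. n"] ren_id by simp

lemma eps_ren [simp]: "eps_formula (ren f p) = eps_formula p"
  by (induction p arbitrary: f) auto

lemma eps_inst [simp]: "eps_formula (inst p t) = eps_formula p"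
  by (simp add: inst_def)

lemma ren_inst: "ren f (inst p t) = inst (ren (case_nat 0 (\<lambda>n. Suc (f n))) p) (f t)"
proof -
  have "f \<circ> case_nat t (\<lambda>n. n) = case_nat (f t) (\<lambda>n. n) \<circ> case_nat 0 (\<lambda>n. Suc (f n))"
    by (auto split: nat.split)
  then show ?thesis by (simp add: inst_def ren_ren)
qed

lemma inst_ren: "inst (ren (case_nat 0 (\<lambda>n. Suc (f n))) p) x = ren (case_nat x f) p"
proof -
  have "case_nat x (\<lambda>n. n) \<circ> case_nat 0 (\<lambda>n. Suc (f n)) = case_nat x f"
    by (auto split: nat.split)
  then show ?thesis by (simp add: inst_def ren_ren)
qed

lemma ren_up_Suc: "ren (case_nat 0 (\<lambda>n. Suc (f n))) (ren Suc p) = ren Suc (ren f p)"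
  by (simp add: ren_ren comp_def)

section \<open>Derivations from hypotheses with free variables, and the Henkin construction\<close>

locale eps_theory =
  fixes T :: "fm set"
  assumes sentences: "p \<in> T \<Longrightarrow> fv_bound p = 0"
begin

lemma thm_eps: "T \<turnstile>\<^sub>\<in> p \<Longrightarrow> eps_formula p"
  unfolding proves_eps_def by (induction rule: derivable.induct) auto

text \<open>Axioms in \<open>T\<close> are sentences, hence fixed by renaming, and the logical
  schemes are closed under it. This allows a fresh variable to be exchanged for a bound one.\<close>

lemma thm_ren: "T \<turnstile>\<^sub>\<in> p \<Longrightarrow> T \<turnstile>\<^sub>\<in> ren f p"
  unfolding proves_eps_def
proof (induction arbitrary: f rule: derivable.induct)
  case (Axiom p)
  then show ?case using sentences by (simp add: ren_sentence derivable.Axiom)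
next
  case (Inst p t)
  then show ?case unfolding ren.simps ren_inst by (intro derivable.Inst) simp
next
  case (Vacuous p)
  then show ?case unfolding ren.simps lift_from_0_1 ren_up_Suc
    using derivable.Vacuous[of "ren f p"] by (simp add: lift_from_0_1)
next
  case (Leibniz i j p)
  then show ?case unfolding ren.simps ren_inst by (intro derivable.Leibniz) simp
next
  case (MP p q)
  then show ?case using derivable.MP by fastforce
qed (auto intro!: derivable.K derivable.S derivable.Double_neg derivable.Dist derivable.Refl
    derivable.Gen)

text \<open>\<open>derivable\<close> may generalize any variable, so formulas with free indices
  cannot simply be added to \<open>T\<close>. Here hypotheses are kept apart and combined by modus
  ponens only, so that the deduction theorem has no side condition on variables.\<close>

inductive ded :: "fm set \<Rightarrow> fm \<Rightarrow> bool" for \<Gamma> where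
  theo: "T \<turnstile>\<^sub>\<in> p \<Longrightarrow> ded \<Gamma> p"
| hyp: "p \<in> \<Gamma> \<Longrightarrow> eps_formula p \<Longrightarrow> ded \<Gamma> p"
| mp: "ded \<Gamma> (p \<^bold>\<longrightarrow> q) \<Longrightarrow> ded \<Gamma> p \<Longrightarrow> ded \<Gamma> q"

lemma ded_eps: "ded \<Gamma> p \<Longrightarrow> eps_formula p"
  by (induction rule: ded.induct) (auto dest: thm_eps)

lemma ded_K: "eps_formula p \<Longrightarrow> eps_formula q \<Longrightarrow> ded \<Gamma> (p \<^bold>\<longrightarrow> q \<^bold>\<longrightarrow> p)"
  by (rule ded.theo) (simp add: proves_eps_def derivable.K)

lemma ded_S: "eps_formula p \<Longrightarrow> eps_formula q \<Longrightarrow> eps_formula r \<Longrightarrow>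
    ded \<Gamma> ((p \<^bold>\<longrightarrow> q \<^bold>\<longrightarrow> r) \<^bold>\<longrightarrow> (p \<^bold>\<longrightarrow> q) \<^bold>\<longrightarrow> p \<^bold>\<longrightarrow> r)"
  by (rule ded.theo) (simp add: proves_eps_def derivable.S)

lemma ded_weaken_imp: "ded \<Gamma> q \<Longrightarrow> eps_formula p \<Longrightarrow> ded \<Gamma> (p \<^bold>\<longrightarrow> q)"
  using ded_K ded.mp ded_eps by blast

lemma ded_id: "eps_formula p \<Longrightarrow> ded \<Gamma> (p \<^bold>\<longrightarrow> p)"
  using ded_S[of p "p \<^bold>\<longrightarrow> p" p] ded_K[of p "p \<^bold>\<longrightarrow> p"] ded_K[of p p] ded.mp
  by (metis eps_formula.simps(5))

lemma deduction: "ded (insert p \<Gamma>) q \<Longrightarrow> eps_formula p \<Longrightarrow> ded \<Gamma> (p \<^bold>\<longrightarrow> q)"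
proof (induction rule: ded.induct)
  case (theo q)
  then show ?case by (simp add: ded.theo ded_weaken_imp)
next
  case (hyp q)
  then show ?case using ded_id ded_weaken_imp ded.hyp by (metis insertE)
next
  case (mp q r)
  then have "eps_formula q" "eps_formula r" using ded_eps by fastforce+
  then show ?case using mp ded_S ded.mp by meson
qed

lemma ded_mono: "ded \<Gamma> p \<Longrightarrow> \<Gamma> \<subseteq> \<Delta> \<Longrightarrow> ded \<Delta> p"
proof (induction rule: ded.induct)
  case (mp p q)
  then show ?case using ded.mp by blast
qed (auto intro: ded.theo ded.hyp)

lemma ded_ccontr: "ded (insert (\<^bold>\<not> p) \<Gamma>) Falsum \<Longrightarrow> eps_formula p \<Longrightarrow> ded \<Gamma> p"
  using deduction[of "\<^bold>\<not> p" \<Gamma> Falsum] ded.theo[of "\<^bold>\<not> \<^bold>\<not> p \<^bold>\<longrightarrow> p"] ded.mp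
  by (simp add: proves_eps_def derivable.Double_neg) blast

lemma ded_empty: "ded {} p \<Longrightarrow> T \<turnstile>\<^sub>\<in> p"
proof (induction rule: ded.induct)
  case (mp p q)
  then show ?case unfolding proves_eps_def using derivable.MP by blast
qed auto

lemma ded_ren: "ded \<Gamma> p \<Longrightarrow> ded (ren f ` \<Gamma>) (ren f p)"
proof (induction rule: ded.induct)
  case (mp p q)
  then show ?case by (metis ded.mp ren.simps(5))
qed (auto intro: ded.theo ded.hyp thm_ren)

text \<open>Induction on the derivation: theorems use \<open>Gen\<close>; a hypothesis, free of the
  new variable after the shift by \<open>Suc\<close>, uses \<open>Vacuous\<close>; modus ponens uses
  \<open>Dist\<close>.\<close>

lemma ded_gen:
  assumes "ded (ren Suc ` \<Gamma>) p"
  shows "ded \<Gamma> (Forall p)"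
  using assms
proof (induction rule: ded.induct)
  case (theo p)
  then show ?case using thm_eps[OF theo] by (auto simp: proves_eps_def intro!: ded.theo derivable.Gen)
next
  case (hyp p)
  then obtain r where r: "r \<in> \<Gamma>" "p = ren Suc r" by auto
  have "ded \<Gamma> (r \<^bold>\<longrightarrow> Forall p)"
    using hyp r derivable.Vacuous[of r]
    by (auto simp: proves_eps_def lift_from_0_1 intro!: ded.theo)
  moreover have "ded \<Gamma> r" using hyp r by (auto intro: ded.hyp)
  ultimately show ?case by (rule ded.mp)
next
  case (mp p q)
  then have "eps_formula p" "eps_formula q" using ded_eps by fastforce+
  then have "ded \<Gamma> (Forall (p \<^bold>\<longrightarrow> q) \<^bold>\<longrightarrow> Forall p \<^bold>\<longrightarrow> Forall q)"
    by (auto simp: proves_eps_def intro!: ded.theo derivable.Dist)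
  then show ?case using mp ded.mp by blast
qed

lemma ded_fresh:
  assumes "ded \<Gamma> (inst q x)" and "\<And>p. p \<in> \<Gamma> \<Longrightarrow> fv_bound p \<le> x" and "fv_bound q \<le> x"
  shows "ded \<Gamma> (Forall q)"
proof (rule ded_gen)
  \<comment> \<open>Turns the fresh variable \<open>x\<close> into the one to be bound and acts as
    \<open>Suc\<close> elsewhere; so it undoes the instantiation of \<open>q\<close> and merely
    shifts the hypotheses.\<close>
  define f where "f n = (if n = x then 0 else Suc n)" for n
  have "ren f p = ren Suc p" if "p \<in> \<Gamma>" for p
    by (rule ren_cong) (use assms(2)[OF that] in \<open>auto simp: f_def\<close>)
  moreover have "ren f (inst q x) = ren (\<lambda>n. n) q"
    unfolding inst_def ren_ren
    by (rule ren_cong) (use assms(3) in \<open>auto simp: f_def split: nat.split\<close>)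
  ultimately show "ded (ren Suc ` \<Gamma>) q"
    using ded_ren[OF assms(1), of f] by (simp add: ren_id cong: image_cong)
qed

text \<open>Finiteness leaves variables that are fresh for the whole set; these become the Henkin
  witnesses.\<close>

definition consistent :: "fm set \<Rightarrow> bool" where
  "consistent \<Gamma> \<longleftrightarrow> finite \<Gamma> \<and> (\<forall>p\<in>\<Gamma>. eps_formula p) \<and> \<not> ded \<Gamma> Falsum"

lemma consistent_decide:
  assumes "consistent \<Gamma>" and "eps_formula p"
  shows "consistent (insert p \<Gamma>) \<or> consistent (insert (\<^bold>\<not> p) \<Gamma>)"
  using assms deduction[of p \<Gamma> Falsum] ded_ccontr[of p \<Gamma>] ded.mp
  unfolding consistent_def by auto

lemma consistent_witness:
  assumes "consistent \<Gamma>" and "eps_formula q"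
  shows "consistent (insert (Forall q) \<Gamma>) \<or> (\<exists>x. consistent (insert (\<^bold>\<not> inst q x) \<Gamma>))"
proof (rule ccontr)
  assume neg: "\<not> ?thesis"
  \<comment> \<open>\<open>x\<close> bounds every free index of \<open>q\<close> and of the members
    of \<open>\<Gamma>\<close>, hence is fresh for all of them.\<close>
  obtain x where x: "\<forall>n \<in> insert (fv_bound q) (fv_bound ` \<Gamma>). n \<le> x"
    using assms(1) finite_nat_set_iff_bounded_le[of "insert (fv_bound q) (fv_bound ` \<Gamma>)"]
    by (auto simp: consistent_def)
  have "ded (insert (\<^bold>\<not> inst q x) \<Gamma>) Falsum"
    using neg assms by (auto simp: consistent_def)
  then have "ded \<Gamma> (inst q x)" using ded_ccontr assms by simp
  then have "ded \<Gamma> (Forall q)" by (rule ded_fresh) (use x in auto)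
  moreover have "ded (insert (Forall q) \<Gamma>) Falsum"
    using neg assms by (auto simp: consistent_def)
  ultimately show False using deduction[of "Forall q" \<Gamma> Falsum] assms ded.mp
    unfolding consistent_def by auto
qed

text \<open>The free variables serve as Henkin constants; they are not yet identified along the
  equations of the complete theory, so equality is only a congruence.\<close>

lemma henkin_model:
  assumes "\<not> T \<turnstile>\<^sub>\<in> \<theta>" and "eps_formula \<theta>" and "fv_bound \<theta> = 0"
  obtains E Q :: "nat \<Rightarrow> nat \<Rightarrow> bool" where "congruence E Q (\<lambda>_. True)"
    "\<And>p e. p \<in> T \<Longrightarrow> eps_formula p \<Longrightarrow> sat E Q (\<lambda>_. True) e p"
    "\<And>e. \<not> sat E Q (\<lambda>_. True) e \<theta>"
proof -
  \<comment> \<open>Meeting \<open>D1\<close> completes the theory; meeting \<open>D2\<close> gives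
    every rejected universal formula a variable as counterexample.\<close>
  define D1 where "D1 p = {\<Gamma>. p \<in> \<Gamma> \<or> (\<^bold>\<not> p) \<in> \<Gamma>}" for p
  define D2 where "D2 q = {\<Gamma>. Forall q \<in> \<Gamma> \<or> (\<exists>x. (\<^bold>\<not> inst q x) \<in> \<Gamma>)}" for q
  have init: "consistent {\<^bold>\<not> \<theta>}"
    using assms ded_ccontr[of \<theta> "{}"] ded_empty by (auto simp: consistent_def)
  define DD where "DD = D1 ` {p. eps_formula p} \<union> D2 ` {p. eps_formula p}"
  have dense: "\<exists>\<Delta>. consistent \<Delta> \<and> \<Gamma> \<subseteq> \<Delta> \<and> \<Delta> \<in> X" if X: "X \<in> DD" "consistent \<Gamma>" for X \<Gamma>
  proof -
    consider p where "eps_formula p" "X = D1 p" | q where "eps_formula q" "X = D2 q"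
      using X(1) unfolding DD_def by blast
    then show ?thesis
    proof cases
      case 1
      then show ?thesis using consistent_decide[OF X(2)] unfolding D1_def by blast
    next
      case 2
      then show ?thesis using consistent_witness[OF X(2)] unfolding D2_def by blast
    qed
  qed
  have "countable DD" by (simp add: DD_def)
  have "\<exists>c. c 0 = {\<^bold>\<not> \<theta>} \<and> (\<forall>n. consistent (c n)) \<and> (\<forall>m n. m \<le> n \<longrightarrow> c m \<subseteq> c n) \<and>
    (\<forall>X\<in>DD. \<exists>n :: nat. c n \<in> X)"
    using init \<open>countable DD\<close> dense by (intro generic_chain[where le = "\<lambda>a b. b \<subseteq> a"]) auto
  then obtain c where c': "c 0 = {\<^bold>\<not> \<theta>}" "\<forall>n. consistent (c n)" "\<forall>m n. m \<le> n \<longrightarrow> c m \<subseteq> c n"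
    "\<forall>X\<in>DD. \<exists>n :: nat. c n \<in> X"
    by (elim exE conjE) (rule that)
  note c = c'(1) spec[OF c'(2)] c'(3)[rule_format] bspec[OF c'(4)]
  have decided: "\<exists>m. p \<in> c m \<or> (\<^bold>\<not> p) \<in> c m" if "eps_formula p" for p
    using c(4)[of "D1 p"] that by (auto simp: D1_def DD_def)
  have witnessed: "\<exists>m. Forall q \<in> c m \<or> (\<exists>x. (\<^bold>\<not> inst q x) \<in> c m)" if "eps_formula q" for q
    using c(4)[of "D2 q"] that by (auto simp: D2_def DD_def)
  define Th where "Th = (\<Union>n. c n)"
  \<comment> \<open>Finitely many premises lie in one stage; were the negation of \<open>p\<close>
    chosen instead, a later stage would derive both and be inconsistent.\<close>
  have closed: "p \<in> Th" if "ded \<Gamma> p" "finite \<Gamma>" "\<Gamma> \<subseteq> Th" for \<Gamma> p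
  proof -
    have "\<exists>n. \<Gamma> \<subseteq> c n" using that(2,3)
    proof (induction rule: finite_induct)
      case (insert x F)
      then obtain m n where "F \<subseteq> c n" "x \<in> c m" by (auto simp: Th_def)
      then have "insert x F \<subseteq> c (max m n)" using c(3)[of m "max m n"] c(3)[of n "max m n"] by auto
      then show ?case ..
    qed auto
    then obtain n where n: "\<Gamma> \<subseteq> c n" ..
    have "eps_formula p" using that ded_eps by blast
    then obtain m where m: "p \<in> c m \<or> (\<^bold>\<not> p) \<in> c m" using decided by blast
    moreover have False if "(\<^bold>\<not> p) \<in> c m"
    proof -
      let ?k = "max m n"
      have "ded (c ?k) p" using \<open>ded \<Gamma> p\<close> n c(3)[of n ?k] by (meson ded_mono max.cobounded2 subset_trans)
      moreover have "ded (c ?k) (\<^bold>\<not> p)"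
        using that c(3)[of m ?k] \<open>eps_formula p\<close> by (auto intro!: ded.hyp)
      ultimately show False using c(2)[of ?k] ded.mp by (auto simp: consistent_def)
    qed
    ultimately show ?thesis by (auto simp: Th_def)
  qed
  have closed1: "q \<in> Th" if "T \<turnstile>\<^sub>\<in> (p \<^bold>\<longrightarrow> q)" "p \<in> Th" for p q
    using closed[OF ded.mp[OF ded.theo ded.hyp], of p q "{p}"] that thm_eps[OF that(1)] by simp
  have closed0: "q \<in> Th" if "T \<turnstile>\<^sub>\<in> q" for q
    using closed[of "{}" q] that by (simp add: ded.theo)
  have fls: "Falsum \<notin> Th"
    using c(2) by (auto simp: Th_def consistent_def intro: ded.hyp)
  have imp: "(p \<^bold>\<longrightarrow> q) \<in> Th \<longleftrightarrow> (p \<in> Th \<longrightarrow> q \<in> Th)" if "eps_formula p" "eps_formula q" for p q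
  proof
    assume "(p \<^bold>\<longrightarrow> q) \<in> Th"
    then show "p \<in> Th \<longrightarrow> q \<in> Th"
      using closed[OF ded.mp[OF ded.hyp ded.hyp], of p q "{p \<^bold>\<longrightarrow> q, p}"] that by simp
  next
    assume *: "p \<in> Th \<longrightarrow> q \<in> Th"
    show "(p \<^bold>\<longrightarrow> q) \<in> Th"
    proof (cases "p \<in> Th")
      case True
      then show ?thesis using * closed1[of q] that by (simp add: proves_eps_def derivable.K)
    next
      case False
      then have "(\<^bold>\<not> p) \<in> Th" using decided[of p] that by (auto simp: Th_def)
      moreover have "ded {\<^bold>\<not> p} (p \<^bold>\<longrightarrow> q)"
      proof (rule deduction)
        let ?G = "insert (\<^bold>\<not> q) (insert p {\<^bold>\<not> p})"
        have "ded ?G Falsum"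
          by (rule ded.mp[of _ p]) (use that in \<open>auto intro!: ded.hyp\<close>)
        then show "ded {p, \<^bold>\<not> p} q" using ded_ccontr that by blast
      qed (use that in auto)
      ultimately show ?thesis using closed by blast
    qed
  qed
  have all: "Forall q \<in> Th \<longleftrightarrow> (\<forall>x. inst q x \<in> Th)" if "eps_formula q" for q
  proof
    assume "Forall q \<in> Th"
    then show "\<forall>x. inst q x \<in> Th"
      using closed1[of "Forall q"] that by (simp add: proves_eps_def derivable.Inst)
  next
    assume *: "\<forall>x. inst q x \<in> Th"
    have "Forall q \<in> Th \<or> (\<exists>x. (\<^bold>\<not> inst q x) \<in> Th)"
      using witnessed[OF that] unfolding Th_def by blast
    then show "Forall q \<in> Th" using imp[of "inst q _" Falsum] * fls that by auto
  qed
  define E where "E i j \<longleftrightarrow> (i \<^bold>\<in> j) \<in> Th" for i j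
  define Q where "Q i j \<longleftrightarrow> (i \<^bold>= j) \<in> Th" for i j
  \<comment> \<open>The elements of the model are variables, so an environment is itself a renaming
    of indices.\<close>
  have truth: "sat E Q (\<lambda>_. True) e p \<longleftrightarrow> ren e p \<in> Th" if "eps_formula p" for e p
    using that
  proof (induction p arbitrary: e)
    case (Imp p q)
    then show ?case using imp by simp
  next
    case (Forall p)
    then show ?case using all by (simp add: inst_ren)
  qed (auto simp: E_def Q_def fls)
  have refl: "Q i i" for i using closed0 by (simp add: Q_def proves_eps_def derivable.Refl)
  have leibniz: "inst p j \<in> Th" if "Q i j" "inst p i \<in> Th" "eps_formula p" for p i j
    using closed1[of "i \<^bold>= j" "inst p i \<^bold>\<longrightarrow> inst p j"] imp that
    by (simp add: Q_def proves_eps_def derivable.Leibniz)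
  \<comment> \<open>In each Leibniz pattern index 0 is the slot to be replaced, and all other
    variables appear shifted by \<open>Suc\<close>.\<close>
  have sym: "Q j i" if "Q i j" for i j
    using leibniz[OF that, of "0 \<^bold>= Suc i"] refl[of i] by (simp add: inst_def Q_def)
  have trans: "Q i k" if "Q i j" "Q j k" for i j k
    using leibniz[OF that(2), of "Suc i \<^bold>= 0"] that(1) by (simp add: inst_def Q_def)
  have E: "E i' j'" if "Q i i'" "Q j j'" "E i j" for i i' j j'
    using leibniz[OF that(1), of "0 \<^bold>\<in> Suc j"] leibniz[OF that(2), of "Suc i' \<^bold>\<in> 0"] that(3)
    by (simp add: inst_def E_def)
  show ?thesis
  proof
    have "equivp Q"
      by (intro equivpI reflpI sympI transpI) (fact refl sym trans)+
    then show "congruence E Q (\<lambda>_. True)"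
      unfolding congruence_def using E by blast
    show "sat E Q (\<lambda>_. True) e p" if "p \<in> T" "eps_formula p" for p e
      using that sentences closed0 by (simp add: truth ren_sentence proves_eps_def derivable.Axiom)
    show "\<not> sat E Q (\<lambda>_. True) e \<theta>" for e
    proof -
      have "(\<^bold>\<not> \<theta>) \<in> Th" using c(1) by (auto simp: Th_def)
      then show ?thesis using imp[of \<theta> Falsum] fls assms by (simp add: truth ren_sentence)
    qed
  qed
qed

end

text \<open>\<open>h\<close> lists exactly one representative of each class, so the quotient is
  taken by reindexing and equality becomes genuine.\<close>

lemma sat_quotient:
  fixes h :: "'b \<Rightarrow> 'a"
  assumes "congruence E Q (\<lambda>_. True)" and "\<And>i. \<exists>j. Q i (h j)" and "\<And>i j. Q (h i) (h j) \<longleftrightarrow> i = j"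
  shows "sat (\<lambda>i j. E (h i) (h j)) (=) (\<lambda>_. True) e p \<longleftrightarrow> sat E Q (\<lambda>_. True) (\<lambda>n. h (e n)) p"
proof (induction p arbitrary: e)
  case (Forall p)
  have "(\<forall>x. sat E Q (\<lambda>_. True) (case_nat (h x) (\<lambda>n. h (e n))) p) \<longleftrightarrow>
        (\<forall>x. sat E Q (\<lambda>_. True) (case_nat x (\<lambda>n. h (e n))) p)" (is "?L \<longleftrightarrow> ?R")
  proof
    assume ?L
    show ?R
    proof
      fix x
      obtain j where "Q x (h j)" using assms(2) by blast
      then have "sat E Q (\<lambda>_. True) (case_nat x (\<lambda>n. h (e n))) p = sat E Q (\<lambda>_. True) (case_nat (h j) (\<lambda>n. h (e n))) p"
        by (intro sat_congruence[OF assms(1)]) (auto split: nat.split simp: congruenceD(1)[OF assms(1)])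
      then show "sat E Q (\<lambda>_. True) (case_nat x (\<lambda>n. h (e n))) p" using \<open>?L\<close> by blast
    qed
  qed blast
  then show ?case by (simp add: Forall comp_case_nat)
qed (simp_all add: assms(3))

lemma fv_bound_funpow_Forall: "fv_bound ((Forall ^^ n) p) = fv_bound p - n"
  by (induction n) auto

lemma fv_bound_closure: "fv_bound (closure p) = 0"
  by (simp add: closure_def fv_bound_funpow_Forall)

lemma ZF_sentence: "p \<in> ZF \<Longrightarrow> fv_bound p = 0"
  unfolding ZF_def
  by (auto simp: fv_bound_closure Separation_def Replacement_def Extensionality_def Foundation_def
      Pairing_def Union_def Power_Set_def Infinity_def upair_fm_def subset_fm_def inductive_fm_def
      empty_fm_def succ_fm_def)

lemma eps_funpow_Forall [simp]: "eps_formula ((Forall ^^ n) p) = eps_formula p"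
  by (induction n) auto

lemma ZF_eps: "p \<in> ZF \<Longrightarrow> eps_formula p"
  unfolding ZF_def
  by (auto simp: closure_def Separation_def Replacement_def Extensionality_def Foundation_def
      Pairing_def Union_def Power_Set_def Infinity_def upair_fm_def subset_fm_def inductive_fm_def
      empty_fm_def succ_fm_def lift_from_def)

text \<open>Pairing and Union collect the elements of \<open>R\<close> into one \<open>u\<close>; by
  Foundation \<open>u\<close> is not a member of itself, so it equals none of them. Hence the
  quotient is infinite and can be indexed by \<open>nat\<close>.\<close>

lemma ZF_model_infinite:
  assumes cong: "congruence E Q (\<lambda>_. True)" and ZF: "\<And>p e. p \<in> ZF \<Longrightarrow> sat E Q (\<lambda>_. True) e p"
  assumes "finite R"
  shows "\<exists>x. \<forall>r\<in>R. \<not> Q x r"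
proof -
  have "sat E Q (\<lambda>_. True) e Pairing" "sat E Q (\<lambda>_. True) e Union" "sat E Q (\<lambda>_. True) e Foundation" for e
    by (rule ZF, simp add: ZF_def)+
  note sats = this[of undefined]
  have pair: "\<exists>p. \<forall>z. E z p \<longleftrightarrow> Q z a \<or> Q z b" for a b
    using sats(1) by (simp add: Pairing_def upair_fm_def) metis
  have union: "\<exists>u. \<forall>z. E z u \<longleftrightarrow> (\<exists>y. E y a \<and> E z y)" for a
    using sats(2) by (simp add: Union_def) metis
  have found: "\<exists>y. E y x \<and> (\<forall>z. E z y \<longrightarrow> \<not> E z x)" if "E y x" for x y
    using sats(3) that by (simp add: Foundation_def) metis
  note C = congruenceD[OF cong]
  have "\<exists>u. \<forall>r\<in>R. E r u" using \<open>finite R\<close>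
  proof (induction rule: finite_induct)
    case (insert x F)
    then obtain u where u: "\<forall>r\<in>F. E r u" by blast
    obtain s where s: "\<And>z. E z s \<longleftrightarrow> Q z x \<or> Q z x" using pair by blast
    obtain p where p: "\<And>z. E z p \<longleftrightarrow> Q z u \<or> Q z s" using pair by blast
    obtain w where w: "\<And>z. E z w \<longleftrightarrow> (\<exists>y. E y p \<and> E z y)" using union by blast
    have "E u p" "E s p" "E x s" using p s C(1) by blast+
    then have "\<forall>r\<in>insert x F. E r w" using u w by blast
    then show ?case ..
  qed auto
  then obtain u where u: "\<forall>r\<in>R. E r u" ..
  have "\<not> E u u"
  proof
    assume "E u u"
    obtain s where s: "\<And>z. E z s \<longleftrightarrow> Q z u \<or> Q z u" using pair by blast
    obtain y where y: "E y s" "\<And>z. E z y \<Longrightarrow> \<not> E z s" using found[of u s] s C(1) by blast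
    then show False using s C \<open>E u u\<close> by blast
  qed
  then have "\<forall>r\<in>R. \<not> Q u r" using u C by blast
  then show ?thesis ..
qed

theorem ZF_completeness:
  assumes "\<not> ZF \<turnstile>\<^sub>\<in> \<theta>" and "eps_formula \<theta>" and "sentence \<theta>"
  obtains E :: "nat \<Rightarrow> nat \<Rightarrow> bool" where
    "\<And>p e. p \<in> ZF \<Longrightarrow> sat E (=) (\<lambda>_. True) e p" "\<And>e. \<not> sat E (=) (\<lambda>_. True) e \<theta>"
proof -
  interpret eps_theory ZF by standard (rule ZF_sentence)
  obtain E Q :: "nat \<Rightarrow> nat \<Rightarrow> bool" where EQ: "congruence E Q (\<lambda>_. True)"
    "\<And>p e. p \<in> ZF \<Longrightarrow> sat E Q (\<lambda>_. True) e p" "\<And>e. \<not> sat E Q (\<lambda>_. True) e \<theta>"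
    by (rule henkin_model[OF assms(1,2) assms(3)[unfolded sentence_def]])
      (rule that, assumption, simp add: ZF_eps, assumption)
  note C = congruenceD[OF EQ(1)]
  \<comment> \<open>The least variable of each class. There are infinitely many of these, and
    \<open>h\<close> below enumerates them by \<open>nat\<close> without repetition.\<close>
  define rep where "rep i = (LEAST j. Q i j)" for i
  have rep: "Q i (rep i)" for i unfolding rep_def using C(1) by (rule LeastI)
  have rep_eq: "rep i = rep j" if "Q i j" for i j
  proof -
    have "Q i k \<longleftrightarrow> Q j k" for k using C(3)[OF that, of k] C(3)[OF C(2)[OF that], of k] by blast
    then show ?thesis by (simp add: rep_def)
  qed
  have "infinite (range rep)"
    using ZF_model_infinite[OF EQ(1,2), of "range rep"] rep by blast
  then have "bij_betw (from_nat_into (range rep)) UNIV (range rep)"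
    by (rule bij_betw_from_nat_into[rotated]) simp
  then obtain h :: "nat \<Rightarrow> nat" where h: "bij_betw h UNIV (range rep)" ..
  have surj: "\<exists>j. Q i (h j)" for i
  proof -
    have "rep i \<in> range h" using h by (simp add: bij_betw_def)
    then obtain j where "rep i = h j" by (rule imageE)
    then show ?thesis using rep[of i] by (intro exI[of _ j]) simp
  qed
  have inj: "Q (h i) (h j) \<longleftrightarrow> i = j" for i j
  proof
    assume Q: "Q (h i) (h j)"
    have idem: "rep (h k) = h k" for k
    proof -
      have "h k \<in> range rep" using h by (auto simp: bij_betw_def)
      then obtain m where m: "h k = rep m" by (rule imageE)
      then show ?thesis using rep_eq[OF rep[of m]] by simp
    qed
    have "h i = h j" using rep_eq[OF Q] unfolding idem .
    then show "i = j" using h unfolding bij_betw_def by (simp add: inj_eq)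
  qed (simp add: C(1))
  show ?thesis
  proof
    fix p e assume "p \<in> ZF"
    then show "sat (\<lambda>i j. E (h i) (h j)) (=) (\<lambda>_. True) e p"
      using sat_quotient[of E Q h, OF EQ(1) surj inj] EQ(2) by blast
  next
    fix e
    show "\<not> sat (\<lambda>i j. E (h i) (h j)) (=) (\<lambda>_. True) e \<theta>"
      using sat_quotient[of E Q h, OF EQ(1) surj inj] EQ(3) by blast
  qed
qed

section \<open>Definable predicates of a model of ZF\<close>

text \<open>The sources of an argument: a fixed element of the model, a local variable open to
  quantification, or a name whose value is read from a valuation.\<close>

datatype 'm tm = Par 'm | Loc nat | Nam nat

primrec tval :: "(nat \<Rightarrow> 'm) \<Rightarrow> (nat \<Rightarrow> 'm) \<Rightarrow> 'm tm \<Rightarrow> 'm" where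
  "tval u v (Par m) = m"
| "tval u v (Loc i) = u i"
| "tval u v (Nam j) = v j"

named_theorems dfn

locale zf_model =
  fixes E :: "'m \<Rightarrow> 'm \<Rightarrow> bool" (infix "\<epsilon>" 50)
  assumes ZF: "p \<in> ZF \<Longrightarrow> sat (\<epsilon>) (=) (\<lambda>_. True) e p"
begin

abbreviation Sat :: "(nat \<Rightarrow> 'm) \<Rightarrow> fm \<Rightarrow> bool" where
  "Sat \<equiv> sat (\<epsilon>) (=) (\<lambda>_. True)"

text \<open>Definability is made a property of HOL predicates, so that it can be checked by
  \<open>intro dfn\<close> instead of by writing formulas. The assignment \<open>t\<close> is
  infinite, but \<open>p\<close> reads only finitely many of its terms.\<close>

definition Dfn :: "((nat \<Rightarrow> 'm) \<Rightarrow> (nat \<Rightarrow> 'm) \<Rightarrow> bool) \<Rightarrow> bool" where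
  "Dfn \<Phi> \<longleftrightarrow> (\<exists>p t. eps_formula p \<and> (\<forall>u v. \<Phi> u v = Sat (\<lambda>n. tval u v (t n)) p))"

lemma DfnI: "eps_formula p \<Longrightarrow> (\<And>u v. \<Phi> u v = Sat (\<lambda>n. tval u v (t n)) p) \<Longrightarrow> Dfn \<Phi>"
  unfolding Dfn_def by blast

lemma DfnE:
  assumes "Dfn \<Phi>"
  obtains p t where "eps_formula p" "\<And>u v. \<Phi> u v = Sat (\<lambda>n. tval u v (t n)) p"
  using assms unfolding Dfn_def by blast

lemma Dfn_tval_mem: "Dfn (\<lambda>u v. tval u v s \<epsilon> tval u v t)"
  by (rule DfnI[where p = "0 \<^bold>\<in> 1" and t = "case_nat s (\<lambda>_. t)"]) auto

lemma Dfn_tval_eq: "Dfn (\<lambda>u v. tval u v s = tval u v t)"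
  by (rule DfnI[where p = "0 \<^bold>= 1" and t = "case_nat s (\<lambda>_. t)"]) auto

lemma Dfn_False: "Dfn (\<lambda>u v. False)"
  by (rule DfnI[where p = Falsum]) auto

lemma Dfn_imp [dfn]:
  assumes "Dfn \<Phi>" "Dfn \<Psi>"
  shows "Dfn (\<lambda>u v. \<Phi> u v \<longrightarrow> \<Psi> u v)"
proof -
  obtain p t where p: "eps_formula p" "\<And>u v. \<Phi> u v = Sat (\<lambda>n. tval u v (t n)) p"
    using assms(1) by (elim DfnE) (rule that)
  obtain q s where q: "eps_formula q" "\<And>u v. \<Psi> u v = Sat (\<lambda>n. tval u v (s n)) q"
    using assms(2) by (elim DfnE) (rule that)
  \<comment> \<open>The two formulas read their arguments from the even and the odd indices of one
    merged assignment.\<close>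
  show ?thesis
    by (rule DfnI[where p = "ren (\<lambda>n. 2 * n) p \<^bold>\<longrightarrow> ren (\<lambda>n. Suc (2 * n)) q"
          and t = "\<lambda>n. if even n then t (n div 2) else s (n div 2)"])
      (simp_all add: p q sat_ren)
qed

lemma Dfn_all [dfn]:
  assumes "Dfn (\<lambda>u v. \<Phi> (u 0) (\<lambda>n. u (Suc n)) v)"
  shows "Dfn (\<lambda>u v. \<forall>x. \<Phi> x u v)"
proof -
  obtain p t where p: "eps_formula p"
    "\<And>u v. \<Phi> (u 0) (\<lambda>n. u (Suc n)) v = Sat (\<lambda>n. tval u v (t n)) p"
    using assms by (elim DfnE) (rule that)
  \<comment> \<open>All indices that stand for local 0 are merged into the new bound variable; the
    other locals move down by one in \<open>s\<close>.\<close>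
  define f where "f n = (if t n = Loc 0 then 0 else Suc n)" for n
  define s where "s n = (case t n of Loc i \<Rightarrow> Loc (i - 1) | _ \<Rightarrow> t n)" for n
  have *: "\<Phi> x u v = Sat (case_nat x (\<lambda>n. tval u v (s n))) (ren f p)" for x u v
  proof -
    have "tval (case_nat x u) v (t n) = case_nat x (\<lambda>n. tval u v (s n)) (f n)" for n
      by (cases "t n") (auto simp: f_def s_def split: nat.split)
    then show ?thesis using p(2)[of "case_nat x u" v] by (simp add: sat_ren)
  qed
  show ?thesis
    by (rule DfnI[where p = "Forall (ren f p)" and t = s]) (simp_all add: p(1) *)
qed

lemma Dfn_True: "Dfn (\<lambda>u v. True)"
  using Dfn_imp[OF Dfn_False Dfn_False] by simp

lemma Dfn_const [dfn]: "Dfn (\<lambda>u v. c)"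
  by (cases c) (simp_all add: Dfn_True Dfn_False)

lemma Dfn_not [dfn]: "Dfn \<Phi> \<Longrightarrow> Dfn (\<lambda>u v. \<not> \<Phi> u v)"
  using Dfn_imp[OF _ Dfn_False] by simp

lemma Dfn_disj [dfn]: "Dfn \<Phi> \<Longrightarrow> Dfn \<Psi> \<Longrightarrow> Dfn (\<lambda>u v. \<Phi> u v \<or> \<Psi> u v)"
  using Dfn_imp[OF Dfn_not, of \<Phi> \<Psi>] by (simp add: disj_imp)

lemma Dfn_conj [dfn]: "Dfn \<Phi> \<Longrightarrow> Dfn \<Psi> \<Longrightarrow> Dfn (\<lambda>u v. \<Phi> u v \<and> \<Psi> u v)"
  using Dfn_not[OF Dfn_imp[OF _ Dfn_not], of \<Phi> \<Psi>] by simp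

lemma Dfn_iff [dfn]: "Dfn \<Phi> \<Longrightarrow> Dfn \<Psi> \<Longrightarrow> Dfn (\<lambda>u v. \<Phi> u v \<longleftrightarrow> \<Psi> u v)"
  unfolding iff_conv_conj_imp by (intro Dfn_conj Dfn_imp)

lemma Dfn_ex [dfn]:
  assumes "Dfn (\<lambda>u v. \<Phi> (u 0) (\<lambda>n. u (Suc n)) v)"
  shows "Dfn (\<lambda>u v. \<exists>x. \<Phi> x u v)"
  using Dfn_not[OF Dfn_all[of "\<lambda>x u v. \<not> \<Phi> x u v", OF Dfn_not[OF assms]]] by simp

lemma Dfn_subst_names:
  assumes "Dfn \<Phi>"
  shows "Dfn (\<lambda>u v. \<Phi> (\<lambda>n. tval u v (s n)) (\<lambda>n. tval u v (r n)))"
proof -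
  obtain p t where p: "eps_formula p" "\<And>u v. \<Phi> u v = Sat (\<lambda>n. tval u v (t n)) p"
    using assms by (elim DfnE) (rule that)
  define s' where "s' n = (case t n of Loc i \<Rightarrow> s i | Nam i \<Rightarrow> r i | Par m \<Rightarrow> Par m)" for n
  have "tval (\<lambda>n. tval u v (s n)) (\<lambda>n. tval u v (r n)) (t n) = tval u v (s' n)" for u v n
    by (cases "t n") (auto simp: s'_def)
  then show ?thesis by (intro DfnI[where p = p and t = s']) (simp_all add: p)
qed

lemma Dfn_shift: "Dfn \<Phi> \<Longrightarrow> Dfn (\<lambda>u v. \<Phi> (\<lambda>n. u (f n)) v)"
  using Dfn_subst_names[of \<Phi> "\<lambda>n. Loc (f n)" Nam] by simp

text \<open>A function is definable through its graph, so set operations that are no terms of the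
  language can occur in definable predicates.\<close>

definition dtrm :: "((nat \<Rightarrow> 'm) \<Rightarrow> (nat \<Rightarrow> 'm) \<Rightarrow> 'm) \<Rightarrow> bool" where
  "dtrm a \<longleftrightarrow> Dfn (\<lambda>u v. u 0 = a (\<lambda>n. u (Suc n)) v)"

lemma dtrm_loc [dfn]: "dtrm (\<lambda>u v. u i)"
  unfolding dtrm_def using Dfn_tval_eq[of "Loc 0" "Loc (Suc i)"] by simp

lemma dtrm_const [dfn]: "dtrm (\<lambda>u v. c)"
  unfolding dtrm_def using Dfn_tval_eq[of "Loc 0" "Par c"] by simp

lemma dtrm_nam [dfn]: "dtrm (\<lambda>u v. v j)"
  unfolding dtrm_def using Dfn_tval_eq[of "Loc 0" "Nam j"] by simp

text \<open>Substitution of a term becomes an existential quantifier over its value.\<close>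

lemma Dfn_app:
  assumes "Dfn (\<lambda>u v. P (u 0) (\<lambda>n. u (Suc n)) v)" and "dtrm a"
  shows "Dfn (\<lambda>u v. P (a u v) u v)"
  using Dfn_ex[of "\<lambda>x u v. x = a u v \<and> P x u v"] assms by (simp add: Dfn_conj dtrm_def)

lemma dtrm_shift: "dtrm a \<Longrightarrow> dtrm (\<lambda>u v. a (\<lambda>n. u (Suc n)) v)"
  unfolding dtrm_def
  using Dfn_shift[of "\<lambda>u v. u 0 = a (\<lambda>n. u (Suc n)) v" "case_nat 0 (\<lambda>n. Suc (Suc n))"] by simp

lemma Dfn_app2:
  assumes P: "Dfn (\<lambda>u v. P (u 0) (u 1))" and a: "dtrm a" and b: "dtrm b"
  shows "Dfn (\<lambda>u v. P (a u v) (b u v))"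
proof -
  have "Dfn (\<lambda>u v. P (a (\<lambda>n. u (Suc n)) v) (u 0))"
    by (rule Dfn_app[of "\<lambda>x u v. P x (u 0)"]) (use P dtrm_shift[OF a] in simp_all)
  then show ?thesis
    by (intro Dfn_app[of "\<lambda>y u v. P (a u v) y", OF _ b]) simp
qed

lemma Dfn_app3:
  assumes P: "Dfn (\<lambda>u v. P (u 0) (u 1) (u 2))" and a: "dtrm a" and b: "dtrm b" and c: "dtrm c"
  shows "Dfn (\<lambda>u v. P (a u v) (b u v) (c u v))"
proof -
  have "Dfn (\<lambda>u v. P (a (\<lambda>n. u (Suc (Suc n))) v) (u 0) (u 1))"
    by (rule Dfn_app[of "\<lambda>x u v. P x (u 0) (u 1)"])
      (use P dtrm_shift[OF dtrm_shift[OF a]] in \<open>simp_all add: numeral_2_eq_2\<close>)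
  then have "Dfn (\<lambda>u v. P (a (\<lambda>n. u (Suc n)) v) (b (\<lambda>n. u (Suc n)) v) (u 0))"
    by (intro Dfn_app[of "\<lambda>x u v. P (a (\<lambda>n. u (Suc n)) v) x (u 0)", OF _ dtrm_shift[OF b]]) simp
  then show ?thesis
    by (intro Dfn_app[of "\<lambda>x u v. P (a u v) (b u v) x", OF _ c]) simp
qed

lemma Dfn_mem [dfn]: "dtrm a \<Longrightarrow> dtrm b \<Longrightarrow> Dfn (\<lambda>u v. a u v \<epsilon> b u v)"
  using Dfn_app2[of "(\<epsilon>)"] Dfn_tval_mem[of "Loc 0" "Loc 1"] by simp

lemma Dfn_eq [dfn]: "dtrm a \<Longrightarrow> dtrm b \<Longrightarrow> Dfn (\<lambda>u v. a u v = b u v)"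
  using Dfn_app2[of "(=)"] Dfn_tval_eq[of "Loc 0" "Loc 1"] by simp

lemma Dfn_param1:
  assumes "Dfn (\<lambda>u v. P (u 0))"
  obtains p e where "eps_formula p" "\<And>x. P x = Sat (case_nat x e) p"
proof -
  obtain p t where p: "eps_formula p" "\<And>u v. P (u 0) = Sat (\<lambda>n. tval u v (t n)) p"
    using assms by (elim DfnE) (rule that)
  define c where "c = (undefined :: nat \<Rightarrow> 'm)"
  define f where "f n = (if t n = Loc 0 then 0 else Suc n)" for n
  define e where "e n = tval (case_nat undefined c) c (t n)" for n
  have *: "P x = Sat (case_nat x e) (ren f p)" for x
  proof -
    have "tval (case_nat x c) c (t n) = case_nat x e (f n)" for n
      by (cases "t n") (auto simp: f_def e_def split: nat.split)
    then show ?thesis using p(2)[of "case_nat x c" c] by (simp add: sat_ren)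
  qed
  show ?thesis by (rule that[of "ren f p", OF _ *]) (simp add: p(1))
qed

lemma Dfn_param2:
  assumes "Dfn (\<lambda>u v. P (u 0) (u 1))"
  obtains p e where "eps_formula p" "\<And>x y. P x y = Sat (case_nat x (case_nat y e)) p"
proof -
  obtain p t where p: "eps_formula p" "\<And>u v. P (u 0) (u 1) = Sat (\<lambda>n. tval u v (t n)) p"
    using assms by (elim DfnE) (rule that)
  define c where "c = (undefined :: nat \<Rightarrow> 'm)"
  define f where "f n = (if t n = Loc 0 then 0 else if t n = Loc 1 then 1 else Suc (Suc n))" for n
  define e where "e n = tval (case_nat undefined (case_nat undefined c)) c (t n)" for n
  have *: "P x y = Sat (case_nat x (case_nat y e)) (ren f p)" for x y
  proof -
    have "tval (case_nat x (case_nat y c)) c (t n) = case_nat x (case_nat y e) (f n)" for n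
      by (cases "t n") (auto simp: f_def e_def split: nat.split)
    then show ?thesis using p(2)[of "case_nat x (case_nat y c)" c] by (simp add: sat_ren)
  qed
  show ?thesis by (rule that[of "ren f p", OF _ *]) (simp add: p(1))
qed

section \<open>Set theory in a model of ZF\<close>

lemma extI: "(\<And>z. z \<epsilon> a \<longleftrightarrow> z \<epsilon> b) \<Longrightarrow> a = b"
  using ZF[of Extensionality undefined] by (simp add: ZF_def Extensionality_def)

lemma ex_pair: "\<exists>p. \<forall>z. z \<epsilon> p \<longleftrightarrow> z = a \<or> z = b"
  using ZF[of Pairing undefined] by (simp add: ZF_def Pairing_def upair_fm_def) metis

lemma ex_Union: "\<exists>u. \<forall>z. z \<epsilon> u \<longleftrightarrow> (\<exists>y. y \<epsilon> a \<and> z \<epsilon> y)"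
  using ZF[of Union undefined] by (simp add: ZF_def Union_def) metis

lemma foundation: "y \<epsilon> x \<Longrightarrow> \<exists>y. y \<epsilon> x \<and> (\<forall>z. z \<epsilon> y \<longrightarrow> \<not> z \<epsilon> x)"
  using ZF[of Foundation undefined] by (simp add: ZF_def Foundation_def) metis

definition sub :: "'m \<Rightarrow> 'm \<Rightarrow> bool" (infix "\<sqsubseteq>" 50) where
  "a \<sqsubseteq> b \<longleftrightarrow> (\<forall>x. x \<epsilon> a \<longrightarrow> x \<epsilon> b)"

lemma Dfn_sub [dfn]: "dtrm a \<Longrightarrow> dtrm b \<Longrightarrow> Dfn (\<lambda>u v. a u v \<sqsubseteq> b u v)"
  by (rule Dfn_app2) (unfold sub_def, intro dfn)

lemma ex_Pow: "\<exists>p. \<forall>z. z \<epsilon> p \<longleftrightarrow> z \<sqsubseteq> a"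
  using ZF[of Power_Set undefined] by (simp add: ZF_def Power_Set_def subset_fm_def sub_def) metis

lemma separation:
  assumes "Dfn (\<lambda>u v. P (u 0))"
  shows "\<exists>b. \<forall>x. x \<epsilon> b \<longleftrightarrow> x \<epsilon> a \<and> P x"
proof -
  obtain p e where p: "eps_formula p" "\<And>x. P x = Sat (case_nat x e) p"
    using assms by (rule Dfn_param1) blast
  have "Sat e' (Separation p)" for e'
    by (rule ZF) (use p(1) in \<open>auto simp: ZF_def\<close>)
  then have "Sat e (Forall (Exists (Forall (0 \<^bold>\<in> 1 \<^bold>\<longleftrightarrow> (0 \<^bold>\<in> 2 \<^bold>\<and> lift_from 1 2 p)))))"
    unfolding Separation_def sat_closure by blast
  moreover have 1: "(\<lambda>n. case_nat x (case_nat b (case_nat a e)) (if n < 1 then n else n + 2)) = case_nat x e"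
    for x b a
    by (auto split: nat.split)
  ultimately have "\<forall>a. \<exists>b. \<forall>x. x \<epsilon> b \<longleftrightarrow> x \<epsilon> a \<and> P x"
    unfolding lift_from_def sat.simps sat_ren 1 p(2)[symmetric] by simp metis
  then show ?thesis by blast
qed

lemma replacement:
  assumes "Dfn (\<lambda>u v. P (u 0) (u 1))" and func: "\<And>x y z. P x y \<Longrightarrow> P x z \<Longrightarrow> y = z"
  shows "\<exists>b. \<forall>y. y \<epsilon> b \<longleftrightarrow> (\<exists>x. x \<epsilon> a \<and> P x y)"
proof -
  obtain p e where p: "eps_formula p" "\<And>x y. P x y = Sat (case_nat x (case_nat y e)) p"
    using assms(1) by (rule Dfn_param2) blast
  have "Sat e' (Replacement p)" for e'
    by (rule ZF) (use p(1) in \<open>auto simp: ZF_def\<close>)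
  moreover
  have 1: "(\<lambda>n. case_nat x (case_nat y (case_nat z e)) (if n < 2 then n else n + 1)) =
      case_nat x (case_nat y e)" for x y z
    by (auto split: nat.split)
  have 2: "(\<lambda>n. case_nat x (case_nat y (case_nat z e)) (if n = 0 then 0 else n + 1)) =
      case_nat x (case_nat z e)" for x y z
    by (auto split: nat.split)
  have 3: "(\<lambda>n. case_nat x (case_nat y (case_nat b (case_nat a e))) (if n < 2 then n else n + 2)) =
      case_nat x (case_nat y e)" for x y b a
    by (auto split: nat.split)
  ultimately have "Sat e (Forall (Forall (Forall
         (lift_from 2 1 p \<^bold>\<and> ren (\<lambda>n. if n = 0 then 0 else n + 1) p \<^bold>\<longrightarrow> 1 \<^bold>= 2)))
       \<^bold>\<longrightarrow> Forall (Exists (Forall (0 \<^bold>\<in> 1 \<^bold>\<longleftrightarrow> ExIn 2 (lift_from 2 2 p)))))"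
    unfolding Replacement_def sat_closure by blast
  then have "(\<forall>z y x. P x y \<and> P x z \<longrightarrow> y = z) \<longrightarrow>
      (\<forall>a. \<exists>b. \<forall>y. y \<epsilon> b \<longleftrightarrow> (\<exists>x. x \<epsilon> a \<and> P x y))"
    unfolding lift_from_def sat.simps sat_ren 1 2 3 p(2)[symmetric] by simp metis
  then show ?thesis using func by blast
qed

definition the_set :: "('m \<Rightarrow> bool) \<Rightarrow> 'm" where
  "the_set P = (THE s. \<forall>x. x \<epsilon> s \<longleftrightarrow> P x)"

lemma the_set_eq: "\<exists>s. \<forall>x. x \<epsilon> s \<longleftrightarrow> P x \<Longrightarrow> z = the_set P \<longleftrightarrow> (\<forall>x. x \<epsilon> z \<longleftrightarrow> P x)"
proof -
  assume "\<exists>s. \<forall>x. x \<epsilon> s \<longleftrightarrow> P x"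
  then have "\<exists>!s. \<forall>x. x \<epsilon> s \<longleftrightarrow> P x" using extI by metis
  from theI'[OF this] show ?thesis unfolding the_set_def[symmetric] using extI by metis
qed

lemma the_set_mem: "\<exists>s. \<forall>x. x \<epsilon> s \<longleftrightarrow> P x \<Longrightarrow> x \<epsilon> the_set P \<longleftrightarrow> P x"
  using the_set_eq[of P "the_set P"] by simp

definition emp :: 'm where "emp = the_set (\<lambda>x. False)"

lemma mem_emp [simp]: "\<not> x \<epsilon> emp"
proof -
  have "Dfn (\<lambda>u v. False)" by (intro dfn)
  from separation[OF this] show ?thesis unfolding emp_def by (subst the_set_mem) auto
qed

definition Uni :: "'m \<Rightarrow> 'm" where "Uni a = the_set (\<lambda>x. \<exists>y. y \<epsilon> a \<and> x \<epsilon> y)"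

lemma mem_Uni [simp]: "x \<epsilon> Uni a \<longleftrightarrow> (\<exists>y. y \<epsilon> a \<and> x \<epsilon> y)"
  unfolding Uni_def by (rule the_set_mem[OF ex_Union])

definition Pw :: "'m \<Rightarrow> 'm" where "Pw a = the_set (\<lambda>x. x \<sqsubseteq> a)"

lemma mem_Pw [simp]: "x \<epsilon> Pw a \<longleftrightarrow> x \<sqsubseteq> a"
  unfolding Pw_def by (rule the_set_mem[OF ex_Pow])

lemma ex_ins: "\<exists>s. \<forall>x. x \<epsilon> s \<longleftrightarrow> x = t \<or> x \<epsilon> a"
proof -
  obtain p where p: "\<And>z. z \<epsilon> p \<longleftrightarrow> z = t \<or> z = t" using ex_pair by blast
  obtain q where q: "\<And>z. z \<epsilon> q \<longleftrightarrow> z = p \<or> z = a" using ex_pair by blast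
  have "x \<epsilon> Uni q \<longleftrightarrow> x = t \<or> x \<epsilon> a" for x using p q by auto
  then show ?thesis by blast
qed

definition ins :: "'m \<Rightarrow> 'm \<Rightarrow> 'm" where "ins t a = the_set (\<lambda>x. x = t \<or> x \<epsilon> a)"

lemma mem_ins [simp]: "x \<epsilon> ins t a \<longleftrightarrow> x = t \<or> x \<epsilon> a"
  unfolding ins_def by (rule the_set_mem[OF ex_ins])

lemma ext_iff: "a = b \<longleftrightarrow> (\<forall>z. z \<epsilon> a \<longleftrightarrow> z \<epsilon> b)"
  using extI by blast

text \<open>By Extensionality the graph of an operation is definable once membership in its value
  is.\<close>

lemma dtrm_extI: "Dfn (\<lambda>u v. \<forall>x. x \<epsilon> u 0 \<longleftrightarrow> x \<epsilon> a (\<lambda>n. u (Suc n)) v) \<Longrightarrow> dtrm a"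
  unfolding dtrm_def ext_iff .

lemmas dtrm_shifts = dtrm_shift dtrm_shift[OF dtrm_shift] dtrm_shift[OF dtrm_shift[OF dtrm_shift]]

lemma dtrm_ins [dfn]: "dtrm a \<Longrightarrow> dtrm b \<Longrightarrow> dtrm (\<lambda>u v. ins (a u v) (b u v))"
  by (rule dtrm_extI) (simp, intro dfn dtrm_shifts)

lemma dtrm_Uni [dfn]: "dtrm a \<Longrightarrow> dtrm (\<lambda>u v. Uni (a u v))"
  by (rule dtrm_extI) (simp, intro dfn dtrm_shifts)

lemma not_self: "\<not> x \<epsilon> x"
  using foundation[of x "ins x emp"] by auto

lemma not_cycle2: "x \<epsilon> y \<Longrightarrow> \<not> y \<epsilon> x"
  using foundation[of x "ins x (ins y emp)"] by auto

abbreviation succ :: "'m \<Rightarrow> 'm" where "succ n \<equiv> ins n n"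

lemma succ_inj: "succ m = succ n \<longleftrightarrow> m = n"
proof
  assume eq: "succ m = succ n"
  have "m \<epsilon> succ m" "n \<epsilon> succ n" by simp_all
  then have "m \<epsilon> succ n" "n \<epsilon> succ m" by (simp_all only: eq)
  then have "m = n \<or> m \<epsilon> n" "n = m \<or> n \<epsilon> m" by simp_all
  then show "m = n" using not_cycle2 by blast
qed simp

lemma succ_neq: "succ n \<noteq> emp"
  unfolding ext_iff by auto

definition op :: "'m \<Rightarrow> 'm \<Rightarrow> 'm" where
  "op a b = ins (ins a emp) (ins (ins a (ins b emp)) emp)"

lemma upair_eqD: "ins a (ins b emp) = ins c (ins d emp) \<Longrightarrow> (a = c \<and> b = d) \<or> (a = d \<and> b = c)"
proof -
  assume "ins a (ins b emp) = ins c (ins d emp)"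
  then have "z = a \<or> z = b \<longleftrightarrow> z = c \<or> z = d" for z
    unfolding ext_iff[of "ins a (ins b emp)" "ins c (ins d emp)"] by simp
  from this[of a] this[of b] this[of c] this[of d] show ?thesis by blast
qed

lemma ins_same: "ins a (ins a emp) = ins a emp"
  by (rule extI) simp

lemma op_eq [simp]: "op a b = op c d \<longleftrightarrow> a = c \<and> b = d"
proof
  assume "op a b = op c d"
  then have "ins (ins a (ins a emp)) (ins (ins a (ins b emp)) emp) =
      ins (ins c (ins c emp)) (ins (ins c (ins d emp)) emp)"
    by (simp only: op_def ins_same)
  from upair_eqD[OF this] show "a = c \<and> b = d"
    by (auto dest: upair_eqD)
qed simp

lemma dtrm_op [dfn]: "dtrm a \<Longrightarrow> dtrm b \<Longrightarrow> dtrm (\<lambda>u v. op (a u v) (b u v))"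
  unfolding op_def by (intro dfn)

subsection \<open>Natural numbers\<close>

definition ind :: "'m \<Rightarrow> bool" where
  "ind w \<longleftrightarrow> emp \<epsilon> w \<and> (\<forall>x. x \<epsilon> w \<longrightarrow> succ x \<epsilon> w)"

lemma Sat_empty: "Sat e (empty_fm k) \<longleftrightarrow> e k = emp"
  by (auto simp: empty_fm_def ext_iff)

lemma Sat_succ: "Sat e (succ_fm i j) \<longleftrightarrow> e i = succ (e j)"
  by (auto simp: succ_fm_def ext_iff)

lemma Sat_inductive: "Sat e (inductive_fm k) \<longleftrightarrow> ind (e k)"
  by (auto simp: inductive_fm_def ind_def Sat_empty Sat_succ)

lemma Sat_subset: "Sat e (subset_fm i j) \<longleftrightarrow> e i \<sqsubseteq> e j"
  by (simp add: subset_fm_def sub_def)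

definition om :: 'm where "om = the_set (\<lambda>x. \<forall>w. ind w \<longrightarrow> x \<epsilon> w)"

lemma mem_om: "x \<epsilon> om \<longleftrightarrow> (\<forall>w. ind w \<longrightarrow> x \<epsilon> w)"
proof -
  obtain w0 where w0: "ind w0"
    using ZF[of Infinity undefined] by (auto simp: ZF_def Infinity_def Sat_inductive)
  have "Dfn (\<lambda>u v. \<forall>w. ind w \<longrightarrow> u 0 \<epsilon> w)" unfolding ind_def by (intro dfn)
  from separation[OF this, of w0] show ?thesis
    unfolding om_def using w0 by (intro the_set_mem) metis
qed

lemma ind_om: "ind om"
  unfolding ind_def mem_om by blast

lemma emp_om [simp]: "emp \<epsilon> om" and succ_om [simp]: "x \<epsilon> om \<Longrightarrow> succ x \<epsilon> om"
  using ind_om by (auto simp: ind_def)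

lemma Sat_Nat: "Sat e (Nat_fm k) \<longleftrightarrow> e k = om"
proof -
  have "Sat e (Nat_fm k) \<longleftrightarrow> ind (e k) \<and> (\<forall>w. ind w \<longrightarrow> e k \<sqsubseteq> w)"
    by (simp add: Nat_fm_def Sat_inductive Sat_subset)
  also have "\<dots> \<longleftrightarrow> e k = om"
  proof
    assume "ind (e k) \<and> (\<forall>w. ind w \<longrightarrow> e k \<sqsubseteq> w)"
    then show "e k = om" unfolding sub_def by (intro extI) (metis mem_om)
  next
    assume "e k = om"
    then show "ind (e k) \<and> (\<forall>w. ind w \<longrightarrow> e k \<sqsubseteq> w)" using ind_om mem_om by (simp add: sub_def)
  qed
  finally show ?thesis .
qed

lemma om_induct:
  assumes "Dfn (\<lambda>u v. P (u 0))" and n: "n \<epsilon> om" and "P emp" and "\<And>n. n \<epsilon> om \<Longrightarrow> P n \<Longrightarrow> P (succ n)"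
  shows "P n"
proof -
  obtain b where b: "\<And>x. x \<epsilon> b \<longleftrightarrow> x \<epsilon> om \<and> P x" using separation[OF assms(1)] by blast
  then have "ind b" unfolding ind_def using assms by simp
  then show ?thesis using n b unfolding mem_om by blast
qed

lemma om_mem_trans: "n \<epsilon> om \<Longrightarrow> \<forall>m k. k \<epsilon> m \<longrightarrow> m \<epsilon> n \<longrightarrow> k \<epsilon> n"
  by (rule om_induct[of "\<lambda>n. \<forall>m k. k \<epsilon> m \<longrightarrow> m \<epsilon> n \<longrightarrow> k \<epsilon> n"]) (intro dfn, auto)

lemma om_succ_mem: "n \<epsilon> om \<Longrightarrow> \<forall>m. m \<epsilon> n \<longrightarrow> succ m \<epsilon> n \<or> succ m = n"
  by (rule om_induct[of "\<lambda>n. \<forall>m. m \<epsilon> n \<longrightarrow> succ m \<epsilon> n \<or> succ m = n"]) (intro dfn, auto)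

lemma om_emp_mem: "n \<epsilon> om \<Longrightarrow> n = emp \<or> emp \<epsilon> n"
  by (rule om_induct[of "\<lambda>n. n = emp \<or> emp \<epsilon> n"]) (intro dfn, auto)

lemma om_sup:
  assumes "m \<epsilon> om" "n \<epsilon> om"
  shows "\<exists>k. k \<epsilon> om \<and> n \<sqsubseteq> k \<and> m \<epsilon> k \<and> m \<sqsubseteq> k"
proof -
  have "\<exists>k. k \<epsilon> om \<and> n \<sqsubseteq> k \<and> m \<epsilon> k"
  proof (rule om_induct[of "\<lambda>m. \<exists>k. k \<epsilon> om \<and> n \<sqsubseteq> k \<and> m \<epsilon> k", OF _ assms(1)])
    show "Dfn (\<lambda>u v. \<exists>k. k \<epsilon> om \<and> n \<sqsubseteq> k \<and> u 0 \<epsilon> k)" by (intro dfn)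
    have "emp \<epsilon> succ n" using om_emp_mem[OF assms(2)] by auto
    then show "\<exists>k. k \<epsilon> om \<and> n \<sqsubseteq> k \<and> emp \<epsilon> k"
      using assms(2) by (intro exI[of _ "succ n"]) (auto simp: sub_def)
  next
    fix m assume "\<exists>k. k \<epsilon> om \<and> n \<sqsubseteq> k \<and> m \<epsilon> k"
    then obtain k where k: "k \<epsilon> om" "n \<sqsubseteq> k" "m \<epsilon> k" by blast
    then have "succ m \<epsilon> succ k" using om_succ_mem[OF k(1)] by auto
    then show "\<exists>k. k \<epsilon> om \<and> n \<sqsubseteq> k \<and> succ m \<epsilon> k"
      using k by (intro exI[of _ "succ k"]) (auto simp: sub_def)
  qed
  then show ?thesis using om_mem_trans unfolding sub_def by blast
qed

text \<open>\<open>G\<close> is a class function whose values are not known to lie in a set; hence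
  the result is a definable relation rather than a set.\<close>

lemma om_recursion:
  assumes G: "Dfn (\<lambda>u v. G (u 0) (u 1) (u 2))" and total: "\<And>n s. \<exists>!s'. G n s s'"
  obtains R where "Dfn (\<lambda>u v. R (u 0) (u 1))" "R emp x0" "\<And>n. n \<epsilon> om \<Longrightarrow> \<exists>!s. R n s"
    "\<And>n s s'. n \<epsilon> om \<Longrightarrow> R n s \<Longrightarrow> G n s s' \<Longrightarrow> R (succ n) s'"
proof -
  \<comment> \<open>An attempt is a set of pairs, each the initial pair or justified by another pair
    of the attempt. Attempts need not be functions; uniqueness of values comes from induction in the
    model.\<close>
  define att where "att f \<longleftrightarrow> (\<forall>p. p \<epsilon> f \<longrightarrow> p = op emp x0 \<or>
    (\<exists>m s s'. m \<epsilon> om \<and> op m s \<epsilon> f \<and> G m s s' \<and> p = op (succ m) s'))" for f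
  define R where "R n s \<longleftrightarrow> (\<exists>f. att f \<and> op n s \<epsilon> f)" for n s
  have R: "Dfn (\<lambda>u v. R (u 0) (u 1))"
    unfolding R_def att_def by (intro dfn Dfn_app3[OF G])
  have R0: "R emp x0"
    unfolding R_def att_def by (intro exI[of _ "ins (op emp x0) emp"]) simp
  have R0D: "s = x0" if "R emp s" for s
    using that succ_neq unfolding R_def att_def by (metis op_eq)
  have RS: "R (succ n) s'" if n: "n \<epsilon> om" "R n s" "G n s s'" for n s s'
  proof -
    obtain f where f: "att f" "op n s \<epsilon> f" using n unfolding R_def by blast
    have "att (ins (op (succ n) s') f)"
      using f n unfolding att_def mem_ins by blast
    then show ?thesis unfolding R_def by (intro exI[of _ "ins (op (succ n) s') f"]) simp
  qed
  have RSD: "\<exists>s. R n s \<and> G n s s'" if Rs: "R (succ n) s'" for n s'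
  proof -
    obtain f where f: "att f" "op (succ n) s' \<epsilon> f" using Rs unfolding R_def by blast
    then obtain m s where "op m s \<epsilon> f" "G m s s'" "succ n = succ m"
      using succ_neq unfolding att_def by (metis op_eq)
    then show ?thesis using f(1) succ_inj unfolding R_def by auto
  qed
  have "\<exists>!s. R n s" if "n \<epsilon> om" for n
  proof (rule om_induct[of "\<lambda>n. \<exists>!s. R n s", OF _ that])
    show "Dfn (\<lambda>u v. \<exists>!s. R (u 0) s)" unfolding Ex1_def by (intro dfn Dfn_app2[OF R])
    show "\<exists>!s. R emp s" using R0 R0D by blast
  next
    fix n assume n: "n \<epsilon> om" "\<exists>!s. R n s"
    then obtain s where s: "R n s" "\<And>t. R n t \<Longrightarrow> t = s" by blast
    obtain s' where s': "G n s s'" "\<And>t. G n s t \<Longrightarrow> t = s'" using total[of n s] by blast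
    show "\<exists>!s. R (succ n) s"
      using RS[OF n(1) s(1) s'(1)] RSD[of n] s(2) s'(2) by blast
  qed
  with R R0 RS show ?thesis using that[of R] by blast
qed

subsection \<open>Collection\<close>

text \<open>The iterates \<open>x\<close>, \<open>Uni x\<close>, \<open>Uni (Uni x)\<close> and so
  on form a set by Replacement along \<open>om\<close>; their union is transitive.\<close>

lemma ex_transitive_superset: "\<exists>t. x \<sqsubseteq> t \<and> (\<forall>y. y \<epsilon> t \<longrightarrow> y \<sqsubseteq> t)"
proof -
  have "Dfn (\<lambda>u v. u 2 = Uni (u 1))" by (intro dfn)
  then obtain R where R: "Dfn (\<lambda>u v. R (u 0) (u 1))" "R emp x" "\<And>n. n \<epsilon> om \<Longrightarrow> \<exists>!s. R n s"
    "\<And>n s s'. n \<epsilon> om \<Longrightarrow> R n s \<Longrightarrow> s' = Uni s \<Longrightarrow> R (succ n) s'"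
    by (rule om_recursion[where G = "\<lambda>n s s'. s' = Uni s" and ?x0.0 = x]) auto
  have "Dfn (\<lambda>u v. u 0 \<epsilon> om \<and> R (u 0) (u 1))" by (intro dfn R(1))
  then have "\<exists>b. \<forall>y. y \<epsilon> b \<longleftrightarrow> (\<exists>n. n \<epsilon> om \<and> n \<epsilon> om \<and> R n y)"
    by (rule replacement) (use R(3) in blast)
  then obtain b where b: "\<And>y. y \<epsilon> b \<longleftrightarrow> (\<exists>n. n \<epsilon> om \<and> R n y)" by blast
  have "x \<epsilon> b" using b R(2) emp_om by blast
  moreover have "Uni s \<epsilon> b" if "s \<epsilon> b" for s using that b R(4) succ_om by blast
  ultimately show ?thesis
    by (intro exI[of _ "Uni b"]) (auto simp: sub_def, metis mem_Uni)
qed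

text \<open>Foundation speaks of sets only; a transitive superset of \<open>x\<close> confines the
  relevant counterexamples to a set.\<close>

lemma eps_induct:
  assumes P: "Dfn (\<lambda>u v. P (u 0))" and step: "\<And>x. (\<And>y. y \<epsilon> x \<Longrightarrow> P y) \<Longrightarrow> P x"
  shows "P x"
proof (rule ccontr)
  assume "\<not> P x"
  obtain t where t: "x \<sqsubseteq> t" "\<And>y. y \<epsilon> t \<Longrightarrow> y \<sqsubseteq> t" using ex_transitive_superset by blast
  have "Dfn (\<lambda>u v. \<not> P (u 0))" using P by (intro dfn)
  from separation[OF this] obtain b where b: "\<And>y. y \<epsilon> b \<longleftrightarrow> y \<epsilon> t \<and> \<not> P y" by blast
  obtain y where "y \<epsilon> x" "\<not> P y" using step \<open>\<not> P x\<close> by blast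
  then have "y \<epsilon> b" using b t(1) by (auto simp: sub_def)
  then obtain z where z: "z \<epsilon> b" "\<forall>w. w \<epsilon> z \<longrightarrow> \<not> w \<epsilon> b" using foundation by blast
  then have "P z" using step b t(2) unfolding sub_def by metis
  then show False using z b by blast
qed

section \<open>A cumulative hierarchy without ordinals\<close>

definition acc :: "'m \<Rightarrow> 'm \<Rightarrow> bool" where
  "acc h z \<longleftrightarrow> (\<exists>y. y \<epsilon> h \<and> (z \<epsilon> y \<or> z \<sqsubseteq> y))"

text \<open>A history in the sense of Scott and Potter: each member is the accumulation of the
  members before it. The accumulations of histories play the part of the stages
  \<open>V_alpha\<close>, so ranks are available without developing ordinals.\<close>

definition hist :: "'m \<Rightarrow> bool" where
  "hist h \<longleftrightarrow> (\<forall>y. y \<epsilon> h \<longrightarrow> (\<forall>z. z \<epsilon> y \<longleftrightarrow> (\<exists>y'. y' \<epsilon> h \<and> y' \<epsilon> y \<and> (z \<epsilon> y' \<or> z \<sqsubseteq> y'))))"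

definition lev :: "'m \<Rightarrow> bool" where
  "lev l \<longleftrightarrow> (\<exists>h. hist h \<and> (\<forall>z. z \<epsilon> l \<longleftrightarrow> acc h z))"

lemma Dfn_lev [dfn]: "dtrm a \<Longrightarrow> Dfn (\<lambda>u v. lev (a u v))"
  by (rule Dfn_app[of "\<lambda>x u v. lev x"]) (unfold lev_def hist_def acc_def, intro dfn)

text \<open>Among the members of \<open>h\<close> that contain \<open>z\<close> take a minimal one;
  by the history property \<open>z\<close> is an element or a subset of an earlier member, and
  minimality excludes the former.\<close>

lemma hist_cover:
  assumes "hist h" and "acc h z"
  shows "\<exists>y. y \<epsilon> h \<and> z \<sqsubseteq> y"
proof (rule ccontr)
  assume neg: "\<not> ?thesis"
  have "Dfn (\<lambda>u v. z \<epsilon> u 0)" by (intro dfn)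
  from separation[OF this] obtain b where b: "\<And>y. y \<epsilon> b \<longleftrightarrow> y \<epsilon> h \<and> z \<epsilon> y" by blast
  obtain y where "y \<epsilon> b" using assms(2) neg b unfolding acc_def by blast
  then obtain y where y: "y \<epsilon> b" "\<forall>w. w \<epsilon> y \<longrightarrow> \<not> w \<epsilon> b" using foundation by blast
  then obtain y' where "y' \<epsilon> h" "y' \<epsilon> y" "z \<epsilon> y' \<or> z \<sqsubseteq> y'"
    using assms(1) b unfolding hist_def by blast
  then show False using neg b y(2) by blast
qed

lemma lev_cover:
  assumes "lev l" "x \<epsilon> l"
  shows "\<exists>h y. hist h \<and> (\<forall>z. z \<epsilon> l \<longleftrightarrow> acc h z) \<and> y \<epsilon> h \<and> x \<sqsubseteq> y"
proof -
  obtain h where h: "hist h" "\<And>z. z \<epsilon> l \<longleftrightarrow> acc h z" using assms(1) unfolding lev_def by blast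
  obtain y where "y \<epsilon> h" "x \<sqsubseteq> y" using hist_cover[OF h(1)] h(2) assms(2) by blast
  then show ?thesis using h by blast
qed

lemma lev_trans:
  assumes "lev l" "x \<epsilon> l" "y \<epsilon> x"
  shows "y \<epsilon> l"
proof -
  obtain h z where h: "\<And>z. z \<epsilon> l \<longleftrightarrow> acc h z" "z \<epsilon> h" "x \<sqsubseteq> z"
    using lev_cover[OF assms(1,2)] by blast
  then have "y \<epsilon> z" using assms(3) by (simp add: sub_def)
  then show ?thesis unfolding h(1) acc_def using h(2) by blast
qed

lemma lev_sub:
  assumes "lev l" "x \<epsilon> l" "y \<sqsubseteq> x"
  shows "y \<epsilon> l"
proof -
  obtain h z where h: "\<And>z. z \<epsilon> l \<longleftrightarrow> acc h z" "z \<epsilon> h" "x \<sqsubseteq> z"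
    using lev_cover[OF assms(1,2)] by blast
  then have "y \<sqsubseteq> z" using assms(3) by (simp add: sub_def)
  then show ?thesis unfolding h(1) acc_def using h(2) by blast
qed

text \<open>The part of \<open>h\<close> inside \<open>y\<close> is itself a history, and
  \<open>y\<close> is its accumulation.\<close>

lemma hist_mem_lev:
  assumes "hist h" and "y \<epsilon> h"
  shows "lev y"
proof -
  have hist: "z \<epsilon> k \<longleftrightarrow> (\<exists>y'. y' \<epsilon> h \<and> y' \<epsilon> k \<and> (z \<epsilon> y' \<or> z \<sqsubseteq> y'))" if "k \<epsilon> h" for k z
    using assms(1) that unfolding hist_def by blast
  have "Dfn (\<lambda>u v. u 0 \<epsilon> y)" by (intro dfn)
  from separation[OF this] obtain g where g: "\<And>x. x \<epsilon> g \<longleftrightarrow> x \<epsilon> h \<and> x \<epsilon> y" by blast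
  have yg: "z \<epsilon> y \<longleftrightarrow> acc g z" for z
    using hist[OF assms(2), of z] unfolding acc_def g by blast
  have sub: "w \<epsilon> y" if "z \<epsilon> g" "w \<epsilon> z" for z w
    unfolding yg acc_def using that by blast
  have "z \<epsilon> k \<longleftrightarrow> (\<exists>y'. y' \<epsilon> g \<and> y' \<epsilon> k \<and> (z \<epsilon> y' \<or> z \<sqsubseteq> y'))" if "k \<epsilon> g" for k z
  proof -
    have "k \<epsilon> h" using that g by blast
    then show ?thesis using hist[of k z] sub[OF that] g by blast
  qed
  then have "hist g" unfolding hist_def by blast
  with yg show ?thesis unfolding lev_def by blast
qed

lemma lev_acc:
  assumes "lev l"
  shows "z \<epsilon> l \<longleftrightarrow> (\<exists>k. lev k \<and> k \<epsilon> l \<and> (z \<epsilon> k \<or> z \<sqsubseteq> k))"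
proof
  assume l: "z \<epsilon> l"
  obtain h y where h: "hist h" "\<And>z. z \<epsilon> l \<longleftrightarrow> acc h z" and y: "y \<epsilon> h" "z \<sqsubseteq> y"
    using lev_cover[OF assms l] by blast
  moreover have "y \<sqsubseteq> y" by (simp add: sub_def)
  then have "y \<epsilon> l" unfolding h(2) acc_def using y(1) by blast
  ultimately show "\<exists>k. lev k \<and> k \<epsilon> l \<and> (z \<epsilon> k \<or> z \<sqsubseteq> k)"
    using hist_mem_lev[OF h(1)] by blast
next
  assume "\<exists>k. lev k \<and> k \<epsilon> l \<and> (z \<epsilon> k \<or> z \<sqsubseteq> k)"
  then show "z \<epsilon> l" using lev_trans[OF assms] lev_sub[OF assms] by blast
qed

definition least_lev :: "('m \<Rightarrow> bool) \<Rightarrow> 'm \<Rightarrow> bool" where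
  "least_lev P l \<longleftrightarrow> lev l \<and> P l \<and> (\<forall>j. lev j \<and> P j \<longrightarrow> \<not> j \<epsilon> l)"

lemma ex_least_lev:
  assumes P: "Dfn (\<lambda>u v. P (u 0))" and "lev l" "P l"
  shows "\<exists>k. least_lev P k"
proof -
  have "Dfn (\<lambda>u v. lev (u 0) \<and> P (u 0))" using P by (intro dfn)
  from separation[OF this, of l] obtain b where
    b: "\<And>x. x \<epsilon> b \<longleftrightarrow> x \<epsilon> l \<and> lev x \<and> P x" by blast
  show ?thesis
  proof (cases "\<exists>k. k \<epsilon> b")
    case True
    then obtain k where k: "k \<epsilon> b" "\<forall>w. w \<epsilon> k \<longrightarrow> \<not> w \<epsilon> b" using foundation by blast
    then have "least_lev P k"
      unfolding least_lev_def using b lev_trans[OF \<open>lev l\<close>] by blast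
    then show ?thesis ..
  next
    case False
    then have "least_lev P l"
      unfolding least_lev_def using assms b by blast
    then show ?thesis ..
  qed
qed

text \<open>Double minimality: \<open>k\<close> is minimal among the levels incomparable with some
  level, \<open>l\<close> minimal among those incomparable with \<open>k\<close>. Then both contain
  the same levels, and a level is determined by the levels in it.\<close>

lemma lev_linear:
  assumes "lev k" "lev l"
  shows "k \<epsilon> l \<or> k = l \<or> l \<epsilon> k"
proof (rule ccontr)
  define C where "C k l \<longleftrightarrow> k \<epsilon> l \<or> k = l \<or> l \<epsilon> k" for k l
  assume "\<not> ?thesis"
  then have neg: "\<exists>l. lev l \<and> \<not> C k l" using assms unfolding C_def by blast
  have "Dfn (\<lambda>u v. \<exists>l. lev l \<and> \<not> C (u 0) l)" unfolding C_def by (intro dfn)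
  from ex_least_lev[OF this assms(1) neg] obtain k where k: "lev k" "\<exists>l. lev l \<and> \<not> C k l"
    "\<And>j. lev j \<Longrightarrow> \<exists>l. lev l \<and> \<not> C j l \<Longrightarrow> \<not> j \<epsilon> k"
    unfolding least_lev_def by blast
  then obtain l' where l': "lev l'" "\<not> C k l'" by blast
  have "Dfn (\<lambda>u v. \<not> C k (u 0))" unfolding C_def by (intro dfn)
  from ex_least_lev[OF this l'] obtain l where
    l: "lev l" "\<not> C k l" "\<And>j. lev j \<Longrightarrow> \<not> C k j \<Longrightarrow> \<not> j \<epsilon> l"
    unfolding least_lev_def by blast
  have "j \<epsilon> l" if "lev j" "j \<epsilon> k" for j
  proof -
    have "C j l" using k(3) that l(1) by blast
    then show ?thesis using l(2) that lev_trans[OF k(1)] unfolding C_def by blast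
  qed
  moreover have "j \<epsilon> k" if "lev j" "j \<epsilon> l" for j
  proof -
    have "C k j" using l(3) that by blast
    then show ?thesis using l(2) that lev_trans[OF l(1)] unfolding C_def by blast
  qed
  ultimately have "k = l"
    by (intro extI) (use lev_acc[OF k(1)] lev_acc[OF l(1)] in blast)
  then show False using l(2) by (simp add: C_def)
qed

lemma least_lev_unique: "least_lev P k \<Longrightarrow> least_lev P l \<Longrightarrow> k = l"
  using lev_linear unfolding least_lev_def by blast

lemma ex_union2: "\<exists>c. \<forall>z. z \<epsilon> c \<longleftrightarrow> z \<epsilon> a \<or> z \<epsilon> b"
proof -
  obtain p where "\<And>z. z \<epsilon> p \<longleftrightarrow> z = a \<or> z = b" using ex_pair by blast
  then have "z \<epsilon> Uni p \<longleftrightarrow> z \<epsilon> a \<or> z \<epsilon> b" for z by auto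
  then show ?thesis by blast
qed

lemma sub_refl [simp]: "x \<sqsubseteq> x"
  by (simp add: sub_def)

lemma ex_acc: "\<exists>l. \<forall>z. z \<epsilon> l \<longleftrightarrow> acc h z"
proof -
  obtain c where c: "\<And>z. z \<epsilon> c \<longleftrightarrow> z \<epsilon> Uni h \<or> z \<epsilon> Pw (Uni h)"
    using ex_union2 by blast
  have "z \<epsilon> c" if "acc h z" for z
    using that unfolding c mem_Pw mem_Uni sub_def acc_def by blast
  moreover have "Dfn (\<lambda>u v. acc h (u 0))" unfolding acc_def by (intro dfn)
  from separation[OF this] obtain l where "\<And>z. z \<epsilon> l \<longleftrightarrow> z \<epsilon> c \<and> acc h z" by blast
  ultimately show ?thesis by blast
qed

lemma hist_extend:
  assumes "hist h" and l: "\<And>z. z \<epsilon> l \<longleftrightarrow> acc h z"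
  shows "hist (ins l h)"
proof -
  have hl: "y \<epsilon> l" if "y \<epsilon> h" for y
    unfolding l acc_def using that sub_refl by blast
  have nl: "\<not> l \<epsilon> y" if "y \<epsilon> h" for y
    using hl[OF that] not_cycle2 by blast
  have "z \<epsilon> l \<longleftrightarrow> (\<exists>y'. y' \<epsilon> ins l h \<and> y' \<epsilon> l \<and> (z \<epsilon> y' \<or> z \<sqsubseteq> y'))" for z
  proof -
    have "z \<epsilon> l \<longleftrightarrow> (\<exists>y'. y' \<epsilon> h \<and> (z \<epsilon> y' \<or> z \<sqsubseteq> y'))" unfolding l acc_def ..
    then show ?thesis using hl not_self[of l] by auto
  qed
  moreover have "z \<epsilon> y \<longleftrightarrow> (\<exists>y'. y' \<epsilon> ins l h \<and> y' \<epsilon> y \<and> (z \<epsilon> y' \<or> z \<sqsubseteq> y'))"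
    if "y \<epsilon> h" for y z
  proof -
    have "z \<epsilon> y \<longleftrightarrow> (\<exists>y'. y' \<epsilon> h \<and> y' \<epsilon> y \<and> (z \<epsilon> y' \<or> z \<sqsubseteq> y'))"
      using assms(1) that unfolding hist_def by blast
    then show ?thesis using nl[OF that] by auto
  qed
  ultimately show ?thesis unfolding hist_def mem_ins by blast
qed

lemma ex_lev_step:
  assumes "\<And>y. y \<epsilon> x \<Longrightarrow> \<exists>l. lev l \<and> y \<epsilon> l"
  shows "\<exists>l. lev l \<and> x \<epsilon> l"
proof -
  define F where "F y l \<longleftrightarrow> least_lev (\<lambda>l. y \<epsilon> l) l" for y l
  have F: "Dfn (\<lambda>u v. F (u 0) (u 1))" unfolding F_def least_lev_def by (intro dfn)
  have Fex: "\<exists>l. F y l" if y: "y \<epsilon> x" for y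
  proof -
    obtain l where "lev l" "y \<epsilon> l" using assms[OF y] by blast
    moreover have "Dfn (\<lambda>u v. y \<epsilon> u 0)" by (intro dfn)
    ultimately show ?thesis unfolding F_def by (intro ex_least_lev[where P = "\<lambda>l. y \<epsilon> l"])
  qed
  have Flev: "lev l" "y \<epsilon> l" if "F y l" for y l
    using that unfolding F_def least_lev_def by blast+
  have "k = l" if "F y k" "F y l" for y k l
    using that unfolding F_def by (rule least_lev_unique)
  then have "\<exists>b. \<forall>l. l \<epsilon> b \<longleftrightarrow> (\<exists>y. y \<epsilon> x \<and> F y l)"
    by (rule replacement[OF F])
  then obtain b where b: "\<And>l. l \<epsilon> b \<longleftrightarrow> (\<exists>y. y \<epsilon> x \<and> F y l)" by blast
  \<comment> \<open>\<open>b\<close> holds the least levels for the elements of \<open>x\<close>.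
    Adding the members of these and keeping only levels gives a family closed downwards under
    levels, as a history must be.\<close>
  obtain c where c: "\<And>k. k \<epsilon> c \<longleftrightarrow> k \<epsilon> b \<or> k \<epsilon> Uni b" using ex_union2 by blast
  have "Dfn (\<lambda>u v. lev (u 0))" by (intro dfn)
  from separation[OF this, of c] obtain h where h: "\<And>k. k \<epsilon> h \<longleftrightarrow> k \<epsilon> c \<and> lev k" by blast
  have h_down: "j \<epsilon> h" if j: "lev j" "j \<epsilon> k" "k \<epsilon> h" for j k
  proof -
    have "k \<epsilon> b \<or> (\<exists>m. m \<epsilon> b \<and> k \<epsilon> m)" using j(3) unfolding h c mem_Uni by blast
    then have "\<exists>m. m \<epsilon> b \<and> j \<epsilon> m"
    proof
      assume "\<exists>m. m \<epsilon> b \<and> k \<epsilon> m"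
      then obtain m where m: "m \<epsilon> b" "k \<epsilon> m" by blast
      then have "lev m" using b Flev(1) by blast
      then show ?thesis using m lev_trans j(2) by blast
    qed (use j(2) in blast)
    then show ?thesis unfolding h c mem_Uni using j(1) by blast
  qed
  have "z \<epsilon> k \<longleftrightarrow> (\<exists>y'. y' \<epsilon> h \<and> y' \<epsilon> k \<and> (z \<epsilon> y' \<or> z \<sqsubseteq> y'))" if k: "k \<epsilon> h" for k z
  proof -
    have "lev k" using k h by blast
    have *: "y' \<epsilon> h \<and> y' \<epsilon> k \<longleftrightarrow> lev y' \<and> y' \<epsilon> k" for y'
      using h_down k h by blast
    show ?thesis using lev_acc[OF \<open>lev k\<close>, of z] * by blast
  qed
  then have "hist h" unfolding hist_def by blast
  obtain l' where l': "\<And>z. z \<epsilon> l' \<longleftrightarrow> acc h z" using ex_acc by blast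
  \<comment> \<open>The level \<open>l'\<close> contains all elements of \<open>x\<close>, so
    \<open>x\<close> is a subset of it; one more accumulation makes \<open>x\<close> a
    member.\<close>
  have hist': "hist (ins l' h)" using \<open>hist h\<close> l' by (rule hist_extend)
  obtain l where l: "\<And>z. z \<epsilon> l \<longleftrightarrow> acc (ins l' h) z" using ex_acc by blast
  have "lev l" unfolding lev_def using hist' l by blast
  moreover have "y \<epsilon> l'" if y: "y \<epsilon> x" for y
  proof -
    obtain l where l: "F y l" using Fex[OF y] by blast
    then have "l \<epsilon> h" using b y h c Flev(1) by blast
    then show ?thesis unfolding l' acc_def using Flev(2)[OF l] by blast
  qed
  then have "x \<sqsubseteq> l'" by (simp add: sub_def)
  then have "x \<epsilon> l" unfolding l acc_def by (intro exI[of _ l']) simp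
  ultimately show ?thesis by blast
qed

lemma ex_lev: "\<exists>l. lev l \<and> x \<epsilon> l"
proof -
  have "Dfn (\<lambda>u v. \<exists>l. lev l \<and> u 0 \<epsilon> l)" by (intro dfn)
  then show ?thesis by (rule eps_induct[where P = "\<lambda>x. \<exists>l. lev l \<and> x \<epsilon> l"]) (rule ex_lev_step)
qed

text \<open>Scott's trick: Replacement applies to the least level that contains a witness, because
  this level is unique; the union of these levels bounds the witnesses.\<close>

theorem collection:
  assumes F: "Dfn (\<lambda>u v. F (u 0) (u 1))"
  shows "\<exists>b. \<forall>x. x \<epsilon> a \<longrightarrow> (\<exists>y. F x y) \<longrightarrow> (\<exists>y. y \<epsilon> b \<and> F x y)"
proof -
  define G where "G x l \<longleftrightarrow> least_lev (\<lambda>l. \<exists>y. y \<epsilon> l \<and> F x y) l" for x l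
  have G: "Dfn (\<lambda>u v. G (u 0) (u 1))" unfolding G_def least_lev_def by (intro dfn Dfn_app2[OF F])
  have "k = l" if "G x k" "G x l" for x k l
    using that unfolding G_def by (rule least_lev_unique)
  then have "\<exists>b. \<forall>l. l \<epsilon> b \<longleftrightarrow> (\<exists>x. x \<epsilon> a \<and> G x l)"
    by (rule replacement[OF G])
  then obtain b where b: "\<And>l. l \<epsilon> b \<longleftrightarrow> (\<exists>x. x \<epsilon> a \<and> G x l)" by blast
  have "\<exists>y. y \<epsilon> Uni b \<and> F x y" if x: "x \<epsilon> a" "F x y" for x y
  proof -
    obtain l where l: "lev l" "y \<epsilon> l" using ex_lev by blast
    have "Dfn (\<lambda>u v. \<exists>y. y \<epsilon> u 0 \<and> F x y)" by (intro dfn Dfn_app2[OF F])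
    moreover have "\<exists>y. y \<epsilon> l \<and> F x y" using l x by blast
    ultimately obtain k where "G x k"
      using ex_least_lev[of "\<lambda>l. \<exists>y. y \<epsilon> l \<and> F x y", OF _ l(1)] unfolding G_def by blast
    then have "k \<epsilon> b" "\<exists>y. y \<epsilon> k \<and> F x y" using b x unfolding G_def least_lev_def by blast+
    then show ?thesis unfolding mem_Uni by blast
  qed
  then show ?thesis by blast
qed

subsection \<open>Finite sets\<close>

text \<open>Copies the shape of \<open>bij_fm\<close>, so that the two agree by unfolding.\<close>

definition bijn :: "'m \<Rightarrow> 'm \<Rightarrow> 'm \<Rightarrow> bool" where
  "bijn f n a \<longleftrightarrow> (\<forall>p. p \<epsilon> f \<longrightarrow> (\<exists>x. x \<epsilon> n \<and> (\<exists>y. y \<epsilon> a \<and> p = op x y))) \<and>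
    (\<forall>x. x \<epsilon> n \<longrightarrow> (\<exists>y. \<forall>z. z \<epsilon> a \<and> op x z \<epsilon> f \<longleftrightarrow> z = y)) \<and>
    (\<forall>y. y \<epsilon> a \<longrightarrow> (\<exists>x. \<forall>z. z \<epsilon> n \<and> op z y \<epsilon> f \<longleftrightarrow> z = x))"

definition Fin :: "'m \<Rightarrow> bool" where
  "Fin a \<longleftrightarrow> (\<exists>n. n \<epsilon> om \<and> (\<exists>f. bijn f n a))"

lemma Dfn_Fin [dfn]: "dtrm a \<Longrightarrow> Dfn (\<lambda>u v. Fin (a u v))"
  by (rule Dfn_app[of "\<lambda>x u v. Fin x"]) (unfold Fin_def bijn_def, intro dfn)

lemma Sat_connectives:
  "Sat e (p \<^bold>\<and> q) \<longleftrightarrow> Sat e p \<and> Sat e q" "Sat e (p \<^bold>\<or> q) \<longleftrightarrow> Sat e p \<or> Sat e q"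
  "Sat e (p \<^bold>\<longleftrightarrow> q) \<longleftrightarrow> (Sat e p \<longleftrightarrow> Sat e q)" "Sat e (Exists p) \<longleftrightarrow> (\<exists>x. Sat (case_nat x e) p)"
  by auto

lemma Sat_upair: "Sat e (upair_fm p a b) \<longleftrightarrow> e p = ins (e a) (ins (e b) emp)"
  unfolding upair_fm_def ext_iff[of "e p"] sat.simps(6) Sat_connectives(3)
  unfolding Sat_connectives(2) by simp

lemma Sat_opair: "Sat e (opair_fm p a b) \<longleftrightarrow> e p = op (e a) (e b)"
proof -
  have "ins x (ins x emp) = ins x emp" for x by (rule extI) auto
  then show ?thesis by (auto simp: opair_fm_def Sat_upair op_def)
qed

lemma Sat_related: "Sat e (related_fm f a b) \<longleftrightarrow> op (e a) (e b) \<epsilon> e f"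
  by (auto simp: related_fm_def Sat_opair)

lemma Sat_Ex1In:
  "Sat e (Ex1In a p) \<longleftrightarrow> (\<exists>y. \<forall>z. z \<epsilon> e a \<and> Sat (case_nat z e) p \<longleftrightarrow> z = y)"
proof -
  have 1: "(\<lambda>n. case_nat z (case_nat y e) (if n < 1 then n else n + 1)) = case_nat z e" for z y
    by (auto split: nat.split)
  show ?thesis
    unfolding Ex1In_def lift_from_def Sat_connectives(4) sat.simps(6)
    unfolding Sat_connectives(3) unfolding Sat_connectives(1) sat_ren 1 by simp
qed

lemma Sat_bij: "Sat e (bij_fm f n a) \<longleftrightarrow> bijn (e f) (e n) (e a)"
proof -
  have "Sat e (bij_fm f n a) \<longleftrightarrow>
    Sat e (AllIn f (ExIn (n + 1) (ExIn (a + 2) (opair_fm 2 1 0)))) \<and>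
    Sat e (AllIn n (Ex1In (a + 1) (related_fm (f + 2) 1 0))) \<and>
    Sat e (AllIn a (Ex1In (n + 1) (related_fm (f + 2) 0 1)))"
    by (simp add: bij_fm_def)
  then show ?thesis
    by (simp add: bijn_def Sat_Ex1In Sat_opair Sat_related)
qed

lemma Sat_finite: "Sat e (finite_fm k) \<longleftrightarrow> Fin (e k)"
proof -
  have "Sat e (finite_fm k) \<longleftrightarrow> (\<exists>w. w = om \<and> (\<exists>n. n \<epsilon> w \<and> (\<exists>f. bijn f n (e k))))"
    by (simp add: finite_fm_def Sat_Nat Sat_bij eval_nat_numeral)
  then show ?thesis by (simp add: Fin_def)
qed

lemma Fin_emp [simp]: "Fin emp"
  unfolding Fin_def bijn_def by (intro exI[of _ emp] conjI) simp_all

lemma Fin_ins: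
  assumes "Fin a"
  shows "Fin (ins t a)"
proof (cases "t \<epsilon> a")
  case True
  then have "ins t a = a" by (intro extI) auto
  then show ?thesis using assms by simp
next
  case False
  obtain n f where n: "n \<epsilon> om" "bijn f n a" using assms unfolding Fin_def by blast
  have dom: "x \<epsilon> n \<and> y \<epsilon> a" if "op x y \<epsilon> f" for x y
    using n(2) that unfolding bijn_def by (metis op_eq)
  have "bijn (ins (op n t) f) (succ n) (ins t a)"
    unfolding bijn_def
  proof (intro conjI allI impI)
    fix p assume "p \<epsilon> ins (op n t) f"
    then show "\<exists>x. x \<epsilon> succ n \<and> (\<exists>y. y \<epsilon> ins t a \<and> p = op x y)"
      using n(2) unfolding bijn_def mem_ins by blast
  next
    fix x assume "x \<epsilon> succ n"
    then show "\<exists>y. \<forall>z. (z \<epsilon> ins t a \<and> op x z \<epsilon> ins (op n t) f) = (z = y)"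
      using n(2) dom not_self[of n] False unfolding bijn_def mem_ins op_eq by metis
  next
    fix y assume "y \<epsilon> ins t a"
    then show "\<exists>x. \<forall>z. (z \<epsilon> succ n \<and> op z y \<epsilon> ins (op n t) f) = (z = x)"
      using n(2) dom not_self[of n] False unfolding bijn_def mem_ins op_eq by metis
  qed
  then show ?thesis using n(1) unfolding Fin_def by (blast intro: succ_om)
qed

text \<open>Reduces to induction on the size in \<open>om\<close>. Definability of \<open>P\<close>
  is essential, since a set finite in the model may be infinite from outside.\<close>

lemma Fin_induct:
  assumes P: "Dfn (\<lambda>u v. P (u 0))" and "Fin a" and "P emp"
    and step: "\<And>a t. Fin a \<Longrightarrow> P a \<Longrightarrow> P (ins t a)"
  shows "P a"
proof -
  have "\<forall>a f. bijn f n a \<longrightarrow> P a" if "n \<epsilon> om" for n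
  proof (rule om_induct[of "\<lambda>n. \<forall>a f. bijn f n a \<longrightarrow> P a", OF _ that])
    show "Dfn (\<lambda>u v. \<forall>a f. bijn f (u 0) a \<longrightarrow> P a)"
      unfolding bijn_def by (intro dfn Dfn_app[of "\<lambda>x u v. P x", OF P])
    have "a = emp" if "bijn f emp a" for f a
      using that extI[of a emp] unfolding bijn_def by (metis mem_emp)
    then show "\<forall>a f. bijn f emp a \<longrightarrow> P a" using \<open>P emp\<close> by blast
  next
    fix n assume n: "n \<epsilon> om" and IH: "\<forall>a f. bijn f n a \<longrightarrow> P a"
    show "\<forall>a f. bijn f (succ n) a \<longrightarrow> P a"
    proof (intro allI impI)
      fix a f assume f: "bijn f (succ n) a"
      have dom: "x \<epsilon> succ n \<and> y \<epsilon> a" if "op x y \<epsilon> f" for x y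
        using f that unfolding bijn_def by (metis op_eq)
      have func: "y = z" if "op x y \<epsilon> f" "op x z \<epsilon> f" for x y z
        using f that dom unfolding bijn_def by metis
      have inj: "x = z" if "op x y \<epsilon> f" "op z y \<epsilon> f" for x y z
        using f that dom unfolding bijn_def by metis
      have tot: "\<exists>y. op x y \<epsilon> f" if "x \<epsilon> succ n" for x
        using f that unfolding bijn_def by metis
      have sur: "\<exists>x. op x y \<epsilon> f" if "y \<epsilon> a" for y
        using f that unfolding bijn_def by metis
      \<comment> \<open>The image of the last number \<open>n\<close>; removing it leaves a
        bijection from \<open>n\<close> onto the rest \<open>b\<close>.\<close>
      obtain t where t: "op n t \<epsilon> f" using tot[of n] by auto
      have "Dfn (\<lambda>u v. u 0 \<noteq> t)" by (intro dfn)
      from separation[OF this] obtain b where b: "\<And>x. x \<epsilon> b \<longleftrightarrow> x \<epsilon> a \<and> x \<noteq> t" by blast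
      have "Dfn (\<lambda>u v. u 0 \<noteq> op n t)" by (intro dfn)
      from separation[OF this] obtain g where g: "\<And>x. x \<epsilon> g \<longleftrightarrow> x \<epsilon> f \<and> x \<noteq> op n t" by blast
      have "bijn g n b"
        unfolding bijn_def
      proof (intro conjI allI impI)
        fix p assume "p \<epsilon> g"
        then have p: "p \<epsilon> f" "p \<noteq> op n t" using g by auto
        then obtain x y where xy: "p = op x y" "x \<epsilon> succ n" "y \<epsilon> a" using f unfolding bijn_def by blast
        then have "x \<noteq> n" "y \<noteq> t" using p t func inj by auto
        then show "\<exists>x. x \<epsilon> n \<and> (\<exists>y. y \<epsilon> b \<and> p = op x y)" using xy b by auto
      next
        fix x assume x: "x \<epsilon> n"
        then obtain y where y: "op x y \<epsilon> f" using tot by auto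
        have "x \<noteq> n" using x not_self by blast
        then have "y \<noteq> t" using y t inj by blast
        show "\<exists>y. \<forall>z. (z \<epsilon> b \<and> op x z \<epsilon> g) = (z = y)"
          using y dom func b g \<open>x \<noteq> n\<close> \<open>y \<noteq> t\<close> by (intro exI[of _ y]) auto
      next
        fix y assume y: "y \<epsilon> b"
        then obtain x where x: "op x y \<epsilon> f" "y \<noteq> t" using sur b by blast
        then have "x \<noteq> n" using t func by blast
        then have "x \<epsilon> n" using dom x by auto
        show "\<exists>x. \<forall>z. (z \<epsilon> n \<and> op z y \<epsilon> g) = (z = x)"
          using x inj g \<open>x \<epsilon> n\<close> by (intro exI[of _ x]) auto
      qed
      then have "P b" "Fin b" using IH n unfolding Fin_def by blast+
      moreover have "a = ins t b" using dom[OF t] b by (intro extI) auto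
      ultimately show "P a" using step by blast
    qed
  qed
  then show ?thesis using \<open>Fin a\<close> unfolding Fin_def by blast
qed

lemma Fin_union:
  assumes "Fin a" "Fin b"
  shows "\<exists>c. Fin c \<and> (\<forall>x. x \<epsilon> c \<longleftrightarrow> x \<epsilon> a \<or> x \<epsilon> b)"
proof (rule Fin_induct[of "\<lambda>a. \<exists>c. Fin c \<and> (\<forall>x. x \<epsilon> c \<longleftrightarrow> x \<epsilon> a \<or> x \<epsilon> b)", OF _ assms(1)])
  show "Dfn (\<lambda>u v. \<exists>c. Fin c \<and> (\<forall>x. x \<epsilon> c \<longleftrightarrow> x \<epsilon> u 0 \<or> x \<epsilon> b))" by (intro dfn)
  show "\<exists>c. Fin c \<and> (\<forall>x. x \<epsilon> c \<longleftrightarrow> x \<epsilon> emp \<or> x \<epsilon> b)" using assms(2) by auto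
next
  fix a t assume "\<exists>c. Fin c \<and> (\<forall>x. x \<epsilon> c \<longleftrightarrow> x \<epsilon> a \<or> x \<epsilon> b)"
  then obtain c where "Fin c" "\<And>x. x \<epsilon> c \<longleftrightarrow> x \<epsilon> a \<or> x \<epsilon> b" by blast
  then show "\<exists>c. Fin c \<and> (\<forall>x. x \<epsilon> c \<longleftrightarrow> x \<epsilon> ins t a \<or> x \<epsilon> b)"
    by (intro exI[of _ "ins t c"]) (auto intro: Fin_ins)
qed

section \<open>Forcing conditions\<close>

text \<open>Only the names at the finitely many free indices of the formula matter. This is the
  source of fresh names.\<close>

lemma Dfn_support:
  assumes "Dfn \<Phi>"
  shows "\<exists>k. \<forall>u v v'. (\<forall>j<k. v j = v' j) \<longrightarrow> \<Phi> u v = \<Phi> u v'"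
proof -
  obtain p t where p: "eps_formula p" "\<And>u v. \<Phi> u v = Sat (\<lambda>n. tval u v (t n)) p"
    using assms by (elim DfnE) (rule that)
  define h where "h n = (case t n of Nam j \<Rightarrow> Suc j | _ \<Rightarrow> 0)" for n
  define k where "k = Max (insert 0 (h ` {..<fv_bound p}))"
  have hk: "h n \<le> k" if "n < fv_bound p" for n
    unfolding k_def by (rule Max_ge) (use that in auto)
  have "\<Phi> u v = \<Phi> u v'" if v: "\<forall>j<k. v j = v' j" for u v v'
    unfolding p(2)
  proof (rule sat_fv_cong)
    fix n assume "n < fv_bound p"
    then show "tval u v (t n) = tval u v' (t n)"
      using hk[of n] v by (cases "t n") (auto simp: h_def)
  qed
  then show ?thesis by blast
qed

text \<open>A valuation is not an element of the model, but quantifying over valuations amounts to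
  quantifying over the finitely many values that matter. Needed for the trivial condition.\<close>

lemma Dfn_ex_names:
  assumes "Dfn \<Phi>"
  shows "Dfn (\<lambda>u v. \<exists>w. \<Phi> u w)"
proof -
  have "Dfn (\<lambda>u v. \<exists>w. \<Phi> u w)"
    if "Dfn \<Phi>" "\<And>u v v'. (\<forall>j<k. v j = v' j) \<Longrightarrow> \<Phi> u v = \<Phi> u v'" for \<Phi> k
    using that
  proof (induction k arbitrary: \<Phi>)
    case 0
    have "(\<exists>w. \<Phi> u w) = \<Phi> u (\<lambda>_. emp)" for u
    proof -
      have "\<Phi> u w = \<Phi> u (\<lambda>_. emp)" for w by (rule 0(2)) simp
      then show ?thesis by blast
    qed
    then show ?case using Dfn_subst_names[OF 0(1), of Loc "\<lambda>_. Par emp"] by simp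
  next
    case (Suc k)
    \<comment> \<open>The highest relevant name becomes a local variable, which an ordinary
      quantifier then binds.\<close>
    let ?\<Psi> = "\<lambda>u w. \<Phi> (\<lambda>n. u (Suc n)) (w(k := u 0))"
    have "(\<lambda>n. tval u v (if n = k then Loc 0 else Nam n)) = v(k := u 0)" for u v :: "nat \<Rightarrow> 'm"
      by auto
    then have "Dfn ?\<Psi>"
      using Dfn_subst_names[OF Suc.prems(1), of "\<lambda>n. Loc (Suc n)" "\<lambda>n. if n = k then Loc 0 else Nam n"]
      by simp
    moreover have "?\<Psi> u v = ?\<Psi> u v'" if "\<forall>j<k. v j = v' j" for u v v'
      by (rule Suc.prems(2)) (use that less_Suc_eq in auto)
    ultimately have "Dfn (\<lambda>u v. \<exists>w. ?\<Psi> u w)" by (rule Suc.IH)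
    then have "Dfn (\<lambda>u v. \<exists>x. \<exists>w. \<Phi> u (w(k := x)))" by (rule Dfn_ex)
    moreover have "(\<exists>x. \<exists>w. \<Phi> u (w(k := x))) = (\<exists>w. \<Phi> u w)" for u
    proof
      assume "\<exists>w. \<Phi> u w"
      then obtain w where "\<Phi> u w" ..
      then have "\<Phi> u (w(k := w k))" by simp
      then show "\<exists>x. \<exists>w. \<Phi> u (w(k := x))" by blast
    qed blast
    ultimately show ?case by simp
  qed
  note elim = this
  obtain k where "\<And>u v v'. (\<forall>j<k. v j = v' j) \<Longrightarrow> \<Phi> u v = \<Phi> u v'"
    using Dfn_support[OF assms] by blast
  then show ?thesis by (rule elim[OF assms])
qed

text \<open>A condition is a proper filter on valuations of the names that is coded in the model.  It is
  represented by its family of positive predicates, i.e. the \<open>P\<close> whose negation is not in the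
  filter.  The last clause replaces a bound on the values of the names.\<close>

definition cond :: "(((nat \<Rightarrow> 'm) \<Rightarrow> bool) \<Rightarrow> bool) \<Rightarrow> bool" where
  "cond Pos \<longleftrightarrow>
    (\<forall>P Q. (\<forall>v. P v \<longrightarrow> Q v) \<longrightarrow> Pos P \<longrightarrow> Pos Q) \<and>
    Pos (\<lambda>v. True) \<and> \<not> Pos (\<lambda>v. False) \<and>
    (\<forall>P Q. Pos (\<lambda>v. P v \<or> Q v) \<longrightarrow> Pos P \<or> Pos Q) \<and>
    (\<forall>\<Phi>. Dfn \<Phi> \<longrightarrow> Dfn (\<lambda>u v. Pos (\<Phi> u))) \<and>
    (\<exists>k. \<forall>j\<ge>k. \<forall>P. Pos (\<lambda>v. \<exists>y. P (v(j := y))) \<longrightarrow> Pos P) \<and>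
    (\<forall>F. Dfn (\<lambda>u v. F (u 0) v) \<longrightarrow> Pos (\<lambda>v. \<exists>y. F y v) \<longrightarrow> (\<exists>b. Pos (\<lambda>v. \<exists>y. y \<epsilon> b \<and> F y v)))"

lemma condD:
  assumes "cond Pos"
  shows "\<forall>P Q. (\<forall>v. P v \<longrightarrow> Q v) \<longrightarrow> Pos P \<longrightarrow> Pos Q"
    and cond_True: "Pos (\<lambda>v. True)" and cond_False: "\<not> Pos (\<lambda>v. False)"
    and "\<forall>P Q. Pos (\<lambda>v. P v \<or> Q v) \<longrightarrow> Pos P \<or> Pos Q"
    and "\<forall>\<Phi>. Dfn \<Phi> \<longrightarrow> Dfn (\<lambda>u v. Pos (\<Phi> u))"
    and cond_fresh: "\<exists>k. \<forall>j\<ge>k. \<forall>P. Pos (\<lambda>v. \<exists>y. P (v(j := y))) \<longrightarrow> Pos P"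
    and "\<forall>F. Dfn (\<lambda>u v. F (u 0) v) \<longrightarrow> Pos (\<lambda>v. \<exists>y. F y v) \<longrightarrow>
      (\<exists>b. Pos (\<lambda>v. \<exists>y. y \<epsilon> b \<and> F y v))"
  using assms unfolding cond_def by - (elim conjE, assumption)+

lemmas cond_disj = condD(4)[rule_format]
lemmas cond_Dfn = condD(5)[rule_format]
lemmas cond_bound = condD(7)[rule_format]

lemma cond_mono:
  assumes "cond Pos" "Pos P" "\<And>v. P v \<Longrightarrow> Q v"
  shows "Pos Q"
proof -
  have "\<forall>v. P v \<longrightarrow> Q v" using assms(3) by blast
  then show ?thesis using condD(1)[OF assms(1)] assms(2) by simp
qed

lemma cond_split:
  assumes "cond Pos" "Pos P" "\<And>v. P v \<Longrightarrow> Q v \<or> R v"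
  shows "Pos Q \<or> Pos R"
  by (rule cond_disj[OF assms(1)], rule cond_mono[OF assms(1,2)], rule assms(3))

text \<open>The trivial filter, whose only member is the set of all valuations; positive are the
  predicates with a solution.\<close>

lemma cond_init: "cond (\<lambda>P. \<exists>v. P v)"
  unfolding cond_def
proof (intro conjI allI impI)
  fix \<Phi> assume "Dfn \<Phi>"
  then show "Dfn (\<lambda>u v. \<exists>v. \<Phi> u v)" by (rule Dfn_ex_names)
next
  fix F :: "'m \<Rightarrow> (nat \<Rightarrow> 'm) \<Rightarrow> bool"
  assume "\<exists>v y. F y v"
  then obtain v y where "F y v" by blast
  then show "\<exists>b v y. y \<epsilon> b \<and> F y v"
    by (intro exI[of _ "ins y emp"] exI[of _ v] exI[of _ y]) simp
qed auto

lemma Dfn_support_upd: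
  assumes "Dfn (\<lambda>u v. G (u 0) v)"
  shows "\<exists>k. \<forall>j\<ge>k. \<forall>x v y. G x (v(j := y)) = G x v"
proof -
  obtain k where k: "\<forall>(u :: nat \<Rightarrow> 'm) v v'. (\<forall>j<k. v j = v' j) \<longrightarrow> G (u 0) v = G (u 0) v'"
    using Dfn_support[OF assms] ..
  have "G x (v(j := y)) = G x v" if "j \<ge> k" for j x v y
  proof -
    have "\<forall>i<k. (v(j := y)) i = v i" using that by simp
    then show ?thesis
      using k[THEN spec[of _ "\<lambda>_. x"], THEN spec[of _ "v(j := y)"], THEN spec[of _ v]] by (rule rev_mp)
  qed
  then show ?thesis by (intro exI[of _ k]) simp
qed

text \<open>Adds one definable set to the filter. As \<open>R\<close> has finite support, almost all
  names stay unconstrained.\<close>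

lemma cond_restrict:
  assumes c: "cond Pos" and R: "Dfn (\<lambda>u v. R v)" and "Pos R"
  shows "cond (\<lambda>P. Pos (\<lambda>v. P v \<and> R v))"
  unfolding cond_def
proof (intro conjI allI impI)
  fix P Q :: "(nat \<Rightarrow> 'm) \<Rightarrow> bool"
  assume "\<forall>v. P v \<longrightarrow> Q v" "Pos (\<lambda>v. P v \<and> R v)"
  then show "Pos (\<lambda>v. Q v \<and> R v)" by (elim cond_mono[OF c]) blast
next
  show "Pos (\<lambda>v. True \<and> R v)" using \<open>Pos R\<close> by simp
  show "\<not> Pos (\<lambda>v. False \<and> R v)" using cond_False[OF c] by simp
next
  fix P Q :: "(nat \<Rightarrow> 'm) \<Rightarrow> bool"
  assume "Pos (\<lambda>v. (P v \<or> Q v) \<and> R v)"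
  then show "Pos (\<lambda>v. P v \<and> R v) \<or> Pos (\<lambda>v. Q v \<and> R v)" by (elim cond_split[OF c]) blast
next
  fix \<Phi> assume "Dfn \<Phi>"
  then show "Dfn (\<lambda>u v. Pos (\<lambda>v. \<Phi> u v \<and> R v))" using R by (intro cond_Dfn[OF c] Dfn_conj)
next
  obtain k1 :: nat where k1': "\<forall>j\<ge>k1. \<forall>P. Pos (\<lambda>v. \<exists>y. P (v(j := y))) \<longrightarrow> Pos P"
    using cond_fresh[OF c] ..
  note k1 = k1'[rule_format]
  obtain k2 :: nat where k2': "\<forall>j\<ge>k2. \<forall>(x :: 'm) v y. R (v(j := y)) = R v"
    using Dfn_support_upd[of "\<lambda>x. R", OF R] ..
  note k2 = k2'[rule_format]
  show "\<exists>k. \<forall>j\<ge>k. \<forall>P. Pos (\<lambda>v. (\<exists>y. P (v(j := y))) \<and> R v) \<longrightarrow> Pos (\<lambda>v. P v \<and> R v)"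
  proof (intro exI[of _ "max k1 k2"] allI impI)
    fix j P assume j: "max k1 k2 \<le> j" and P: "Pos (\<lambda>v. (\<exists>y. P (v(j := y))) \<and> R v)"
    from P have "Pos (\<lambda>v. \<exists>y. P (v(j := y)) \<and> R (v(j := y)))"
      by (rule cond_mono[OF c]) (use j in \<open>simp add: k2\<close>)
    then show "Pos (\<lambda>v. P v \<and> R v)" using k1[of j "\<lambda>v. P v \<and> R v"] j by simp
  qed
next
  fix F assume F: "Dfn (\<lambda>u v. F (u 0) v)" and P: "Pos (\<lambda>v. (\<exists>y. F y v) \<and> R v)"
  have "Dfn (\<lambda>u v. F (u 0) v \<and> R v)" using F R by (intro dfn)
  moreover have "Pos (\<lambda>v. \<exists>y. F y v \<and> R v)" using P by (rule cond_mono[OF c]) blast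
  ultimately obtain b where "Pos (\<lambda>v. \<exists>y. y \<epsilon> b \<and> F y v \<and> R v)"
    using cond_bound[OF c, of "\<lambda>y v. F y v \<and> R v"] by blast
  then have "Pos (\<lambda>v. (\<exists>y. y \<epsilon> b \<and> F y v) \<and> R v)" by (rule cond_mono[OF c]) blast
  then show "\<exists>b. Pos (\<lambda>v. (\<exists>y. y \<epsilon> b \<and> F y v) \<and> R v)" ..
qed

text \<open>Adds to the filter the sets \<open>{v. G x v}\<close> for all \<open>x\<close> in some member of the directed family \<open>Z\<close>.\<close>

lemma cond_directed:
  assumes c: "cond Pos" and Z: "Dfn (\<lambda>u v. Z (u 0))" and bd: "\<And>a. Z a \<Longrightarrow> a \<epsilon> C"
    and "Z a0" and dir: "\<And>a b. Z a \<Longrightarrow> Z b \<Longrightarrow> \<exists>c. Z c \<and> a \<sqsubseteq> c \<and> b \<sqsubseteq> c"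
    and G: "Dfn (\<lambda>u v. G (u 0) v)"
    and pos: "\<And>a. Z a \<Longrightarrow> Pos (\<lambda>v. \<forall>x. x \<epsilon> a \<longrightarrow> G x v)"
  shows "cond (\<lambda>P. \<forall>a. Z a \<longrightarrow> Pos (\<lambda>v. P v \<and> (\<forall>x. x \<epsilon> a \<longrightarrow> G x v)))"
  unfolding cond_def
proof (intro conjI allI impI)
  fix P Q :: "(nat \<Rightarrow> 'm) \<Rightarrow> bool" and a
  assume "\<forall>v. P v \<longrightarrow> Q v" "\<forall>a. Z a \<longrightarrow> Pos (\<lambda>v. P v \<and> (\<forall>x. x \<epsilon> a \<longrightarrow> G x v))" "Z a"
  then have "Pos (\<lambda>v. P v \<and> (\<forall>x. x \<epsilon> a \<longrightarrow> G x v))" by blast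
  then show "Pos (\<lambda>v. Q v \<and> (\<forall>x. x \<epsilon> a \<longrightarrow> G x v))"
    by (rule cond_mono[OF c]) (use \<open>\<forall>v. P v \<longrightarrow> Q v\<close> in blast)
next
  fix a assume "Z a"
  then show "Pos (\<lambda>v. True \<and> (\<forall>x. x \<epsilon> a \<longrightarrow> G x v))" using pos by simp
next
  show "\<not> (\<forall>a. Z a \<longrightarrow> Pos (\<lambda>v. False \<and> (\<forall>x. x \<epsilon> a \<longrightarrow> G x v)))"
    using \<open>Z a0\<close> cond_False[OF c] by auto
next
  fix P Q :: "(nat \<Rightarrow> 'm) \<Rightarrow> bool"
  assume PQ: "\<forall>a. Z a \<longrightarrow> Pos (\<lambda>v. (P v \<or> Q v) \<and> (\<forall>x. x \<epsilon> a \<longrightarrow> G x v))"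
  show "(\<forall>a. Z a \<longrightarrow> Pos (\<lambda>v. P v \<and> (\<forall>x. x \<epsilon> a \<longrightarrow> G x v))) \<or>
    (\<forall>a. Z a \<longrightarrow> Pos (\<lambda>v. Q v \<and> (\<forall>x. x \<epsilon> a \<longrightarrow> G x v)))"
  proof (rule ccontr)
    assume "\<not> ?thesis"
    then obtain a b where a: "Z a" "\<not> Pos (\<lambda>v. P v \<and> (\<forall>x. x \<epsilon> a \<longrightarrow> G x v))"
      and b: "Z b" "\<not> Pos (\<lambda>v. Q v \<and> (\<forall>x. x \<epsilon> b \<longrightarrow> G x v))" by blast
    \<comment> \<open>Directedness merges the two failures: splitting the disjunction at
      \<open>d\<close> would make one of them positive after all.\<close>
    obtain d where d: "Z d" "a \<sqsubseteq> d" "b \<sqsubseteq> d" using dir a(1) b(1) by blast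
    have "Pos (\<lambda>v. (P v \<or> Q v) \<and> (\<forall>x. x \<epsilon> d \<longrightarrow> G x v))" using PQ d(1) by blast
    then have "Pos (\<lambda>v. P v \<and> (\<forall>x. x \<epsilon> a \<longrightarrow> G x v)) \<or> Pos (\<lambda>v. Q v \<and> (\<forall>x. x \<epsilon> b \<longrightarrow> G x v))"
      by (rule cond_split[OF c]) (use d(2,3) in \<open>auto simp: sub_def\<close>)
    then show False using a b by blast
  qed
next
  fix \<Phi> assume "Dfn \<Phi>"
  then have "Dfn (\<lambda>u v. \<Phi> (\<lambda>n. u (Suc n)) v)" by (rule Dfn_shift)
  then show "Dfn (\<lambda>u v. \<forall>a. Z a \<longrightarrow> Pos (\<lambda>v. \<Phi> u v \<and> (\<forall>x. x \<epsilon> a \<longrightarrow> G x v)))"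
    using Z G by (intro dfn cond_Dfn[OF c])
next
  obtain k1 :: nat where k1': "\<forall>j\<ge>k1. \<forall>P. Pos (\<lambda>v. \<exists>y. P (v(j := y))) \<longrightarrow> Pos P"
    using cond_fresh[OF c] ..
  note k1 = k1'[rule_format]
  obtain k2 :: nat where k2': "\<forall>j\<ge>k2. \<forall>x v y. G x (v(j := y)) = G x v"
    using Dfn_support_upd[OF G] ..
  note k2 = k2'[rule_format]
  show "\<exists>k. \<forall>j\<ge>k. \<forall>P. (\<forall>a. Z a \<longrightarrow> Pos (\<lambda>v. (\<exists>y. P (v(j := y))) \<and> (\<forall>x. x \<epsilon> a \<longrightarrow> G x v))) \<longrightarrow>
    (\<forall>a. Z a \<longrightarrow> Pos (\<lambda>v. P v \<and> (\<forall>x. x \<epsilon> a \<longrightarrow> G x v)))"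
  proof (intro exI[of _ "max k1 k2"] allI impI)
    fix j P a assume j: "max k1 k2 \<le> j" and "Z a"
      and "\<forall>a. Z a \<longrightarrow> Pos (\<lambda>v. (\<exists>y. P (v(j := y))) \<and> (\<forall>x. x \<epsilon> a \<longrightarrow> G x v))"
    then have "Pos (\<lambda>v. (\<exists>y. P (v(j := y))) \<and> (\<forall>x. x \<epsilon> a \<longrightarrow> G x v))" by blast
    then have "Pos (\<lambda>v. \<exists>y. P (v(j := y)) \<and> (\<forall>x. x \<epsilon> a \<longrightarrow> G x (v(j := y))))"
      by (rule cond_mono[OF c]) (use j in \<open>simp add: k2\<close>)
    then show "Pos (\<lambda>v. P v \<and> (\<forall>x. x \<epsilon> a \<longrightarrow> G x v))"
      using k1[of j "\<lambda>v. P v \<and> (\<forall>x. x \<epsilon> a \<longrightarrow> G x v)"] j by simp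
  qed
next
  fix F assume F: "Dfn (\<lambda>u v. F (u 0) v)"
    and P: "\<forall>a. Z a \<longrightarrow> Pos (\<lambda>v. (\<exists>y. F y v) \<and> (\<forall>x. x \<epsilon> a \<longrightarrow> G x v))"
  \<comment> \<open>The bound on the witnesses may depend on \<open>a\<close>; Collection over
    \<open>C\<close> yields a set of bounds whose union serves all \<open>a\<close> at once.\<close>
  define H where "H a b \<longleftrightarrow> Pos (\<lambda>v. \<exists>y. y \<epsilon> b \<and> F y v \<and> (\<forall>x. x \<epsilon> a \<longrightarrow> G x v))" for a b
  have "Dfn (\<lambda>u v. H (u 0) (u 1))" unfolding H_def using F G by (intro dfn cond_Dfn[OF c])
  from collection[OF this, of C] obtain bb where
    bb: "\<And>a. a \<epsilon> C \<Longrightarrow> \<exists>b. H a b \<Longrightarrow> \<exists>b. b \<epsilon> bb \<and> H a b" by blast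
  have "Pos (\<lambda>v. (\<exists>y. y \<epsilon> Uni bb \<and> F y v) \<and> (\<forall>x. x \<epsilon> a \<longrightarrow> G x v))" if "Z a" for a
  proof -
    have "Pos (\<lambda>v. (\<exists>y. F y v) \<and> (\<forall>x. x \<epsilon> a \<longrightarrow> G x v))" using P that by blast
    then have "Pos (\<lambda>v. \<exists>y. F y v \<and> (\<forall>x. x \<epsilon> a \<longrightarrow> G x v))" by (rule cond_mono[OF c]) blast
    moreover have "Dfn (\<lambda>u v. F (u 0) v \<and> (\<forall>x. x \<epsilon> a \<longrightarrow> G x v))" using F G by (intro dfn)
    ultimately have "\<exists>b. H a b"
      unfolding H_def using cond_bound[OF c, of "\<lambda>y v. F y v \<and> (\<forall>x. x \<epsilon> a \<longrightarrow> G x v)"] by blast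
    then obtain b where b: "b \<epsilon> bb" "H a b" using bb bd \<open>Z a\<close> by blast
    from b(2) show ?thesis
      unfolding H_def by (rule cond_mono[OF c]) (use b(1) in auto)
  qed
  then show "\<exists>b. \<forall>a. Z a \<longrightarrow> Pos (\<lambda>v. (\<exists>y. y \<epsilon> b \<and> F y v) \<and> (\<forall>x. x \<epsilon> a \<longrightarrow> G x v))" by blast
qed

text \<open>Fewer positive predicates mean a larger filter.\<close>

definition stronger :: "(((nat \<Rightarrow> 'm) \<Rightarrow> bool) \<Rightarrow> bool) \<Rightarrow> (((nat \<Rightarrow> 'm) \<Rightarrow> bool) \<Rightarrow> bool) \<Rightarrow> bool" where
  "stronger Pos' Pos \<longleftrightarrow> (\<forall>P. Pos' P \<longrightarrow> Pos P)"

definition forces :: "(((nat \<Rightarrow> 'm) \<Rightarrow> bool) \<Rightarrow> bool) \<Rightarrow> ((nat \<Rightarrow> 'm) \<Rightarrow> bool) \<Rightarrow> bool" where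
  "forces Pos P \<longleftrightarrow> \<not> Pos (\<lambda>v. \<not> P v)"

lemma stronger_refl: "stronger c c" and stronger_trans: "stronger a b \<Longrightarrow> stronger b c \<Longrightarrow> stronger a c"
  by (auto simp: stronger_def)

lemma forces_stronger: "forces Pos P \<Longrightarrow> stronger Pos' Pos \<Longrightarrow> forces Pos' P"
  by (auto simp: stronger_def forces_def)

lemma forces_mono: "cond Pos \<Longrightarrow> forces Pos P \<Longrightarrow> (\<And>v. P v \<Longrightarrow> Q v) \<Longrightarrow> forces Pos Q"
  unfolding forces_def using cond_mono[of Pos "\<lambda>v. \<not> Q v" "\<lambda>v. \<not> P v"] by blast

text \<open>The common last step of the density arguments by a single decision: whatever is positive
  and definable can be put into the filter.\<close>

lemma force_positive:
  assumes c: "cond Pos" and R: "Dfn (\<lambda>u v. R v)" and "Pos R"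
  shows "\<exists>Pos'. cond Pos' \<and> stronger Pos' Pos \<and> forces Pos' R"
proof (intro exI conjI)
  show "cond (\<lambda>P. Pos (\<lambda>v. P v \<and> R v))" using assms by (rule cond_restrict)
  show "stronger (\<lambda>P. Pos (\<lambda>v. P v \<and> R v)) Pos"
    unfolding stronger_def by (intro allI impI) (erule cond_mono[OF c], blast)
  have "(\<lambda>v. \<not> R v \<and> R v) = (\<lambda>v. False)" by blast
  then show "forces (\<lambda>P. Pos (\<lambda>v. P v \<and> R v)) R"
    unfolding forces_def using cond_False[OF c] by simp
qed

section \<open>Density arguments\<close>

lemma dense_decide:
  assumes c: "cond Pos" and P: "Dfn (\<lambda>u v. P v)"
  shows "\<exists>Pos'. cond Pos' \<and> stronger Pos' Pos \<and> (forces Pos' P \<or> forces Pos' (\<lambda>v. \<not> P v))"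
proof -
  have "Pos P \<or> Pos (\<lambda>v. \<not> P v)" using cond_True[OF c] by (rule cond_split[OF c]) blast
  moreover have "Dfn (\<lambda>u v. \<not> P v)" using P by (intro dfn)
  ultimately show ?thesis using force_positive[OF c] P by blast
qed

lemma dense_bounded:
  assumes c: "cond Pos" and a: "dtrm (\<lambda>u v. a v)"
  shows "\<exists>Pos'. cond Pos' \<and> stronger Pos' Pos \<and> (\<exists>b. forces Pos' (\<lambda>v. a v \<epsilon> b))"
proof -
  have "Dfn (\<lambda>u v. u 0 = a v)" using a by (intro dfn)
  moreover have "Pos (\<lambda>v. \<exists>y. y = a v)" using cond_True[OF c] by simp
  ultimately obtain b where b: "Pos (\<lambda>v. \<exists>y. y \<epsilon> b \<and> y = a v)"
    using cond_bound[OF c, of "\<lambda>y v. y = a v"] by blast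
  have "Pos (\<lambda>v. a v \<epsilon> b)" using b by (rule cond_mono[OF c]) blast
  moreover have "Dfn (\<lambda>u v. a v \<epsilon> b)" using a by (intro dfn)
  ultimately show ?thesis using force_positive[OF c] by blast
qed

text \<open>\<open>j\<close> lies outside the support of \<open>F\<close> and is left free by the
  condition, so \<open>v j\<close> can be changed to a witness without disturbing
  \<open>F\<close>.\<close>

lemma fresh_name:
  assumes c: "cond Pos" and F: "Dfn (\<lambda>u v. F (u 0) v)"
  shows "\<exists>j. Pos (\<lambda>v. \<exists>y. F y v) \<longrightarrow> Pos (\<lambda>v. F (v j) v)"
proof -
  obtain k1 :: nat where k1': "\<forall>j\<ge>k1. \<forall>P. Pos (\<lambda>v. \<exists>y. P (v(j := y))) \<longrightarrow> Pos P"
    using cond_fresh[OF c] ..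
  note k1 = k1'[rule_format]
  obtain k2 :: nat where k2': "\<forall>j\<ge>k2. \<forall>x v y. F x (v(j := y)) = F x v"
    using Dfn_support_upd[OF F] ..
  note k2 = k2'[rule_format]
  define j where "j = max k1 k2"
  have "Pos (\<lambda>v. F (v j) v)" if "Pos (\<lambda>v. \<exists>y. F y v)"
    using k1[of j "\<lambda>v. F (v j) v"] k2[of j] that by (simp add: j_def)
  then show ?thesis by blast
qed

lemma dense_witness:
  assumes c: "cond Pos" and F: "Dfn (\<lambda>u v. F (u 0) v)"
  shows "\<exists>Pos'. cond Pos' \<and> stronger Pos' Pos \<and>
    (forces Pos' (\<lambda>v. \<not> (\<exists>y. F y v)) \<or> (\<exists>j. forces Pos' (\<lambda>v. F (v j) v)))"
proof (cases "Pos (\<lambda>v. \<exists>y. F y v)")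
  case True
  then obtain j where "Pos (\<lambda>v. F (v j) v)" using fresh_name[OF assms] by blast
  moreover have "Dfn (\<lambda>u v. F (v j) v)"
    using Dfn_app[of "\<lambda>x u v. F x v", OF F dtrm_nam] .
  ultimately show ?thesis using force_positive[OF c] by blast
next
  case False
  then have "forces Pos (\<lambda>v. \<not> (\<exists>y. F y v))" by (simp add: forces_def)
  then show ?thesis using c stronger_refl by blast
qed

text \<open>Makes the elements of standard finite sets standard. Splitting into the single elements
  of \<open>a\<close> is not possible from outside, where \<open>a\<close> may be infinite; the
  induction runs in the model, which sees \<open>Pos\<close> through
  \<open>cond_Dfn\<close>.\<close>

lemma dense_finite:
  assumes c: "cond Pos" and t: "dtrm (\<lambda>u v. t v)" and "Fin a"
  shows "\<exists>Pos'. cond Pos' \<and> stronger Pos' Pos \<and>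
    (forces Pos' (\<lambda>v. \<not> t v \<epsilon> a) \<or> (\<exists>m. forces Pos' (\<lambda>v. t v = m)))"
proof (cases "Pos (\<lambda>v. t v \<epsilon> a)")
  case True
  have "Pos (\<lambda>v. t v \<epsilon> a) \<longrightarrow> (\<exists>m. Pos (\<lambda>v. t v = m))"
  proof (rule Fin_induct[of "\<lambda>a. Pos (\<lambda>v. t v \<epsilon> a) \<longrightarrow> (\<exists>m. Pos (\<lambda>v. t v = m))", OF _ \<open>Fin a\<close>])
    show "Dfn (\<lambda>u v. Pos (\<lambda>v. t v \<epsilon> u 0) \<longrightarrow> (\<exists>m. Pos (\<lambda>v. t v = m)))"
      using t by (intro dfn cond_Dfn[OF c])
    show "Pos (\<lambda>v. t v \<epsilon> emp) \<longrightarrow> (\<exists>m. Pos (\<lambda>v. t v = m))" using cond_False[OF c] by simp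
  next
    fix a s assume IH: "Pos (\<lambda>v. t v \<epsilon> a) \<longrightarrow> (\<exists>m. Pos (\<lambda>v. t v = m))"
    show "Pos (\<lambda>v. t v \<epsilon> ins s a) \<longrightarrow> (\<exists>m. Pos (\<lambda>v. t v = m))"
    proof
      assume "Pos (\<lambda>v. t v \<epsilon> ins s a)"
      then have "Pos (\<lambda>v. t v = s) \<or> Pos (\<lambda>v. t v \<epsilon> a)" by (rule cond_split[OF c]) simp
      then show "\<exists>m. Pos (\<lambda>v. t v = m)" using IH by blast
    qed
  qed
  then obtain m where "Pos (\<lambda>v. t v = m)" using True by blast
  moreover have "Dfn (\<lambda>u v. t v = m)" using t by (intro dfn)
  ultimately show ?thesis using force_positive[OF c] by blast
next
  case False
  then have "forces Pos (\<lambda>v. \<not> t v \<epsilon> a)" by (simp add: forces_def)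
  then show ?thesis using c stronger_refl by blast
qed

text \<open>The trace of \<open>t\<close> on \<open>\<omega>\<close> is decided along the branch that takes \<open>n \<in> t\<close> whenever this is
  compatible with the previous decisions; recursion in the model makes the branch one of its sets.\<close>

lemma dense_trace:
  assumes c: "cond Pos" and t: "dtrm (\<lambda>u v. t v)"
  shows "\<exists>Pos'. cond Pos' \<and> stronger Pos' Pos \<and>
    (\<exists>b. b \<sqsubseteq> om \<and> (\<forall>n. n \<epsilon> om \<longrightarrow> forces Pos' (\<lambda>v. n \<epsilon> t v \<longleftrightarrow> n \<epsilon> b)))"
proof -
  \<comment> \<open>The decisions recorded in \<open>s\<close> about the elements of
    \<open>a\<close> are compatible with the condition.\<close>
  define good where "good a s \<longleftrightarrow> Pos (\<lambda>v. \<forall>m. m \<epsilon> a \<longrightarrow> (m \<epsilon> t v \<longleftrightarrow> m \<epsilon> s))" for a s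
  have good: "Dfn (\<lambda>u v. good (u 0) (u 1))"
    unfolding good_def using t by (intro dfn cond_Dfn[OF c])
  define G where "G n s s' \<longleftrightarrow> (good (succ n) (ins n s) \<and> s' = ins n s) \<or>
    (\<not> good (succ n) (ins n s) \<and> s' = s)" for n s s'
  have "Dfn (\<lambda>u v. G (u 0) (u 1) (u 2))"
    unfolding G_def by (intro dfn Dfn_app2[OF good])
  moreover have "\<exists>!s'. G n s s'" for n s unfolding G_def by blast
  ultimately obtain R where R: "Dfn (\<lambda>u v. R (u 0) (u 1))" "R emp emp"
    "\<And>n. n \<epsilon> om \<Longrightarrow> \<exists>!s. R n s"
    "\<And>n s s'. n \<epsilon> om \<Longrightarrow> R n s \<Longrightarrow> G n s s' \<Longrightarrow> R (succ n) s'"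
    by (rule om_recursion[where ?x0.0 = emp]) (rule that)
  have R_unique: "s = s'" if "n \<epsilon> om" "R n s" "R n s'" for n s s'
    using R(3)[OF that(1)] that(2,3) by blast
  have "Dfn (\<lambda>u v. \<exists>s. R (u 0) s \<and> good (succ (u 0)) (ins (u 0) s))"
    by (intro dfn Dfn_app2[OF R(1)] Dfn_app2[OF good])
  \<comment> \<open>The limit of the branch: a number belongs to it if it is accepted at its own
    stage, and later stages never revise this.\<close>
  from separation[OF this, of om] obtain b where
    b: "\<And>m. m \<epsilon> b \<longleftrightarrow> m \<epsilon> om \<and> (\<exists>s. R m s \<and> good (succ m) (ins m s))" by blast
  define I where "I n \<longleftrightarrow> (\<forall>s. R n s \<longrightarrow> good n s \<and> s \<sqsubseteq> n \<and> (\<forall>m. m \<epsilon> n \<longrightarrow> (m \<epsilon> b \<longleftrightarrow> m \<epsilon> s)))" for n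
  have I: "I n" if "n \<epsilon> om" for n
  proof (rule om_induct[of I, OF _ that])
    show "Dfn (\<lambda>u v. I (u 0))"
      unfolding I_def by (intro dfn Dfn_app2[OF R(1)] Dfn_app2[OF good])
    have "good emp emp" unfolding good_def using cond_True[OF c] by simp
    then show "I emp"
      unfolding I_def using R_unique[OF emp_om R(2)] by (metis mem_emp sub_refl)
  next
    fix n assume n: "n \<epsilon> om" "I n"
    obtain s where s: "R n s" using R(3)[OF n(1)] by blast
    then have IH: "good n s" "s \<sqsubseteq> n" "\<And>m. m \<epsilon> n \<Longrightarrow> m \<epsilon> b \<longleftrightarrow> m \<epsilon> s"
      using n(2) unfolding I_def by blast+
    have "\<not> n \<epsilon> s" using IH(2) not_self unfolding sub_def by blast
    show "I (succ n)"
    proof (cases "good (succ n) (ins n s)")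
      case True
      then have "R (succ n) (ins n s)" using R(4)[OF n(1) s] unfolding G_def by blast
      then have eq: "s' = ins n s" if "R (succ n) s'" for s'
        using R_unique[OF succ_om[OF n(1)]] that by blast
      have "n \<epsilon> b" using b n(1) s True by blast
      moreover have "\<not> n \<epsilon> n" by (rule not_self)
      ultimately have "ins n s \<sqsubseteq> succ n" "\<And>m. m \<epsilon> succ n \<Longrightarrow> m \<epsilon> b \<longleftrightarrow> m \<epsilon> ins n s"
        using IH(2,3) unfolding sub_def by auto
      then show ?thesis unfolding I_def using True eq by blast
    next
      case False
      then have "R (succ n) s" using R(4)[OF n(1) s] unfolding G_def by blast
      then have eq: "s' = s" if "R (succ n) s'" for s'
        using R_unique[OF succ_om[OF n(1)]] that by blast
      have "\<not> n \<epsilon> b" using b R_unique[OF n(1) s] False by blast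
      then have "s \<sqsubseteq> succ n" "\<And>m. m \<epsilon> succ n \<Longrightarrow> m \<epsilon> b \<longleftrightarrow> m \<epsilon> s"
        using IH(2,3) \<open>\<not> n \<epsilon> s\<close> unfolding sub_def by auto
      \<comment> \<open>As \<open>n\<close> is not in \<open>s\<close>, the valuations that agree
        with \<open>s\<close> on \<open>n\<close> split into those that agree with
        \<open>ins n s\<close> and those that agree with \<open>s\<close> on \<open>succ n\<close>;
        one part is positive.\<close>
      moreover have "good (succ n) (ins n s) \<or> good (succ n) s"
        using IH(1) unfolding good_def
        by (rule cond_split[OF c]) (use \<open>\<not> n \<epsilon> s\<close> not_self[of n] in auto)
      ultimately show ?thesis unfolding I_def using False eq by blast
    qed
  qed
  have pos: "Pos (\<lambda>v. \<forall>m. m \<epsilon> n \<longrightarrow> (m \<epsilon> t v \<longleftrightarrow> m \<epsilon> b))" if "n \<epsilon> om" for n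
  proof -
    obtain s where "R n s" using R(3)[OF \<open>n \<epsilon> om\<close>] by blast
    then have "good n s" "\<And>m. m \<epsilon> n \<Longrightarrow> m \<epsilon> b \<longleftrightarrow> m \<epsilon> s" using I[OF that] unfolding I_def by blast+
    then show ?thesis unfolding good_def by (elim cond_mono[OF c]) blast
  qed
  define Pos' where
    "Pos' P \<longleftrightarrow> (\<forall>n. n \<epsilon> om \<longrightarrow> Pos (\<lambda>v. P v \<and> (\<forall>m. m \<epsilon> n \<longrightarrow> (m \<epsilon> t v \<longleftrightarrow> m \<epsilon> b))))" for P
  have "cond Pos'"
    unfolding Pos'_def
  \<comment> \<open>A natural number is the set of its predecessors, so \<open>om\<close> itself is
    the directed family of finite stages.\<close>
  proof (rule cond_directed[OF c, where C = om and ?a0.0 = emp and Z = "\<lambda>n. n \<epsilon> om"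
        and G = "\<lambda>m v. m \<epsilon> t v \<longleftrightarrow> m \<epsilon> b"])
    show "Dfn (\<lambda>u v. u 0 \<epsilon> om)" by (intro dfn)
    show "Dfn (\<lambda>u v. u 0 \<epsilon> t v \<longleftrightarrow> u 0 \<epsilon> b)" using t by (intro dfn)
    show "\<exists>k. k \<epsilon> om \<and> m \<sqsubseteq> k \<and> n \<sqsubseteq> k" if "m \<epsilon> om" "n \<epsilon> om" for m n
      using om_sup[OF that] by blast
  qed (use pos in simp_all)
  moreover have "stronger Pos' Pos"
    unfolding stronger_def
  proof (intro allI impI)
    fix P assume "Pos' P"
    then have "Pos (\<lambda>v. P v \<and> (\<forall>m. m \<epsilon> emp \<longrightarrow> (m \<epsilon> t v \<longleftrightarrow> m \<epsilon> b)))"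
      unfolding Pos'_def using emp_om by blast
    then show "Pos P" by simp
  qed
  moreover have "forces Pos' (\<lambda>v. n \<epsilon> t v \<longleftrightarrow> n \<epsilon> b)" if "n \<epsilon> om" for n
    unfolding forces_def
  proof
    assume "Pos' (\<lambda>v. \<not> (n \<epsilon> t v \<longleftrightarrow> n \<epsilon> b))"
    \<comment> \<open>The stage \<open>succ n\<close> is taken because it contains
      \<open>n\<close>.\<close>
    then have "Pos (\<lambda>v. \<not> (n \<epsilon> t v \<longleftrightarrow> n \<epsilon> b) \<and> (\<forall>m. m \<epsilon> succ n \<longrightarrow> (m \<epsilon> t v \<longleftrightarrow> m \<epsilon> b)))"
      unfolding Pos'_def using succ_om[OF that] by blast
    then have "Pos (\<lambda>v. False)" by (rule cond_mono[OF c]) (metis mem_ins)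
    then show False using cond_False[OF c] by blast
  qed
  moreover have "b \<sqsubseteq> om" using b by (simp add: sub_def)
  ultimately show ?thesis by blast
qed

text \<open>A positive predicate splits by whether the added element belongs to \<open>t\<close>, so
  the trace is decided one element at a time, by an induction inside the model.\<close>

lemma finite_trace:
  assumes c: "cond Pos" and t: "dtrm (\<lambda>u v. t v)" and "Fin a"
  shows "\<exists>s. Fin s \<and> Pos (\<lambda>v. \<forall>x. x \<epsilon> s \<longleftrightarrow> x \<epsilon> a \<and> x \<epsilon> t v)"
proof (rule Fin_induct[of "\<lambda>a. \<exists>s. Fin s \<and> Pos (\<lambda>v. \<forall>x. x \<epsilon> s \<longleftrightarrow> x \<epsilon> a \<and> x \<epsilon> t v)", OF _ \<open>Fin a\<close>])
  show "Dfn (\<lambda>u v. \<exists>s. Fin s \<and> Pos (\<lambda>v. \<forall>x. x \<epsilon> s \<longleftrightarrow> x \<epsilon> u 0 \<and> x \<epsilon> t v))"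
    using t by (intro dfn cond_Dfn[OF c])
  show "\<exists>s. Fin s \<and> Pos (\<lambda>v. \<forall>x. x \<epsilon> s \<longleftrightarrow> x \<epsilon> emp \<and> x \<epsilon> t v)"
    using cond_True[OF c] by (intro exI[of _ emp]) simp
next
  fix a z assume "\<exists>s. Fin s \<and> Pos (\<lambda>v. \<forall>x. x \<epsilon> s \<longleftrightarrow> x \<epsilon> a \<and> x \<epsilon> t v)"
  then obtain s where s: "Fin s" "Pos (\<lambda>v. \<forall>x. x \<epsilon> s \<longleftrightarrow> x \<epsilon> a \<and> x \<epsilon> t v)" by blast
  have "Pos (\<lambda>v. \<forall>x. x \<epsilon> ins z s \<longleftrightarrow> x \<epsilon> ins z a \<and> x \<epsilon> t v) \<or>
    Pos (\<lambda>v. \<forall>x. x \<epsilon> s \<longleftrightarrow> x \<epsilon> ins z a \<and> x \<epsilon> t v)"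
    using s(2) by (rule cond_split[OF c]) auto
  then show "\<exists>s. Fin s \<and> Pos (\<lambda>v. \<forall>x. x \<epsilon> s \<longleftrightarrow> x \<epsilon> ins z a \<and> x \<epsilon> t v)"
    using s(1) Fin_ins by blast
qed

lemma dense_idealization:
  assumes c: "cond Pos" and t: "dtrm (\<lambda>u v. t v)" and F: "Dfn (\<lambda>u v. F (u 0) (u 1) v)"
  shows "\<exists>Pos'. cond Pos' \<and> stronger Pos' Pos \<and>
    ((\<exists>s. Fin s \<and> forces Pos' (\<lambda>v. s \<sqsubseteq> t v) \<and>
       forces Pos' (\<lambda>v. \<not> (\<exists>y. \<forall>x. x \<epsilon> s \<longrightarrow> F x y v))) \<or>
     (\<exists>j. \<forall>x. forces Pos' (\<lambda>v. x \<epsilon> t v \<longrightarrow> F x (v j) v)))"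
proof -
  \<comment> \<open>A standard bound on \<open>t\<close> confines its elements to
    \<open>Uni b\<close>. The finite subsets of \<open>Uni b\<close>, unlike all finite sets of the
    model, lie in one set, as the directed extension requires.\<close>
  obtain Pos1 b where c1: "cond Pos1" "stronger Pos1 Pos" "forces Pos1 (\<lambda>v. t v \<epsilon> b)"
    using dense_bounded[OF c t] by blast
  note c = c1(1)
  have bound: "forces Pos1 (\<lambda>v. x \<epsilon> t v \<longrightarrow> x \<epsilon> Uni b)" for x
    using c1(3) by (rule forces_mono[OF c]) auto
  have Fx: "Dfn (\<lambda>u v. F (a u v) (d u v) v)" if "dtrm a" "dtrm d" for a d
  proof -
    have "Dfn (\<lambda>u v. F (a (\<lambda>n. u (Suc n)) v) (u 0) v)"
      by (rule Dfn_app[of "\<lambda>x u v. F x (u 0) v"]) (use F dtrm_shift[OF that(1)] in simp_all)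
    then show ?thesis
      by (intro Dfn_app[of "\<lambda>y u v. F (a u v) y v", OF _ that(2)]) simp
  qed
  \<comment> \<open>Membership in \<open>t\<close> enters as a hypothesis because \<open>a\<close>
    need not be a subset of \<open>t\<close>.\<close>
  define W where "W a v \<longleftrightarrow> (\<exists>y. \<forall>x. x \<epsilon> a \<longrightarrow> x \<epsilon> t v \<longrightarrow> F x y v)" for a v
  show ?thesis
  proof (cases "\<exists>a. Fin a \<and> \<not> Pos1 (W a)")
    case True
    then obtain a where a: "Fin a" "\<not> Pos1 (W a)" by blast
    obtain s where s: "Fin s" "Pos1 (\<lambda>v. \<forall>x. x \<epsilon> s \<longleftrightarrow> x \<epsilon> a \<and> x \<epsilon> t v)"
      using finite_trace[OF c t a(1)] by blast
    have "Dfn (\<lambda>u v. \<forall>x. x \<epsilon> s \<longleftrightarrow> x \<epsilon> a \<and> x \<epsilon> t v)" using t by (intro dfn)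
    from force_positive[OF c this s(2)] obtain Pos2 where
      c2: "cond Pos2" "stronger Pos2 Pos1" "forces Pos2 (\<lambda>v. \<forall>x. x \<epsilon> s \<longleftrightarrow> x \<epsilon> a \<and> x \<epsilon> t v)"
      by blast
    have 1: "forces Pos2 (\<lambda>v. s \<sqsubseteq> t v)"
      using c2(3) by (rule forces_mono[OF c2(1)]) (auto simp: sub_def)
    have 2: "forces Pos2 (\<lambda>v. \<not> (\<exists>y. \<forall>x. x \<epsilon> s \<longrightarrow> F x y v))"
      unfolding forces_def
    proof
      assume "Pos2 (\<lambda>v. \<not> \<not> (\<exists>y. \<forall>x. x \<epsilon> s \<longrightarrow> F x y v))"
      \<comment> \<open>Where the trace of \<open>t\<close> on \<open>a\<close> is \<open>s\<close>,
        a common solution for \<open>s\<close> gives \<open>W a\<close>; the other valuations are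
        excluded by \<open>Pos2\<close>.\<close>
      then have "Pos2 (W a) \<or> Pos2 (\<lambda>v. \<not> (\<forall>x. x \<epsilon> s \<longleftrightarrow> x \<epsilon> a \<and> x \<epsilon> t v))"
        by (rule cond_split[OF c2(1)]) (unfold W_def, blast)
      then have "Pos2 (W a)" using c2(3) by (simp add: forces_def)
      then show False using a(2) c2(2) by (simp add: stronger_def)
    qed
    have "stronger Pos2 Pos" using c2(2) c1(2) by (rule stronger_trans)
    then show ?thesis using c2(1) s(1) 1 2 by blast
  next
    case False
    then have pos: "Pos1 (W a)" if "Fin a" for a using that by blast
    define Z where "Z a \<longleftrightarrow> Fin a \<and> a \<sqsubseteq> Uni b" for a
    have Z: "Dfn (\<lambda>u v. Z (u 0))" unfolding Z_def by (intro dfn)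
    obtain k1 :: nat where k1': "\<forall>j\<ge>k1. \<forall>P. Pos1 (\<lambda>v. \<exists>y. P (v(j := y))) \<longrightarrow> Pos1 P"
      using cond_fresh[OF c] ..
    note k1 = k1'[rule_format]
    define B where "B x y v \<longleftrightarrow> (x \<epsilon> t v \<longrightarrow> F x y v)" for x y v
    have B: "Dfn (\<lambda>u v. B (u 0) (u 1) v)" unfolding B_def using t by (intro dfn Fx)
    obtain k2 where k2: "\<forall>(u :: nat \<Rightarrow> 'm) v v'. (\<forall>j<k2. v j = v' j) \<longrightarrow> B (u 0) (u 1) v = B (u 0) (u 1) v'"
      using Dfn_support[OF B] ..
    \<comment> \<open>Fresh for the condition and for \<open>B\<close>, and chosen before
      \<open>a\<close>: one name has to solve all finite subproblems.\<close>
    define j where "j = max k1 k2"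
    have Bj: "B x y (v(j := z)) = B x y v" for x y v z
    proof -
      have "\<forall>i<k2. (v(j := z)) i = v i" by (simp add: j_def)
      then have "B (case_nat x (\<lambda>_. y) 0) (case_nat x (\<lambda>_. y) 1) (v(j := z)) =
          B (case_nat x (\<lambda>_. y) 0) (case_nat x (\<lambda>_. y) 1) v"
        using k2[THEN spec[of _ "case_nat x (\<lambda>_. y)"], THEN spec[of _ "v(j := z)"], THEN spec[of _ v]]
        by (rule rev_mp)
      then show ?thesis by simp
    qed
    define G where "G x v \<longleftrightarrow> B x (v j) v" for x v
    have G: "Dfn (\<lambda>u v. G (u 0) v)"
      unfolding G_def B_def using t by (intro dfn Fx)
    have posG: "Pos1 (\<lambda>v. \<forall>x. x \<epsilon> a \<longrightarrow> G x v)" if "Z a" for a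
    proof (rule k1[of j])
      show "k1 \<le> j" by (simp add: j_def)
      have "Pos1 (W a)" using pos that by (simp add: Z_def)
      then show "Pos1 (\<lambda>v. \<exists>y. \<forall>x. x \<epsilon> a \<longrightarrow> G x (v(j := y)))"
        by (rule cond_mono[OF c]) (simp add: G_def Bj, simp add: B_def W_def)
    qed
    define Pos2 where
      "Pos2 P \<longleftrightarrow> (\<forall>a. Z a \<longrightarrow> Pos1 (\<lambda>v. P v \<and> (\<forall>x. x \<epsilon> a \<longrightarrow> G x v)))" for P
    have Zemp: "Z emp" by (simp add: Z_def sub_def)
    have "cond Pos2"
      unfolding Pos2_def
    proof (rule cond_directed[OF c Z _ Zemp _ G posG, where C = "Pw (Uni b)"])
      show "a \<epsilon> Pw (Uni b)" if "Z a" for a using that by (simp add: Z_def)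
      show "\<exists>d. Z d \<and> a \<sqsubseteq> d \<and> a' \<sqsubseteq> d" if "Z a" "Z a'" for a a'
      proof -
        obtain d where "Fin d" "\<And>x. x \<epsilon> d \<longleftrightarrow> x \<epsilon> a \<or> x \<epsilon> a'"
          using Fin_union \<open>Z a\<close> \<open>Z a'\<close> unfolding Z_def by blast
        then show ?thesis using that unfolding Z_def sub_def by blast
      qed
    qed
    moreover have st: "stronger Pos2 Pos1"
      unfolding stronger_def
    proof (intro allI impI)
      fix P assume "Pos2 P"
      then have "Pos1 (\<lambda>v. P v \<and> (\<forall>x. x \<epsilon> emp \<longrightarrow> G x v))"
        unfolding Pos2_def using Zemp by blast
      then show "Pos1 P" by simp
    qed
    moreover have "forces Pos2 (\<lambda>v. x \<epsilon> t v \<longrightarrow> F x (v j) v)" for x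
    proof (cases "x \<epsilon> Uni b")
      case True
      then have "Z (ins x emp)" unfolding Z_def sub_def using Fin_ins[OF Fin_emp] by auto
      show ?thesis
        unfolding forces_def
      proof
        assume "Pos2 (\<lambda>v. \<not> (x \<epsilon> t v \<longrightarrow> F x (v j) v))"
        then have "Pos1 (\<lambda>v. \<not> (x \<epsilon> t v \<longrightarrow> F x (v j) v) \<and> (\<forall>z. z \<epsilon> ins x emp \<longrightarrow> G z v))"
          unfolding Pos2_def using \<open>Z (ins x emp)\<close> by blast
        then have "Pos1 (\<lambda>v. False)"
          by (rule cond_mono[OF c]) (metis G_def B_def mem_ins)
        then show False using cond_False[OF c] by blast
      qed
    next
      case False
      \<comment> \<open>Outside \<open>Uni b\<close> the premise is already refuted by the bound on
        \<open>t\<close>.\<close>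
      have "forces Pos1 (\<lambda>v. x \<epsilon> t v \<longrightarrow> F x (v j) v)"
        using bound[of x] by (rule forces_mono[OF c]) (use False in blast)
      then show ?thesis using st by (rule forces_stronger)
    qed
    moreover have "stronger Pos2 Pos" using st c1(2) by (rule stronger_trans)
    ultimately show ?thesis by blast
  qed
qed

end

section \<open>The generic extension\<close>

text \<open>Elements of \<open>N\<close> are \<open>Inl m\<close>, the copy of an element of
  \<open>M\<close>, and \<open>Inr j\<close>, a name.\<close>

primrec val :: "(nat \<Rightarrow> 'm) \<Rightarrow> 'm + nat \<Rightarrow> 'm" where
  "val v (Inl m) = m"
| "val v (Inr j) = v j"

primrec tm_of :: "'m + nat \<Rightarrow> 'm tm" where
  "tm_of (Inl m) = Par m"
| "tm_of (Inr j) = Nam j"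

lemma tval_tm_of [simp]: "tval u v (tm_of x) = val v x"
  by (cases x) simp_all

context zf_model
begin

lemma dtrm_val [dfn]: "dtrm (\<lambda>u v. val v x)"
  by (cases x) (simp_all add: dfn)

text \<open>A definable predicate is determined by its formula and the finite list of terms at the
  free indices; the default \<open>Loc 0\<close> beyond the list is never read.\<close>

lemma countable_Dfn: "countable {\<Phi> :: (nat \<Rightarrow> 'm) \<Rightarrow> (nat \<Rightarrow> 'm) \<Rightarrow> bool. Dfn \<Phi>}"
  if "countable (UNIV :: 'm tm set)"
proof -
  define f :: "fm \<times> 'm tm list \<Rightarrow> (nat \<Rightarrow> 'm) \<Rightarrow> (nat \<Rightarrow> 'm) \<Rightarrow> bool" where
    "f = (\<lambda>(p, l) u v. Sat (\<lambda>n. tval u v (if n < length l then l ! n else Loc 0)) p)"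
  have "countable (UNIV :: 'm tm list set)"
    using countable_lists[OF that] by simp
  then have "countable (range f)"
    by (intro countable_image) (simp add: UNIV_Times_UNIV[symmetric] del: UNIV_Times_UNIV)
  moreover have "\<Phi> \<in> range f" if "Dfn \<Phi>" for \<Phi>
  proof -
    obtain p t where p: "\<And>u v. \<Phi> u v = Sat (\<lambda>n. tval u v (t n)) p"
      using \<open>Dfn \<Phi>\<close> by (elim DfnE) (rule that)
    have "\<Phi> u v = f (p, map t [0..<fv_bound p]) u v" for u v
      unfolding p f_def prod.case by (rule sat_fv_cong) simp
    then show ?thesis by (intro range_eqI[of _ _ "(p, map t [0..<fv_bound p])"] ext)
  qed
  then have "{\<Phi>. Dfn \<Phi>} \<subseteq> range f" by blast
  ultimately show ?thesis by (rule countable_subset[rotated])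
qed

end

text \<open>\<open>U\<close> behaves as an ultrafilter on definable predicates only. The assumptions
  are what meeting the dense sets yields; the verification of the axioms refers to \<open>U\<close>
  and no longer to conditions.\<close>

locale generic = zf_model E for E :: "'m \<Rightarrow> 'm \<Rightarrow> bool" (infix "\<epsilon>" 50) +
  fixes U :: "((nat \<Rightarrow> 'm) \<Rightarrow> bool) \<Rightarrow> bool"
  assumes mono: "(\<forall>v. P v \<longrightarrow> Q v) \<Longrightarrow> U P \<Longrightarrow> U Q"
    and conj: "U P \<Longrightarrow> U Q \<Longrightarrow> U (\<lambda>v. P v \<and> Q v)"
    and triv: "U (\<lambda>v. True)"
    and proper: "\<not> U (\<lambda>v. False)"
    and decides: "Dfn (\<lambda>u. P) \<Longrightarrow> U P \<or> U (\<lambda>v. \<not> P v)"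
    and bounded: "\<exists>b. U (\<lambda>v. val v x \<epsilon> b)"
    and witness: "Dfn (\<lambda>u v. F (u 0) v) \<Longrightarrow> U (\<lambda>v. \<exists>y. F y v) \<Longrightarrow> \<exists>j. U (\<lambda>v. F (v j) v)"
    and finite: "Fin a \<Longrightarrow> U (\<lambda>v. val v x \<epsilon> a) \<Longrightarrow> \<exists>m. U (\<lambda>v. val v x = m)"
    and trace: "\<exists>b. b \<sqsubseteq> om \<and> (\<forall>n. n \<epsilon> om \<longrightarrow> U (\<lambda>v. n \<epsilon> val v x \<longleftrightarrow> n \<epsilon> b))"
    and idealization: "Dfn (\<lambda>u v. G (u 0) (u 1) v) \<Longrightarrow>
      (\<exists>s. Fin s \<and> U (\<lambda>v. s \<sqsubseteq> val v x) \<and> U (\<lambda>v. \<not> (\<exists>y. \<forall>z. z \<epsilon> s \<longrightarrow> G z y v))) \<or>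
      (\<exists>j. \<forall>z. U (\<lambda>v. z \<epsilon> val v x \<longrightarrow> G z (v j) v))"

lemma (in zf_model) ex_generic:
  assumes "countable (UNIV :: 'm set)"
  shows "\<exists>U. generic (\<epsilon>) U"
proof -
  have "countable (UNIV :: 'm tm set)"
  proof -
    have "(UNIV :: 'm tm set) \<subseteq> range Par \<union> range Loc \<union> range Nam"
      by (metis (no_types, lifting) UNIV_I Un_iff rangeI subsetI tm.exhaust)
    moreover have "countable (range Par \<union> range Loc \<union> range Nam :: 'm tm set)"
      using assms by (intro countable_Un countable_image) auto
    ultimately show ?thesis by (rule countable_subset)
  qed
  note cDfn = countable_Dfn[OF this]
  \<comment> \<open>Predicates with no, one or two local arguments are images of the countable
    family of all definable ones.\<close>
  have c0: "countable {P. Dfn (\<lambda>u. P)}" (is "countable ?S0")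
  proof (rule countable_subset)
    show "?S0 \<subseteq> (\<lambda>\<Phi>. \<Phi> undefined) ` {\<Phi>. Dfn \<Phi>}"
    proof
      fix P assume "P \<in> ?S0"
      then show "P \<in> (\<lambda>\<Phi>. \<Phi> undefined) ` {\<Phi>. Dfn \<Phi>}"
        by (intro image_eqI[of _ _ "\<lambda>u. P"]) simp_all
    qed
  qed (rule countable_image[OF cDfn])
  have c1: "countable {F. Dfn (\<lambda>u v. F (u 0) v)}" (is "countable ?S1")
  proof (rule countable_subset)
    show "?S1 \<subseteq> (\<lambda>\<Phi> x. \<Phi> (\<lambda>_. x)) ` {\<Phi>. Dfn \<Phi>}"
    proof
      fix F assume "F \<in> ?S1"
      then show "F \<in> (\<lambda>\<Phi> x. \<Phi> (\<lambda>_. x)) ` {\<Phi>. Dfn \<Phi>}"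
        by (intro image_eqI[of _ _ "\<lambda>u v. F (u 0) v"]) simp_all
    qed
  qed (rule countable_image[OF cDfn])
  have c2: "countable {F. Dfn (\<lambda>u v. F (u 0) (u 1) v)}" (is "countable ?S2")
  proof (rule countable_subset)
    show "?S2 \<subseteq> (\<lambda>\<Phi> x y. \<Phi> (case_nat x (\<lambda>_. y))) ` {\<Phi>. Dfn \<Phi>}"
    proof
      fix F assume "F \<in> ?S2"
      then show "F \<in> (\<lambda>\<Phi> x y. \<Phi> (case_nat x (\<lambda>_. y))) ` {\<Phi>. Dfn \<Phi>}"
        by (intro image_eqI[of _ _ "\<lambda>u v. F (u 0) (u 1) v"]) simp_all
    qed
  qed (rule countable_image[OF cDfn])
  have cn: "countable (UNIV :: ('m + nat) set)"
    unfolding UNIV_sum using assms by (intro countable_Un countable_image) simp_all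
  \<comment> \<open>One dense set for each instance of the last six assumptions of
    \<open>generic\<close>.\<close>
  define D1 where "D1 P = {c. forces c P \<or> forces c (\<lambda>v. \<not> P v)}" for P
  define D2 where "D2 x = {c. \<exists>b. forces c (\<lambda>v. val v x \<epsilon> b)}" for x
  define D3 where "D3 F = {c. forces c (\<lambda>v. \<not> (\<exists>y. F y v)) \<or> (\<exists>j. forces c (\<lambda>v. F (v j) v))}"
    for F
  define D4 where "D4 = (\<lambda>(x, a). {c. forces c (\<lambda>v. \<not> val v x \<epsilon> a) \<or> (\<exists>m. forces c (\<lambda>v. val v x = m))})"
  define D5 where "D5 x = {c. \<exists>b. b \<sqsubseteq> om \<and> (\<forall>n. n \<epsilon> om \<longrightarrow> forces c (\<lambda>v. n \<epsilon> val v x \<longleftrightarrow> n \<epsilon> b))}"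
    for x
  define D6 where "D6 = (\<lambda>(x, G). {c. (\<exists>s. Fin s \<and> forces c (\<lambda>v. s \<sqsubseteq> val v x) \<and>
      forces c (\<lambda>v. \<not> (\<exists>y. \<forall>z. z \<epsilon> s \<longrightarrow> G z y v))) \<or>
    (\<exists>j. \<forall>z. forces c (\<lambda>v. z \<epsilon> val v x \<longrightarrow> G z (v j) v))})"
  define DD where "DD = D1 ` ?S0 \<union> range D2 \<union> D3 ` ?S1 \<union> D4 ` (UNIV \<times> {a. Fin a}) \<union> range D5 \<union>
    D6 ` (UNIV \<times> ?S2)"
  have "countable {a. Fin a}" using assms by (rule countable_subset[rotated]) simp
  then have "countable DD"
    unfolding DD_def using c0 c1 c2 cn by (intro countable_Un countable_image countable_SIGMA) auto
  have dense: "\<exists>c'. cond c' \<and> stronger c' c \<and> c' \<in> X" if X: "X \<in> DD" and c: "cond c" for X c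
  proof -
    from X consider (1) P where "Dfn (\<lambda>u. P)" "X = D1 P" | (2) x where "X = D2 x"
      | (3) F where "Dfn (\<lambda>u v. F (u 0) v)" "X = D3 F" | (4) x a where "Fin a" "X = D4 (x, a)"
      | (5) x where "X = D5 x" | (6) x G where "Dfn (\<lambda>u v. G (u 0) (u 1) v)" "X = D6 (x, G)"
      unfolding DD_def by (elim UnE imageE SigmaE) simp_all
    then show ?thesis
    proof cases
      case 1
      show ?thesis using dense_decide[OF c 1(1)] unfolding 1(2) D1_def mem_Collect_eq .
    next
      case 2
      show ?thesis using dense_bounded[OF c dtrm_val] unfolding 2 D2_def mem_Collect_eq .
    next
      case 3
      show ?thesis using dense_witness[OF c 3(1)] unfolding 3(2) D3_def mem_Collect_eq .
    next
      case 4
      show ?thesis using dense_finite[OF c dtrm_val 4(1)] unfolding 4(2) D4_def prod.case mem_Collect_eq .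
    next
      case 5
      show ?thesis using dense_trace[OF c dtrm_val] unfolding 5 D5_def mem_Collect_eq .
    next
      case 6
      show ?thesis using dense_idealization[OF c dtrm_val 6(1)]
        unfolding 6(2) D6_def prod.case mem_Collect_eq .
    qed
  qed
  have "\<exists>c. c 0 = (\<lambda>P. \<exists>v. P v) \<and> (\<forall>n. cond (c n)) \<and> (\<forall>m n. m \<le> n \<longrightarrow> stronger (c n) (c m)) \<and>
    (\<forall>X\<in>DD. \<exists>n :: nat. c n \<in> X)"
    using stronger_refl stronger_trans cond_init \<open>countable DD\<close> dense by (rule generic_chain)
  then obtain c where c: "\<forall>n. cond (c n)" "\<forall>m n. m \<le> n \<longrightarrow> stronger (c n) (c m)"
    "\<forall>X\<in>DD. \<exists>n :: nat. c n \<in> X"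
    by (elim exE conjE) (rule that)
  \<comment> \<open>The union of the increasing chain of filters.\<close>
  define U where "U P \<longleftrightarrow> (\<exists>n. forces (c n) P)" for P
  have UI: "U P" if "forces (c n) P" for n P using that unfolding U_def by blast
  have Uconj: "U (\<lambda>v. P v \<and> Q v)" if PQ: "U P" "U Q" for P Q
  proof -
    obtain m n where mn: "forces (c m) P" "forces (c n) Q" using PQ unfolding U_def by blast
    define k where "k = max m n"
    have "stronger (c k) (c m)" "stronger (c k) (c n)" using c(2) by (simp_all add: k_def)
    then have k: "forces (c k) P" "forces (c k) Q" using mn forces_stronger by blast+
    have "forces (c k) (\<lambda>v. P v \<and> Q v)"
      unfolding forces_def
    proof
      assume "c k (\<lambda>v. \<not> (P v \<and> Q v))"
      then have "c k (\<lambda>v. \<not> P v) \<or> c k (\<lambda>v. \<not> Q v)"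
        by (rule cond_split[OF spec[OF c(1)]]) blast
      then show False using k unfolding forces_def by blast
    qed
    then show ?thesis by (rule UI)
  qed
  have Umono: "U Q" if PQ: "\<forall>v. P v \<longrightarrow> Q v" "U P" for P Q
  proof -
    obtain n where "forces (c n) P" using PQ(2) unfolding U_def by blast
    then have "forces (c n) Q" by (rule forces_mono[OF spec[OF c(1)]]) (use PQ(1) in blast)
    then show ?thesis by (rule UI)
  qed
  have Uproper: "\<not> U (\<lambda>v. False)"
    unfolding U_def forces_def using cond_True[OF spec[OF c(1)]] by simp
  have Uneg: "\<not> U P" if "U (\<lambda>v. \<not> P v)" for P
  proof
    assume "U P"
    from Uconj[OF that this] have "U (\<lambda>v. False)" by simp
    then show False using Uproper by blast
  qed
  have meets: "\<exists>n. c n \<in> X" if "X \<in> DD" for X using c(3) that by blast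
  have "generic (\<epsilon>) U"
  proof (unfold_locales)
    show "U Q" if "\<forall>v. P v \<longrightarrow> Q v" "U P" for P Q using that by (rule Umono)
    show "U (\<lambda>v. P v \<and> Q v)" if "U P" "U Q" for P Q using that by (rule Uconj)
    show "U (\<lambda>v. True)"
      unfolding U_def forces_def using cond_False[OF spec[OF c(1)]] by simp
    show "\<not> U (\<lambda>v. False)" by (rule Uproper)
  next
    fix P assume "Dfn (\<lambda>u. P)"
    then have "D1 P \<in> DD" unfolding DD_def by blast
    then obtain n where "c n \<in> D1 P" using meets by blast
    then show "U P \<or> U (\<lambda>v. \<not> P v)" unfolding D1_def mem_Collect_eq using UI by blast
  next
    fix x
    have "D2 x \<in> DD" unfolding DD_def by blast
    then obtain n where "c n \<in> D2 x" using meets by blast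
    then show "\<exists>b. U (\<lambda>v. val v x \<epsilon> b)" unfolding D2_def mem_Collect_eq using UI by blast
  next
    fix F assume F: "Dfn (\<lambda>u v. F (u 0) v)" "U (\<lambda>v. \<exists>y. F y v)"
    have "D3 F \<in> DD" unfolding DD_def using F(1) by blast
    then obtain n where "c n \<in> D3 F" using meets by blast
    then have "forces (c n) (\<lambda>v. \<not> (\<exists>y. F y v)) \<or> (\<exists>j. forces (c n) (\<lambda>v. F (v j) v))"
      unfolding D3_def mem_Collect_eq .
    then show "\<exists>j. U (\<lambda>v. F (v j) v)"
    proof
      assume "forces (c n) (\<lambda>v. \<not> (\<exists>y. F y v))"
      from Uneg[OF UI[OF this]] F(2) show ?thesis by blast
    next
      assume "\<exists>j. forces (c n) (\<lambda>v. F (v j) v)"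
      then obtain j where "forces (c n) (\<lambda>v. F (v j) v)" ..
      then have "U (\<lambda>v. F (v j) v)" by (rule UI)
      then show ?thesis ..
    qed
  next
    fix a x assume a: "Fin a" "U (\<lambda>v. val v x \<epsilon> a)"
    have "D4 (x, a) \<in> DD" unfolding DD_def using a(1) by blast
    then obtain n where "c n \<in> D4 (x, a)" using meets by blast
    then have "forces (c n) (\<lambda>v. \<not> val v x \<epsilon> a) \<or> (\<exists>m. forces (c n) (\<lambda>v. val v x = m))"
      unfolding D4_def prod.case mem_Collect_eq .
    then show "\<exists>m. U (\<lambda>v. val v x = m)"
    proof
      assume "forces (c n) (\<lambda>v. \<not> val v x \<epsilon> a)"
      from Uneg[OF UI[OF this]] a(2) show ?thesis by blast
    next
      assume "\<exists>m. forces (c n) (\<lambda>v. val v x = m)"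
      then obtain m where "forces (c n) (\<lambda>v. val v x = m)" ..
      then have "U (\<lambda>v. val v x = m)" by (rule UI)
      then show ?thesis ..
    qed
  next
    fix x
    have "D5 x \<in> DD" unfolding DD_def by blast
    then obtain n where "c n \<in> D5 x" using meets by blast
    then obtain b where b: "b \<sqsubseteq> om" "\<forall>k. k \<epsilon> om \<longrightarrow> forces (c n) (\<lambda>v. k \<epsilon> val v x \<longleftrightarrow> k \<epsilon> b)"
      unfolding D5_def by blast
    then have "\<forall>k. k \<epsilon> om \<longrightarrow> U (\<lambda>v. k \<epsilon> val v x \<longleftrightarrow> k \<epsilon> b)" by (intro allI impI UI[of n]) blast
    then show "\<exists>b. b \<sqsubseteq> om \<and> (\<forall>k. k \<epsilon> om \<longrightarrow> U (\<lambda>v. k \<epsilon> val v x \<longleftrightarrow> k \<epsilon> b))"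
      using b(1) by blast
  next
    fix G x assume "Dfn (\<lambda>u v. G (u 0) (u 1) v)"
    then have "D6 (x, G) \<in> DD" unfolding DD_def by blast
    then obtain n where "c n \<in> D6 (x, G)" using meets by blast
    then have "(\<exists>s. Fin s \<and> forces (c n) (\<lambda>v. s \<sqsubseteq> val v x) \<and>
        forces (c n) (\<lambda>v. \<not> (\<exists>y. \<forall>z. z \<epsilon> s \<longrightarrow> G z y v))) \<or>
      (\<exists>j. \<forall>z. forces (c n) (\<lambda>v. z \<epsilon> val v x \<longrightarrow> G z (v j) v))"
      unfolding D6_def prod.case mem_Collect_eq .
    then show "(\<exists>s. Fin s \<and> U (\<lambda>v. s \<sqsubseteq> val v x) \<and> U (\<lambda>v. \<not> (\<exists>y. \<forall>z. z \<epsilon> s \<longrightarrow> G z y v))) \<or>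
      (\<exists>j. \<forall>z. U (\<lambda>v. z \<epsilon> val v x \<longrightarrow> G z (v j) v))"
      by (elim disj_forward ex_forward conj_forward all_forward) (assumption | erule UI)+
  qed
  then show ?thesis by (rule exI[of _ U])
qed

context generic
begin

lemma U_mono:
  assumes "U P" "\<And>v. P v \<Longrightarrow> Q v"
  shows "U Q"
proof -
  have "\<forall>v. P v \<longrightarrow> Q v" using assms(2) by blast
  then show ?thesis using assms(1) by (rule mono)
qed

lemma U_mono2:
  assumes "U P" "U Q" "\<And>v. P v \<Longrightarrow> Q v \<Longrightarrow> R v"
  shows "U R"
  using conj[OF assms(1,2)] by (rule U_mono) (use assms(3) in blast)

lemma U_const [simp]: "U (\<lambda>v. c) \<longleftrightarrow> c"
  by (cases c) (simp_all add: triv proper)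

lemma U_contra:
  assumes "U P" "U (\<lambda>v. \<not> P v)"
  shows False
proof -
  have "U (\<lambda>v. False)" by (rule U_mono2[OF assms]) simp
  then show False by simp
qed

definition N_mem :: "'m + nat \<Rightarrow> 'm + nat \<Rightarrow> bool" where
  "N_mem x y \<longleftrightarrow> U (\<lambda>v. val v x \<epsilon> val v y)"

definition N_eq :: "'m + nat \<Rightarrow> 'm + nat \<Rightarrow> bool" where
  "N_eq x y \<longleftrightarrow> U (\<lambda>v. val v x = val v y)"

definition N_st :: "'m + nat \<Rightarrow> bool" where
  "N_st x \<longleftrightarrow> (\<exists>m. U (\<lambda>v. val v x = m))"

abbreviation NSat :: "(nat \<Rightarrow> 'm + nat) \<Rightarrow> fm \<Rightarrow> bool" where
  "NSat \<equiv> sat N_mem N_eq N_st"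

lemma N_congruence: "congruence N_mem N_eq N_st"
  unfolding congruence_def
proof (intro conjI equivpI reflpI sympI transpI allI impI)
  show "N_eq x x" for x by (simp add: N_eq_def)
  show "N_eq y x" if "N_eq x y" for x y
    using that unfolding N_eq_def by (rule U_mono) simp
  show "N_eq x z" if "N_eq x y" "N_eq y z" for x y z
    using that unfolding N_eq_def by (rule U_mono2) simp
  show "N_mem x' y'" if "N_eq x x'" "N_eq y y'" "N_mem x y" for x x' y y'
  proof -
    have "U (\<lambda>v. val v x = val v x' \<and> val v y = val v y')"
      using that(1,2) unfolding N_eq_def by (rule conj)
    then show ?thesis using that(3) unfolding N_mem_def by (rule U_mono2) simp
  qed
  show "N_st x'" if x: "N_eq x x'" "N_st x" for x x'
  proof -
    obtain m where "U (\<lambda>v. val v x = m)" using x(2) unfolding N_st_def ..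
    then have "U (\<lambda>v. val v x' = m)" using x(1) unfolding N_eq_def by (rule U_mono2) simp
    then show ?thesis unfolding N_st_def ..
  qed
qed

theorem Los: "eps_formula p \<Longrightarrow> NSat e p \<longleftrightarrow> U (\<lambda>v. Sat (\<lambda>n. val v (e n)) p)"
proof (induction p arbitrary: e)
  case (Imp p q)
  have "Dfn (\<lambda>u v. Sat (\<lambda>n. val v (e n)) p)" if "eps_formula p" for p
    using that by (intro DfnI[where p = p and t = "\<lambda>n. tm_of (e n)"]) simp_all
  \<comment> \<open>If the premise is not in \<open>U\<close>, its negation is, and this already
    implies the implication.\<close>
  then have dec: "U (\<lambda>v. Sat (\<lambda>n. val v (e n)) p) \<or> U (\<lambda>v. \<not> Sat (\<lambda>n. val v (e n)) p)"
    using Imp.prems by (intro decides) simp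
  have "(U (\<lambda>v. Sat (\<lambda>n. val v (e n)) p) \<longrightarrow> U (\<lambda>v. Sat (\<lambda>n. val v (e n)) q)) \<longleftrightarrow>
    U (\<lambda>v. Sat (\<lambda>n. val v (e n)) p \<longrightarrow> Sat (\<lambda>n. val v (e n)) q)" (is "?L \<longleftrightarrow> ?R")
  proof
    assume L: ?L
    from dec show ?R
    proof
      assume "U (\<lambda>v. \<not> Sat (\<lambda>n. val v (e n)) p)"
      then show ?R by (rule U_mono) blast
    next
      assume "U (\<lambda>v. Sat (\<lambda>n. val v (e n)) p)"
      with L have "U (\<lambda>v. Sat (\<lambda>n. val v (e n)) q)" by blast
      then show ?R by (rule U_mono) blast
    qed
  next
    assume R: ?R
    show ?L
    proof
      assume "U (\<lambda>v. Sat (\<lambda>n. val v (e n)) p)"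
      with R show "U (\<lambda>v. Sat (\<lambda>n. val v (e n)) q)" by (rule U_mono2) blast
    qed
  qed
  then show ?case using Imp by simp
next
  case (Forall p)
  define F where "F y v \<longleftrightarrow> Sat (case_nat y (\<lambda>n. val v (e n))) p" for y v
  have F: "Dfn (\<lambda>u v. F (u 0) v)"
    unfolding F_def
  proof (rule DfnI[where p = p and t = "case_nat (Loc 0) (\<lambda>n. tm_of (e n))"])
    show "eps_formula p" using Forall.prems by simp
    have "case_nat (u 0) (\<lambda>n. val v (e n)) = (\<lambda>n. tval u v (case_nat (Loc 0) (\<lambda>n. tm_of (e n)) n))"
      for u v
      by (auto split: nat.split)
    then show "Sat (case_nat (u 0) (\<lambda>n. val v (e n))) p =
      Sat (\<lambda>n. tval u v (case_nat (Loc 0) (\<lambda>n. tm_of (e n)) n)) p" for u v by simp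
  qed
  have IH: "NSat (case_nat x e) p \<longleftrightarrow> U (\<lambda>v. F (val v x) v)" for x
    using Forall.IH[of "case_nat x e"] Forall.prems unfolding F_def comp_case_nat by simp
  have "(\<forall>x. U (\<lambda>v. F (val v x) v)) \<longleftrightarrow> U (\<lambda>v. \<forall>y. F y v)"
  proof
    assume all: "\<forall>x. U (\<lambda>v. F (val v x) v)"
    show "U (\<lambda>v. \<forall>y. F y v)"
    proof (rule ccontr)
      assume "\<not> U (\<lambda>v. \<forall>y. F y v)"
      moreover have "Dfn (\<lambda>u v. \<forall>y. F y v)" using F by (intro dfn)
      ultimately have "U (\<lambda>v. \<not> (\<forall>y. F y v))" using decides by blast
      then have "U (\<lambda>v. \<exists>y. \<not> F y v)" by (rule U_mono) blast
      moreover have "Dfn (\<lambda>u v. \<not> F (u 0) v)" using F by (intro dfn)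
      \<comment> \<open>A failure of the universal formula has a name as witness, and this name is
        an element of \<open>N\<close>.\<close>
      ultimately obtain j where j: "U (\<lambda>v. \<not> F (v j) v)"
        using witness[of "\<lambda>y v. \<not> F y v"] by blast
      have "U (\<lambda>v. F (v j) v)" using spec[OF all, of "Inr j"] by simp
      then show False using j by (rule U_contra)
    qed
  next
    assume "U (\<lambda>v. \<forall>y. F y v)"
    then show "\<forall>x. U (\<lambda>v. F (val v x) v)" by (intro allI) (erule U_mono, blast)
  qed
  then show ?case by (simp add: IH F_def)
qed (simp_all add: N_mem_def N_eq_def)

lemma NSat_standard: "eps_formula p \<Longrightarrow> NSat (\<lambda>n. Inl (\<mu> n)) p \<longleftrightarrow> Sat \<mu> p"
  by (simp add: Los)

text \<open>A standard element is equal in \<open>N\<close> to some \<open>Inl m\<close>, and all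
  formulas respect this equality; so only parameters of this form have to be checked.\<close>

lemma NSat_st_closure:
  assumes "\<And>\<mu>. NSat (\<lambda>n. Inl (\<mu> n)) p"
  shows "NSat e (st_closure p)"
  unfolding st_closure_def sat_funpow_AllSt
proof (intro allI impI)
  fix e' assume "\<forall>k<fv_bound p. N_st (e' k)"
  then have "\<forall>k. \<exists>m. k < fv_bound p \<longrightarrow> U (\<lambda>v. val v (e' k) = m)" unfolding N_st_def by blast
  from choice[OF this] obtain \<mu> where
    \<mu>: "\<forall>k. k < fv_bound p \<longrightarrow> U (\<lambda>v. val v (e' k) = \<mu> k)" ..
  define e'' where "e'' k = (if k < fv_bound p then Inl (\<mu> k) else e' k)" for k
  have "NSat e' p = NSat e'' p"
    by (rule sat_congruence[OF N_congruence]) (use \<mu> in \<open>simp add: e''_def N_eq_def\<close>)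
  also have "\<dots> = NSat (\<lambda>n. Inl (\<mu> n)) p"
    by (rule sat_fv_cong) (simp add: e''_def)
  finally show "NSat e' p" using assms by blast
qed

section \<open>Verification of the axioms in \<open>N\<close>\<close>

lemma N_ZF: "p \<in> ZF \<Longrightarrow> NSat e p"
  using Los[OF ZF_eps] ZF by simp

lemma N_Transfer:
  assumes "eps_formula p"
  shows "NSat e (Transfer p)"
  unfolding Transfer_def
proof (rule NSat_st_closure)
  fix \<mu> :: "nat \<Rightarrow> 'm"
  have "NSat (\<lambda>n. Inl (\<mu> n)) (Forall p)" if all: "\<forall>x. N_st x \<longrightarrow> NSat (case_nat x (\<lambda>n. Inl (\<mu> n))) p"
  proof -
    have "Sat (case_nat m \<mu>) p" for m
    proof -
      have "N_st (Inl m)" by (auto simp: N_st_def)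
      then have "NSat (case_nat (Inl m) (\<lambda>n. Inl (\<mu> n))) p" using all by blast
      then have "NSat (\<lambda>n. Inl (case_nat m \<mu> n)) p" by (simp only: comp_case_nat)
      then show ?thesis using NSat_standard[OF assms] by blast
    qed
    then have "Sat \<mu> (Forall p)" by simp
    then show ?thesis using NSat_standard[of "Forall p"] assms by simp
  qed
  then show "NSat (\<lambda>n. Inl (\<mu> n)) (AllSt p \<^bold>\<longrightarrow> Forall p)" by simp
qed

lemma eps_Nat_fm [simp]: "eps_formula (Nat_fm k)"
  by (simp add: Nat_fm_def inductive_fm_def empty_fm_def succ_fm_def subset_fm_def)

lemma eps_subset_fm [simp]: "eps_formula (subset_fm i j)"
  by (simp add: subset_fm_def)

lemma eps_finite_fm [simp]: "eps_formula (finite_fm k)"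
  by (simp add: finite_fm_def bij_fm_def Ex1In_def related_fm_def opair_fm_def upair_fm_def lift_from_def)

lemma NSat_Nat: "NSat e (Nat_fm k) \<longleftrightarrow> U (\<lambda>v. val v (e k) = om)"
  by (simp add: Los Sat_Nat)

lemma NSat_subset: "NSat e (subset_fm i j) \<longleftrightarrow> U (\<lambda>v. val v (e i) \<sqsubseteq> val v (e j))"
  by (simp add: Los Sat_subset)

lemma NSat_finite: "NSat e (finite_fm k) \<longleftrightarrow> U (\<lambda>v. Fin (val v (e k)))"
  by (simp add: Los Sat_finite)

text \<open>Supplies a number outside \<open>s\<close>: from \<open>s \<sqsubseteq> y\<close> it
  follows that \<open>y\<close> is not in \<open>s\<close>, as no set is its own member.\<close>

lemma Fin_bounded:
  assumes "Fin s" "s \<sqsubseteq> om"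
  shows "\<exists>y. y \<epsilon> om \<and> s \<sqsubseteq> y"
proof -
  have "s \<sqsubseteq> om \<longrightarrow> (\<exists>y. y \<epsilon> om \<and> s \<sqsubseteq> y)"
  proof (rule Fin_induct[of "\<lambda>s. s \<sqsubseteq> om \<longrightarrow> (\<exists>y. y \<epsilon> om \<and> s \<sqsubseteq> y)", OF _ assms(1)])
    show "Dfn (\<lambda>u v. u 0 \<sqsubseteq> om \<longrightarrow> (\<exists>y. y \<epsilon> om \<and> u 0 \<sqsubseteq> y))" by (intro dfn)
    show "emp \<sqsubseteq> om \<longrightarrow> (\<exists>y. y \<epsilon> om \<and> emp \<sqsubseteq> y)"
      by (intro impI exI[of _ emp]) simp
  next
    fix s t assume IH: "s \<sqsubseteq> om \<longrightarrow> (\<exists>y. y \<epsilon> om \<and> s \<sqsubseteq> y)"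
    show "ins t s \<sqsubseteq> om \<longrightarrow> (\<exists>y. y \<epsilon> om \<and> ins t s \<sqsubseteq> y)"
    proof
      assume "ins t s \<sqsubseteq> om"
      then have "t \<epsilon> om" "s \<sqsubseteq> om" by (simp_all add: sub_def)
      then obtain y where y: "y \<epsilon> om" "s \<sqsubseteq> y" using IH by blast
      obtain k where "k \<epsilon> om" "y \<sqsubseteq> k" "t \<epsilon> k" using om_sup[OF \<open>t \<epsilon> om\<close> y(1)] by blast
      then show "\<exists>y. y \<epsilon> om \<and> ins t s \<sqsubseteq> y" using y(2) by (intro exI[of _ k]) (simp add: sub_def)
    qed
  qed
  then show ?thesis using assms(2) by blast
qed

lemma N_Nontriviality: "NSat e Nontriviality"
proof -
  define G where "G z y v \<longleftrightarrow> y \<epsilon> om \<and> z \<noteq> y" for z y and v :: "nat \<Rightarrow> 'm"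
  have "Dfn (\<lambda>u v. G (u 0) (u 1) v)" unfolding G_def by (intro dfn)
  from idealization[OF this, of "Inl om"]
  consider s where "Fin s" "s \<sqsubseteq> om" "\<not> (\<exists>y. \<forall>z. z \<epsilon> s \<longrightarrow> y \<epsilon> om \<and> z \<noteq> y)"
    | j where "\<forall>z. U (\<lambda>v. z \<epsilon> om \<longrightarrow> v j \<epsilon> om \<and> z \<noteq> v j)"
    unfolding G_def by auto
  then obtain j where j: "\<forall>z. U (\<lambda>v. z \<epsilon> om \<longrightarrow> v j \<epsilon> om \<and> z \<noteq> v j)"
  proof cases
    case (1 s)
    obtain y where "y \<epsilon> om" "s \<sqsubseteq> y" using Fin_bounded[OF 1(1,2)] by blast
    then have "\<forall>z. z \<epsilon> s \<longrightarrow> y \<epsilon> om \<and> z \<noteq> y" using not_self unfolding sub_def by blast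
    then show ?thesis using 1(3) by blast
  qed
  \<comment> \<open>Any standard number would do in place of \<open>emp\<close>; it only serves to
    extract \<open>v j \<epsilon> om\<close>.\<close>
  have mem: "N_mem (Inr j) (Inl om)"
    unfolding N_mem_def using spec[OF j, of emp] by (rule U_mono) simp
  have "\<not> N_eq x (Inr j)" if x: "N_st x" "N_mem x (Inl om)" for x
  proof
    assume "N_eq x (Inr j)"
    obtain m where m: "U (\<lambda>v. val v x = m)" using x(1) unfolding N_st_def ..
    have "U (\<lambda>v. m \<epsilon> om)" using m x(2) unfolding N_mem_def by (rule U_mono2) simp
    then have "m \<epsilon> om" by simp
    then have "U (\<lambda>v. m \<noteq> v j)" using spec[OF j, of m] by (elim U_mono) simp
    moreover have "U (\<lambda>v. m = v j)"
      using m \<open>N_eq x (Inr j)\<close> unfolding N_eq_def by (rule U_mono2) simp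
    ultimately show False using U_contra by blast
  qed
  then show ?thesis
    unfolding Nontriviality_def using mem
    by (simp add: NSat_Nat) (rule exI[of _ "Inl om"], simp, rule exI[of _ "Inr j"], simp)
qed

lemma N_Standard_Part: "NSat e Standard_Part"
proof -
  have main: "\<exists>b. N_st b \<and> U (\<lambda>v. val v b \<sqsubseteq> om) \<and>
    (\<forall>x. N_st x \<longrightarrow> N_mem x (Inl om) \<longrightarrow> (N_mem x b \<longleftrightarrow> N_mem x a))" for a
  proof -
    obtain b where b: "b \<sqsubseteq> om" "\<forall>n. n \<epsilon> om \<longrightarrow> U (\<lambda>v. n \<epsilon> val v a \<longleftrightarrow> n \<epsilon> b)"
      using trace[of a] by blast
    have "N_mem x (Inl b) \<longleftrightarrow> N_mem x a" if x: "N_st x" "N_mem x (Inl om)" for x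
    proof -
      obtain m where m: "U (\<lambda>v. val v x = m)" using x(1) unfolding N_st_def ..
      have "U (\<lambda>v. m \<epsilon> om)" using m x(2) unfolding N_mem_def by (rule U_mono2) simp
      then have "U (\<lambda>v. m \<epsilon> val v a \<longleftrightarrow> m \<epsilon> b)" using b(2) by simp
      from conj[OF m this] have eq: "U (\<lambda>v. val v x = m \<and> (m \<epsilon> val v a \<longleftrightarrow> m \<epsilon> b))" .
      show ?thesis
        unfolding N_mem_def
      proof
        assume "U (\<lambda>v. val v x \<epsilon> val v (Inl b))"
        with eq show "U (\<lambda>v. val v x \<epsilon> val v a)" by (rule U_mono2) simp
      next
        assume "U (\<lambda>v. val v x \<epsilon> val v a)"
        with eq show "U (\<lambda>v. val v x \<epsilon> val v (Inl b))" by (rule U_mono2) simp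
      qed
    qed
    moreover have "N_st (Inl b)" by (auto simp: N_st_def)
    moreover have "U (\<lambda>v. val v (Inl b) \<sqsubseteq> om)" using b(1) by simp
    ultimately show ?thesis by blast
  qed
  let ?p = "ExSt (subset_fm 0 2 \<^bold>\<and> AllSt (0 \<^bold>\<in> 3 \<^bold>\<longrightarrow> (0 \<^bold>\<in> 1 \<^bold>\<longleftrightarrow> 0 \<^bold>\<in> 2)))"
  have "NSat (case_nat a (case_nat (Inl om) e)) (subset_fm 0 1 \<^bold>\<longrightarrow> ?p)" for a
  proof -
    obtain b where b: "N_st b" "U (\<lambda>v. val v b \<sqsubseteq> om)"
      "\<forall>x. N_st x \<longrightarrow> N_mem x (Inl om) \<longrightarrow> (N_mem x b \<longleftrightarrow> N_mem x a)"
      using main[of a] by blast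
    have "NSat (case_nat a (case_nat (Inl om) e)) ?p"
      using b by (simp add: NSat_subset) (rule exI[of _ b], simp)
    then show ?thesis by (rule sat.simps(5)[THEN iffD2, OF impI])
  qed
  then have "NSat (case_nat (Inl om) e) (Forall (subset_fm 0 1 \<^bold>\<longrightarrow> ?p))"
    by (rule sat.simps(6)[THEN iffD2, OF allI])
  moreover have "NSat (case_nat (Inl om) e) (Nat_fm 0)" by (simp add: NSat_Nat)
  ultimately show ?thesis
    unfolding Standard_Part_def sat.simps(4,5,6) by blast
qed

lemma N_Boundedness: "NSat e Boundedness"
proof -
  have "\<exists>y. N_st y \<and> N_mem x y" for x
  proof -
    obtain b where "U (\<lambda>v. val v x \<epsilon> b)" using bounded ..
    then have "N_mem x (Inl b)" by (simp add: N_mem_def)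
    moreover have "N_st (Inl b)" by (auto simp: N_st_def)
    ultimately show ?thesis by blast
  qed
  then show ?thesis by (simp add: Boundedness_def)
qed

lemma N_Bounded_Idealization:
  assumes p: "eps_formula p"
  shows "NSat e (Bounded_Idealization p)"
  unfolding Bounded_Idealization_def
proof (rule NSat_st_closure)
  fix \<mu> :: "nat \<Rightarrow> 'm"
  let ?e = "\<lambda>n. Inl (\<mu> n) :: 'm + nat"
  define G where "G z y = Sat (case_nat z (case_nat y \<mu>)) p" for z y
  have G: "Dfn (\<lambda>u v. G (u 0) (u 1))"
    unfolding G_def
  proof (rule DfnI[where p = p and t = "case_nat (Loc 0) (case_nat (Loc 1) (\<lambda>n. Par (\<mu> n)))"])
    have "case_nat (u 0) (case_nat (u 1) \<mu>) =
      (\<lambda>n. tval u v (case_nat (Loc 0) (case_nat (Loc 1) (\<lambda>n. Par (\<mu> n))) n))" for u v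
      by (auto split: nat.split)
    then show "Sat (case_nat (u 0) (case_nat (u 1) \<mu>)) p =
      Sat (\<lambda>n. tval u v (case_nat (Loc 0) (case_nat (Loc 1) (\<lambda>n. Par (\<mu> n))) n)) p" for u v
      by simp
  qed (rule p)
  \<comment> \<open>The lifted formula skips the entries for \<open>a\<close> and \<open>A\<close>
    and reads its parameters as before; \<open>env1\<close> is the same with \<open>A\<close>
    alone.\<close>
  have env2: "(\<lambda>n. case_nat x (case_nat y (case_nat a (case_nat A f))) (if n < 2 then n else n + 2)) =
    case_nat x (case_nat y f)" for x y a A and f :: "nat \<Rightarrow> 'c"
    by (auto split: nat.split)
  have env1: "(\<lambda>n. case_nat x (case_nat y (case_nat A f)) (if n < 2 then n else n + 1)) =
    case_nat x (case_nat y f)" for x y A and f :: "nat \<Rightarrow> 'c"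
    by (auto split: nat.split)
  have NG: "NSat (case_nat x (case_nat y ?e)) p \<longleftrightarrow> U (\<lambda>v. G (val v x) (val v y))" for x y
    unfolding Los[OF p] G_def comp_case_nat by simp
  have L: "NSat (case_nat a (case_nat A ?e)) (Exists (AllIn 1 (lift_from 2 2 p))) \<longleftrightarrow>
    (\<exists>y. \<forall>x. N_mem x a \<longrightarrow> U (\<lambda>v. G (val v x) (val v y)))" for a A
    by (simp add: lift_from_def sat_ren env2[unfolded One_nat_def] NG[symmetric] del: One_nat_def)
       (simp add: env2 NG)
  have R: "NSat (case_nat A ?e) (Exists (AllSt (0 \<^bold>\<in> 2 \<^bold>\<longrightarrow> lift_from 2 1 p))) \<longleftrightarrow>
    (\<exists>y. \<forall>x. N_st x \<longrightarrow> N_mem x A \<longrightarrow> U (\<lambda>v. G (val v x) (val v y)))" for A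
    by (simp add: lift_from_def sat_ren env1[unfolded One_nat_def] NG) blast
  have main: "(\<forall>a. N_st a \<longrightarrow> U (\<lambda>v. Fin (val v a)) \<and> U (\<lambda>v. val v a \<sqsubseteq> val v A) \<longrightarrow>
      (\<exists>y. \<forall>x. N_mem x a \<longrightarrow> U (\<lambda>v. G (val v x) (val v y)))) \<longleftrightarrow>
    (\<exists>y. \<forall>x. N_st x \<longrightarrow> N_mem x A \<longrightarrow> U (\<lambda>v. G (val v x) (val v y)))" (is "?l \<longleftrightarrow> ?r") for A
  proof
    assume l: ?l
    have "Dfn (\<lambda>u v. (\<lambda>z y v. G z y) (u 0) (u 1) v)" using G by simp
    from idealization[OF this, of A]
    show ?r
    proof
      assume "\<exists>s. Fin s \<and> U (\<lambda>v. s \<sqsubseteq> val v A) \<and> U (\<lambda>v. \<not> (\<exists>y. \<forall>z. z \<epsilon> s \<longrightarrow> G z y))"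
      then obtain s where s: "Fin s" "U (\<lambda>v. s \<sqsubseteq> val v A)" "\<not> (\<exists>y. \<forall>z. z \<epsilon> s \<longrightarrow> G z y)"
        unfolding U_const by (elim exE conjE) (rule that)
      have "N_st (Inl s)" by (auto simp: N_st_def)
      moreover have "U (\<lambda>v. Fin (val v (Inl s))) \<and> U (\<lambda>v. val v (Inl s) \<sqsubseteq> val v A)"
        using s(1,2) by simp
      ultimately have "\<exists>y. \<forall>x. N_mem x (Inl s) \<longrightarrow> U (\<lambda>v. G (val v x) (val v y))"
        by (rule l[THEN spec, THEN mp, THEN mp])
      then obtain y where y: "\<forall>x. N_mem x (Inl s) \<longrightarrow> U (\<lambda>v. G (val v x) (val v y))" ..
      \<comment> \<open>If no \<open>y\<close> solves all of \<open>s\<close>, some name is a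
        counterexample to this \<open>y\<close>. It is an element of \<open>N\<close> that belongs
        to \<open>s\<close>, so the hypothesis applies to it.\<close>
      define F where "F z v \<longleftrightarrow> z \<epsilon> s \<and> \<not> G z (val v y)" for z v
      have F: "Dfn (\<lambda>u v. F (u 0) v)"
        unfolding F_def by (intro dfn Dfn_app2[OF G])
      have "U (\<lambda>v. \<exists>z. F z v)" by (rule U_mono[OF triv]) (use s(3) in \<open>unfold F_def, blast\<close>)
      from witness[OF F this] obtain j where j: "U (\<lambda>v. F (v j) v)" ..
      then have "N_mem (Inr j) (Inl s)" unfolding N_mem_def F_def by (rule U_mono) simp
      then have "U (\<lambda>v. G (val v (Inr j)) (val v y))" using y by blast
      from U_mono2[OF j this, of "\<lambda>v. False"] have "U (\<lambda>v. False)" by (simp add: F_def)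
      then show ?r by simp
    next
      assume "\<exists>j. \<forall>z. U (\<lambda>v. z \<epsilon> val v A \<longrightarrow> G z (v j))"
      then obtain j where j: "\<forall>z. U (\<lambda>v. z \<epsilon> val v A \<longrightarrow> G z (v j))" ..
      have "U (\<lambda>v. G (val v x) (val v (Inr j)))" if x: "N_st x" "N_mem x A" for x
      proof -
        obtain m where m: "U (\<lambda>v. val v x = m)" using x(1) unfolding N_st_def ..
        from conj[OF m spec[OF j, of m]] x(2) show ?thesis
          unfolding N_mem_def by (rule U_mono2) simp
      qed
      then show ?r by (intro exI[of _ "Inr j"]) simp
    qed
  next
    assume ?r
    then obtain y where y: "\<forall>x. N_st x \<longrightarrow> N_mem x A \<longrightarrow> U (\<lambda>v. G (val v x) (val v y))" ..
    show ?l
    proof (intro allI impI exI[of _ y])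
      fix a x assume a: "N_st a" "U (\<lambda>v. Fin (val v a)) \<and> U (\<lambda>v. val v a \<sqsubseteq> val v A)" "N_mem x a"
      obtain s where s: "U (\<lambda>v. val v a = s)" using a(1) unfolding N_st_def ..
      have "U (\<lambda>v. Fin s)" using s conjunct1[OF a(2)] by (rule U_mono2) simp
      then have "Fin s" unfolding U_const .
      moreover have "U (\<lambda>v. val v x \<epsilon> s)" using s a(3) unfolding N_mem_def by (rule U_mono2) simp
      \<comment> \<open>The converse direction rests on this: members of a standard finite set are
        standard.\<close>
      ultimately have "N_st x" unfolding N_st_def by (rule finite)
      moreover have "N_mem x A"
        using a(3) conjunct2[OF a(2)] unfolding N_mem_def by (rule U_mono2) (simp add: sub_def)
      ultimately show "U (\<lambda>v. G (val v x) (val v y))" using y by blast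
    qed
  qed
  have all: "NSat (case_nat A ?e) (AllSt (finite_fm 0 \<^bold>\<and> subset_fm 0 1 \<^bold>\<longrightarrow> q)) \<longleftrightarrow>
    (\<forall>a. N_st a \<longrightarrow> U (\<lambda>v. Fin (val v a)) \<and> U (\<lambda>v. val v a \<sqsubseteq> val v A) \<longrightarrow>
      NSat (case_nat a (case_nat A ?e)) q)" for A q
    by (simp add: NSat_finite NSat_subset)
  have "NSat (case_nat A ?e)
      (AllSt (finite_fm 0 \<^bold>\<and> subset_fm 0 1 \<^bold>\<longrightarrow> Exists (AllIn 1 (lift_from 2 2 p)))) \<longleftrightarrow>
    NSat (case_nat A ?e) (Exists (AllSt (0 \<^bold>\<in> 2 \<^bold>\<longrightarrow> lift_from 2 1 p)))" for A
    unfolding all L R by (rule main)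
  then have "NSat (case_nat A ?e)
      (AllSt (finite_fm 0 \<^bold>\<and> subset_fm 0 1 \<^bold>\<longrightarrow> Exists (AllIn 1 (lift_from 2 2 p)))
       \<^bold>\<longleftrightarrow> Exists (AllSt (0 \<^bold>\<in> 2 \<^bold>\<longrightarrow> lift_from 2 1 p)))" for A
    by (rule sat_iff[THEN iffD2])
  then show "NSat ?e (Forall
      (AllSt (finite_fm 0 \<^bold>\<and> subset_fm 0 1 \<^bold>\<longrightarrow> Exists (AllIn 1 (lift_from 2 2 p)))
       \<^bold>\<longleftrightarrow> Exists (AllSt (0 \<^bold>\<in> 2 \<^bold>\<longrightarrow> lift_from 2 1 p))))"
    by (rule sat.simps(6)[THEN iffD2, OF allI])
qed

lemma N_model: "p \<in> SPOT \<union> {Boundedness} \<union> BI' \<Longrightarrow> NSat e p"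
  unfolding SPOT_def BI'_def
  by (auto intro: N_ZF N_Transfer N_Nontriviality N_Standard_Part N_Boundedness N_Bounded_Idealization)

end

theorem theoremC:
  fixes \<theta> :: fm
  assumes "eps_formula \<theta>" and "sentence \<theta>"
    and "SPOT \<union> {Boundedness} \<union> BI' \<turnstile>\<^sub>s\<^sub>t \<theta>"
  shows "ZF \<turnstile>\<^sub>\<in> \<theta>"
proof (rule ccontr)
  assume "\<not> ZF \<turnstile>\<^sub>\<in> \<theta>"
  from this assms(1,2) obtain E :: "nat \<Rightarrow> nat \<Rightarrow> bool" where
    E: "\<And>p e. p \<in> ZF \<Longrightarrow> sat E (=) (\<lambda>_. True) e p" "\<And>e. \<not> sat E (=) (\<lambda>_. True) e \<theta>"
    by (rule ZF_completeness) (rule that)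
  interpret zf_model E by standard (rule E(1))
  obtain U where "generic E U" using ex_generic[OF countableI_type] ..
  then interpret generic E U .
  \<comment> \<open>Soundness gives \<open>\<theta>\<close> in \<open>N\<close>; in an environment
    of elements of \<open>M\<close>, Los's theorem brings it down to \<open>M\<close>, where it
    fails.\<close>
  have "NSat e \<theta>" for e
    using assms(3) unfolding proves_st_def by (rule soundness[OF _ N_congruence N_model])
  then have "Sat (\<lambda>_. undefined) \<theta>" using NSat_standard[OF assms(1)] by blast
  then show False using E(2) by blast
qed

end
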